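(* Let $0\le l<k$ be integers. (1) If $G\in C^0(B_r\times X^{l},L_{k-l}(X^{k-l};X))$, $\xi_i\in C^0(B_r,X)$ for each $i=1,\dots,k$ and $A_{l+i}\in C^0(B_r,L(X))$ for each $i=1,\dots,k-l$, then $$\hat P_{(\xi_{l+1},\dots,\xi_k)}[G(s;\xi_1,\dots,\xi_l)\circ(A_{l+1}\otimes\dots\otimes A_k)](v)$$ belongs to $C^0(B_r\times C^0(B_r,X)^{l},C^0(B_r,X))$ as a function of $v,\xi_1,\dots,\xi_l$ for each fixed $\xi_{l+1},\dots,\xi_k$ (that is, it is jointly continuous in $(v,\xi_1,\dots,\xi_l)\in B_r\times C^0(B_r,X)^l$; equivalently, it defines a continuous map of $(\xi_1,\dots,\xi_l)$ into $C^0(B_r,X)$), and $\hat P$ is of class $C^\infty$ in $\xi_{l+1},\dots,\xi_k$. (2) Moreover, if $G$ is of class of smoothness $C^m$ in the arguments $\xi_1,\dots,\xi_l$, then $\hat P_{(\xi_{l+1},\dots,\xi_k)}G$ is also of class of smoothness $C^m$ in $\xi_1,\dots,\xi_l$.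
   Context: $\mathbf K$ is a local field containing $\mathbf Q_p$; $X=c_0(\alpha,\mathbf K)$ for an ordinal $\alpha$ (families $(x_j)_{j\in\alpha}$ with $\{j:|x_j|>\epsilon\}$ finite for every $\epsilon>0$, sup norm); $B_r$ is a closed ball in $\mathbf K$ of radius $r>0$ containing $t_0$. $C^0(M,Z)$ denotes continuous maps $M\to Z$; $C^0(B_r,X)$ carries the supremum norm. Powers are Cartesian products with the maximum norm. $L(X)$ is the space of bounded linear operators; $L_{k-l}(X^{k-l};X)$ is the space of continuous $(k-l)$-linear operators $X^{k-l}\to X$ with the operator norm. $G(v;\xi_1,\dots,\xi_l)$ is short for $G(v;\xi_1(v),\dots,\xi_l(v))$. Approximation of the identity: fixed maps $\sigma_n:B_r\to B_r$, $n=0,1,2,\dots$, with $\sigma_0\equiv t_0$; $\sigma_m\circ\sigma_n=\sigma_n\circ\sigma_m$ for $m\ge n$; and for some $0<\rho<1$ and all $n\ge1$: $|x-y|<\rho^n$ implies $\sigma_n(x)=\sigma_n(y)$, and $|\sigma_n(x)-x|<\rho^n$. Antiderivation: with $v_n=\sigma_n(v)$, $$\hat P_{(\xi_{l+1},\dots,\xi_k)}[G(s;\xi_1,\dots,\xi_l)\circ(A_{l+1}\otimes\dots\otimes A_k)](v):=\sum_{n=0}^\infty G(v_n;\xi_1(v_n),\dots,\xi_l(v_n)).\big(A_{l+1}(v_n)[\xi_{l+1}(v_{n+1})-\xi_{l+1}(v_n)],\dots,A_k(v_n)[\xi_k(v_{n+1})-\xi_k(v_n)]\big).$$ Smoothness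 is in the sense of difference quotients: for $\phi$ on an open subset of a normed space, $\bar\Phi^1\phi(x;h;\zeta)$ is the continuous extension to $\zeta=0$ of $(\phi(x+\zeta h)-\phi(x))/\zeta$, and $\bar\Phi^n\phi(x;h_1,\dots,h_n;\zeta_1,\dots,\zeta_n)$ is the continuous extension of $[\bar\Phi^{n-1}\phi(x+\zeta_nh_n;h_1,\dots,h_{n-1};\zeta_1,\dots,\zeta_{n-1})-\bar\Phi^{n-1}\phi(x;h_1,\dots,h_{n-1};\zeta_1,\dots,\zeta_{n-1})]/\zeta_n$; $\phi\in C^m$ if $\bar\Phi^n\phi$ exists and is continuous for all $n\le m$, and $C^\infty=\bigcap_mC^m$. For $G$, "of class $C^m$ in $\xi_1,\dots,\xi_l$" means that these difference quotients in the variables in $X^l$ exist and are continuous jointly with $v\in B_r$. *)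

theory Defs
  imports "HOL-Analysis.Analysis" "HOL-Library.Function_Algebras"
begin

section \<open>Local fields\<close>

text \<open>The constant \<open>norm\<close> of the library is confined to real normed vector spaces.\<close>
class nonarch_valued_field = field + metric_space +
  fixes vabs :: "'a \<Rightarrow> real"
  assumes dist_vabs: "dist x y = vabs (x - y)"
    and vabs_mult: "vabs (x * y) = vabs x * vabs y"
    and vabs_ultrametric: "vabs (x + y) \<le> max (vabs x) (vabs y)"

class nonarch_local_field = nonarch_valued_field +
  assumes vabs_nontrivial: "\<exists>x. x \<noteq> 0 \<and> vabs x < 1"
    and locally_compact: "\<exists>U K. open U \<and> compact K \<and> x \<in> U \<and> U \<subseteq> K"

definition padic_abs :: "nat \<Rightarrow> rat \<Rightarrow> real" where
  "padic_abs p q =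
     (if q = 0 then 0
      else case quotient_of q of (a, b) \<Rightarrow>
        real p powi (int (multiplicity (int p) b) - int (multiplicity (int p) a)))"

text \<open>
  The set \<open>F\<close> is a completion of the rationals with respect to the \<open>p\<close>-adic absolute value,
  that is, a copy of the \<open>p\<close>-adic numbers. The exponent \<open>s\<close> admits every normalization
  of the absolute value of the local field.
\<close>
definition contains_Qp :: "nat \<Rightarrow> 'k::{nonarch_local_field, field_char_0} itself \<Rightarrow> bool" where
  "contains_Qp p _ \<longleftrightarrow>
     (\<exists>F :: 'k set. complete F \<and> range of_rat \<subseteq> F \<and> F \<subseteq> closure (range of_rat) \<and>
        (\<exists>s>0. \<forall>q. vabs (of_rat q :: 'k) = padic_abs p q powr s))"


section \<open>Normed spaces over a valued field\<close>

text \<open>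
  A normed space is a carrier with a scalar multiplication and a norm; its addition is the one of
  the ambient type. All spaces below consist of functions, which are normalized to vanish
  outside their domain, so that addition is the pointwise addition of the ambient function type.
\<close>
record ('k, 'e) nspace =
  vecs :: "'e set"
  scl :: "'k \<Rightarrow> 'e \<Rightarrow> 'e"
  nrm :: "'e \<Rightarrow> real"

text \<open>
  The conditional only makes the distance nonnegative off the carrier, where the formulas
  for the norms below are meaningless.
\<close>
definition ndist :: "('k, 'e::ab_group_add) nspace \<Rightarrow> 'e \<Rightarrow> 'e \<Rightarrow> real" where
  "ndist E x y = (if x \<in> vecs E \<and> y \<in> vecs E then nrm E (x - y) else 0)"

definition ntop :: "('k, 'e::ab_group_add) nspace \<Rightarrow> 'e topology" where
  "ntop E = Metric_space.mtopology (vecs E) (ndist E)"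

definition scalars :: "('k::nonarch_valued_field, 'k) nspace" where
  "scalars = \<lparr>vecs = UNIV, scl = (*), nrm = vabs\<rparr>"

text \<open>The space \<open>c\<^sub>0(J, K)\<close>; as \<open>x\<close> vanishes off \<open>J\<close>, its sup norm may be taken over the whole type.\<close>
definition c0_space :: "'j set \<Rightarrow> ('k::nonarch_valued_field, 'j \<Rightarrow> 'k) nspace" where
  "c0_space J =
     \<lparr>vecs = {x. (\<forall>j. j \<notin> J \<longrightarrow> x j = 0) \<and> (\<forall>\<epsilon>>0. finite {j \<in> J. vabs (x j) > \<epsilon>})},
      scl = (\<lambda>c x j. c * x j),
      nrm = (\<lambda>x. SUP j. vabs (x j))\<rparr>"

text \<open>The power of \<open>E\<close> with index set \<open>I\<close> (the zero space if \<open>I\<close> is empty).\<close>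
definition pow_space ::
  "nat set \<Rightarrow> ('k, 'e::ab_group_add) nspace \<Rightarrow> ('k, nat \<Rightarrow> 'e) nspace" where
  "pow_space I E =
     \<lparr>vecs = {x. (\<forall>i\<in>I. x i \<in> vecs E) \<and> (\<forall>i. i \<notin> I \<longrightarrow> x i = 0)},
      scl = (\<lambda>c x i. scl E c (x i)),
      nrm = (\<lambda>x. Max (insert 0 ((\<lambda>i. nrm E (x i)) ` I)))\<rparr>"

text \<open>Continuous maps on a nonempty compact set \<open>B\<close>, with the supremum norm.\<close>
definition C0_space ::
  "'k::nonarch_valued_field set \<Rightarrow> ('k, 'e::ab_group_add) nspace \<Rightarrow> ('k, 'k \<Rightarrow> 'e) nspace" where
  "C0_space B E =
     \<lparr>vecs = {f. continuous_map (top_of_set B) (ntop E) f \<and> (\<forall>v. v \<notin> B \<longrightarrow> f v = 0)},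
      scl = (\<lambda>c f v. scl E c (f v)),
      nrm = (\<lambda>f. SUP v\<in>B. nrm E (f v))\<rparr>"

text \<open>
  Bounded linear operators on \<open>E\<close>, and continuous multilinear operators on the power of \<open>E\<close> with
  index set \<open>I\<close>, with the operator norms. Vanishing denominators contribute
  \<open>0\<close> to the suprema, by \<open>a / 0 = 0\<close>.
\<close>
definition lin_space ::
  "('k, 'e::ab_group_add) nspace \<Rightarrow> ('k, 'e \<Rightarrow> 'e) nspace" where
  "lin_space E =
     \<lparr>vecs = {T. (\<forall>x\<in>vecs E. T x \<in> vecs E) \<and> (\<forall>x. x \<notin> vecs E \<longrightarrow> T x = 0) \<and>
        (\<forall>x\<in>vecs E. \<forall>y\<in>vecs E. T (x + y) = T x + T y) \<and>
        (\<forall>c. \<forall>x\<in>vecs E. T (scl E c x) = scl E c (T x)) \<and>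
        (\<exists>C. \<forall>x\<in>vecs E. nrm E (T x) \<le> C * nrm E x)},
      scl = (\<lambda>c T x. scl E c (T x)),
      nrm = (\<lambda>T. SUP x\<in>vecs E. nrm E (T x) / nrm E x)\<rparr>"

definition mult_space ::
  "nat set \<Rightarrow> ('k, 'e::ab_group_add) nspace \<Rightarrow> ('k, 'f::ab_group_add) nspace
    \<Rightarrow> ('k, (nat \<Rightarrow> 'e) \<Rightarrow> 'f) nspace" where
  "mult_space I E F =
     \<lparr>vecs = {T. continuous_map (ntop (pow_space I E)) (ntop F) T \<and>
        (\<forall>x. x \<notin> vecs (pow_space I E) \<longrightarrow> T x = 0) \<and>
        (\<forall>x\<in>vecs (pow_space I E). \<forall>i\<in>I. \<forall>a\<in>vecs E. \<forall>b\<in>vecs E.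
           T (x(i := a + b)) = T (x(i := a)) + T (x(i := b))) \<and>
        (\<forall>x\<in>vecs (pow_space I E). \<forall>i\<in>I. \<forall>c. \<forall>a\<in>vecs E.
           T (x(i := scl E c a)) = scl F c (T (x(i := a))))},
      scl = (\<lambda>c T x. scl F c (T x)),
      nrm = (\<lambda>T. SUP x\<in>vecs (pow_space I E). nrm F (T x) / (\<Prod>i\<in>I. nrm E (x i)))\<rparr>"

definition nsums :: "('k, 'e::ab_group_add) nspace \<Rightarrow> (nat \<Rightarrow> 'e) \<Rightarrow> 'e \<Rightarrow> bool" where
  "nsums E f s \<longleftrightarrow> limitin (ntop E) (\<lambda>N. \<Sum>n<N. f n) s sequentially"

definition nsuminf :: "('k, 'e::ab_group_add) nspace \<Rightarrow> (nat \<Rightarrow> 'e) \<Rightarrow> 'e" where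
  "nsuminf E f = (THE s. nsums E f s)"


section \<open>Smoothness by difference quotients\<close>

definition dq_top ::
  "'v topology \<Rightarrow> ('k::nonarch_valued_field, 'e::ab_group_add) nspace \<Rightarrow> nat
    \<Rightarrow> ('v \<times> 'e \<times> (nat \<Rightarrow> 'e) \<times> (nat \<Rightarrow> 'k)) topology" where
  "dq_top T E n =
     prod_topology T (prod_topology (ntop E)
       (prod_topology (ntop (pow_space {1..n} E)) (ntop (pow_space {1..n} scalars))))"

text \<open>
  For a map \<open>\<phi> v x\<close> with a parameter \<open>v\<close> in the topological space \<open>T\<close> and \<open>x\<close> in the
  normed space \<open>E\<close>, \<open>diff_quot T E F \<phi> n \<Phi>\<close> says that \<open>\<Phi> (v, x, h, \<zeta>)\<close> is the \<open>n\<close>-th extended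
  difference quotient of \<open>\<phi>\<close> with respect to \<open>x\<close>, with increments \<open>h 1, \<dots>, h n\<close> and scalars
  \<open>\<zeta> 1, \<dots>, \<zeta> n\<close>, and that it is jointly continuous. Since \<open>\<phi>\<close> is defined on the whole of \<open>E\<close>, there
  is no restriction on the arguments. Updating the last entry by \<open>0\<close> truncates a tuple.
\<close>
primrec diff_quot ::
  "'v topology \<Rightarrow> ('k::nonarch_valued_field, 'e::ab_group_add) nspace
    \<Rightarrow> ('k, 'f::ab_group_add) nspace \<Rightarrow> ('v \<Rightarrow> 'e \<Rightarrow> 'f)
    \<Rightarrow> nat \<Rightarrow> ('v \<times> 'e \<times> (nat \<Rightarrow> 'e) \<times> (nat \<Rightarrow> 'k) \<Rightarrow> 'f) \<Rightarrow> bool" where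
  "diff_quot T E F \<phi> 0 \<Phi> \<longleftrightarrow>
     continuous_map (dq_top T E 0) (ntop F) \<Phi> \<and>
     (\<forall>v\<in>topspace T. \<forall>x\<in>vecs E. \<Phi> (v, x, 0, 0) = \<phi> v x)"
| "diff_quot T E F \<phi> (Suc n) \<Phi> \<longleftrightarrow>
     continuous_map (dq_top T E (Suc n)) (ntop F) \<Phi> \<and>
     (\<exists>\<Psi>. diff_quot T E F \<phi> n \<Psi> \<and>
       (\<forall>v\<in>topspace T. \<forall>x\<in>vecs E. \<forall>h\<in>vecs (pow_space {1..Suc n} E).
        \<forall>\<zeta>\<in>vecs (pow_space {1..Suc n} scalars). \<zeta> (Suc n) \<noteq> 0 \<longrightarrow>
          \<Phi> (v, x, h, \<zeta>) = scl F (inverse (\<zeta> (Suc n)))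
            (\<Psi> (v, x + scl E (\<zeta> (Suc n)) (h (Suc n)), h(Suc n := 0), \<zeta>(Suc n := 0))
             - \<Psi> (v, x, h(Suc n := 0), \<zeta>(Suc n := 0)))))"

text \<open>The class \<open>C\<^sup>m\<close> in \<open>x\<close>, jointly with the parameter; \<open>m = \<infinity>\<close> is allowed.\<close>
definition smooth_param ::
  "enat \<Rightarrow> 'v topology \<Rightarrow> ('k::nonarch_valued_field, 'e::ab_group_add) nspace
    \<Rightarrow> ('k, 'f::ab_group_add) nspace \<Rightarrow> ('v \<Rightarrow> 'e \<Rightarrow> 'f) \<Rightarrow> bool" where
  "smooth_param m T E F \<phi> \<longleftrightarrow> (\<forall>n. enat n \<le> m \<longrightarrow> (\<exists>\<Phi>. diff_quot T E F \<phi> n \<Phi>))"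

text \<open>No parameter, i.e. a parameter from a one-point space.\<close>
definition smooth ::
  "enat \<Rightarrow> ('k::nonarch_valued_field, 'e::ab_group_add) nspace
    \<Rightarrow> ('k, 'f::ab_group_add) nspace \<Rightarrow> ('e \<Rightarrow> 'f) \<Rightarrow> bool" where
  "smooth m E F \<phi> \<longleftrightarrow> smooth_param m (discrete_topology {()}) E F (\<lambda>_. \<phi>)"


section \<open>The antiderivation\<close>

definition approx_identity ::
  "'k::nonarch_valued_field set \<Rightarrow> 'k \<Rightarrow> (nat \<Rightarrow> 'k \<Rightarrow> 'k) \<Rightarrow> bool" where
  "approx_identity B t\<^sub>0 \<sigma> \<longleftrightarrow>
     (\<forall>n. \<forall>v\<in>B. \<sigma> n v \<in> B) \<and>
     (\<forall>v\<in>B. \<sigma> 0 v = t\<^sub>0) \<and>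
     (\<forall>m n. n \<le> m \<longrightarrow> (\<forall>v\<in>B. \<sigma> m (\<sigma> n v) = \<sigma> n (\<sigma> m v))) \<and>
     (\<exists>\<rho>. 0 < \<rho> \<and> \<rho> < 1 \<and>
       (\<forall>n\<ge>1. (\<forall>x\<in>B. \<forall>y\<in>B. vabs (x - y) < \<rho> ^ n \<longrightarrow> \<sigma> n x = \<sigma> n y) \<and>
              (\<forall>x\<in>B. vabs (\<sigma> n x - x) < \<rho> ^ n)))"

text \<open>
  The \<open>n\<close>-th term of the series at \<open>v\<close>. Here \<open>\<xi>\<close> is the tuple of the functions on which \<open>G\<close>
  depends, and \<open>\<eta>\<close> is the tuple, indexed by \<open>I\<close>, of the functions that the
  antiderivation is taken with respect to.
\<close>
definition antider_term ::
  "nat set \<Rightarrow> (nat \<Rightarrow> 'k \<Rightarrow> 'k) \<Rightarrow> ('k \<Rightarrow> (nat \<Rightarrow> 'e) \<Rightarrow> (nat \<Rightarrow> 'e) \<Rightarrow> 'e)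
    \<Rightarrow> (nat \<Rightarrow> 'k \<Rightarrow> 'e \<Rightarrow> 'e) \<Rightarrow> (nat \<Rightarrow> 'k \<Rightarrow> 'e) \<Rightarrow> (nat \<Rightarrow> 'k \<Rightarrow> 'e) \<Rightarrow> 'k \<Rightarrow> nat
    \<Rightarrow> 'e::ab_group_add" where
  "antider_term I \<sigma> G A \<xi> \<eta> v n =
     G (\<sigma> n v) (\<lambda>i. \<xi> i (\<sigma> n v))
       (\<lambda>i. if i \<in> I then A i (\<sigma> n v) (\<eta> i (\<sigma> (Suc n) v) - \<eta> i (\<sigma> n v)) else 0)"

definition antider ::
  "'k set \<Rightarrow> ('k, 'e) nspace \<Rightarrow> nat set \<Rightarrow> (nat \<Rightarrow> 'k \<Rightarrow> 'k)
    \<Rightarrow> ('k \<Rightarrow> (nat \<Rightarrow> 'e) \<Rightarrow> (nat \<Rightarrow> 'e) \<Rightarrow> 'e)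
    \<Rightarrow> (nat \<Rightarrow> 'k \<Rightarrow> 'e \<Rightarrow> 'e) \<Rightarrow> (nat \<Rightarrow> 'k \<Rightarrow> 'e) \<Rightarrow> (nat \<Rightarrow> 'k \<Rightarrow> 'e) \<Rightarrow> 'k
    \<Rightarrow> 'e::ab_group_add" where
  "antider B X I \<sigma> G A \<xi> \<eta> v =
     (if v \<in> B then nsuminf X (antider_term I \<sigma> G A \<xi> \<eta> v) else 0)"

end

theory Submission
  imports Defs
begin

text \<open>
  Write \<open>\<tau> s t = G(s, \<xi>(s)).(A\<^sub>i(s)[\<eta>\<^sub>i(t) - \<eta>\<^sub>i(s)])\<^sub>i\<close>. The \<open>n\<close>-th term of the series at \<open>v\<close> is
  \<open>\<tau> (\<sigma>\<^sub>n v) (\<sigma>\<^sub>n\<^sub>+\<^sub>1 v)\<close>, and only two properties of \<open>\<tau>\<close> matter: it is jointly continuous in \<open>s\<close>,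
  \<open>t\<close> and every parameter on which \<open>G\<close>, \<open>\<xi>\<close> and \<open>\<eta>\<close> depend continuously, and it vanishes for \<open>s = t\<close>,
  because there is at least one increment (\<open>l < k\<close>). The ball is compact, as the field is locally
  compact. Hence \<open>\<tau>\<close> is uniformly small near the diagonal, and since \<open>\<sigma>\<^sub>n v\<close> and \<open>\<sigma>\<^sub>n\<^sub>+\<^sub>1 v\<close> approach
  each other uniformly in \<open>v\<close>, the terms tend to \<open>0\<close> uniformly; in a complete ultrametric space
  this gives uniform convergence. Moreover, when the parameter \<open>w\<close> is close to \<open>w\<^sub>0\<close>, the tube lemma bounds the
  change of \<open>\<tau>\<close> by \<open>\<epsilon>\<close> uniformly on the square of the ball. So each term changes by at most \<open>\<epsilon>\<close>, and by the
  ultrametric inequality so does the whole sum. This is \<open>continuous_map_increment_series\<close>; its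
  consequence \<open>continuous_map_antider\<close>, with an arbitrary topological space of parameters, yields all the
  continuity assertions of the theorem.

  The antiderivation is multilinear in \<open>\<eta>\<close>, and continuous in \<open>\<eta>\<close> by the same result. A
  continuous multilinear operator is of class \<open>C\<^sup>\<infinity>\<close> (\<open>smooth_multilinear\<close>): its difference quotients
  of every order are sums of values of the operator itself, so that the
  division by the scalar can be carried out explicitly.

  Finally, the antiderivation is linear in \<open>G\<close>, so forming difference quotients in \<open>\<xi>\<close> commutes
  with it: the antiderivation of the \<open>n\<close>-th extended difference quotient of \<open>G\<close>, evaluated
  along the functions \<open>\<xi>, h\<^sub>1, \<dots>, h\<^sub>n\<close>, is the \<open>n\<close>-th extended difference quotient of the antiderivation
  (\<open>diff_quot_antider\<close>). Its continuity, also where a scalar vanishes, is again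
  \<open>continuous_map_antider\<close>, with the arguments of the difference quotient as parameters.
\<close>

section \<open>Non-archimedean absolute values\<close>

lemma vabs_zero [simp]: "vabs (0::'k::nonarch_valued_field) = 0"
  by (metis dist_self diff_self dist_vabs)

lemma vabs_eq_0 [simp]: "vabs (x::'k::nonarch_valued_field) = 0 \<longleftrightarrow> x = 0"
  by (metis dist_eq_0_iff diff_zero dist_vabs)

lemma vabs_nonneg [simp]: "0 \<le> vabs (x::'k::nonarch_valued_field)"
  by (metis diff_zero dist_vabs zero_le_dist)

lemma vabs_pos [simp]: "0 < vabs (x::'k::nonarch_valued_field) \<longleftrightarrow> x \<noteq> 0"
  using vabs_nonneg[of x] vabs_eq_0[of x] by linarith

lemma vabs_one [simp]: "vabs (1::'k::nonarch_valued_field) = 1"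
  using vabs_mult[of "1::'k" 1] vabs_eq_0[of "1::'k"] by simp

lemma vabs_minus [simp]: "vabs (- x) = vabs (x::'k::nonarch_valued_field)"
  by (metis diff_0 diff_zero dist_commute dist_vabs)

lemma vabs_inverse: "vabs (inverse x) = inverse (vabs (x::'k::nonarch_valued_field))"
proof (cases "x = 0")
  case False
  then have "vabs x * vabs (inverse x) = 1"
    by (metis right_inverse vabs_mult vabs_one)
  then show ?thesis by (metis inverse_unique)
qed simp

lemma vabs_power: "vabs (x ^ n) = vabs (x::'k::nonarch_valued_field) ^ n"
  by (induction n) (auto simp: vabs_mult)

lemma vabs_diff_le: "vabs (x - y) \<le> max (vabs x) (vabs (y::'k::nonarch_valued_field))"
  using vabs_ultrametric[of x "- y"] by simp

lemma dist_ultrametric: "dist x z \<le> max (dist x y) (dist y (z::'k::nonarch_valued_field))"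
  using vabs_ultrametric[of "x - y" "y - z"] by (simp add: dist_vabs)

text \<open>
  Some ball around \<open>0\<close> lies in a compact neighbourhood. An affine map with a large multiplier, namely an
  inverse power of an element of absolute value less than \<open>1\<close>, carries it onto a superset of the given ball.
\<close>
lemma compact_cball_local_field: "compact (cball (z::'k::nonarch_local_field) r)"
proof -
  obtain U K where UK: "open U" "compact K" "(0::'k) \<in> U" "U \<subseteq> K"
    using locally_compact by blast
  then obtain d where d: "d > 0" "cball 0 d \<subseteq> U"
    using open_contains_cball by blast
  have c0: "compact (cball (0::'k) d)"
    using compact_Int_closed[OF \<open>compact K\<close> closed_cball, of 0 d] d UK by (metis inf.absorb2 order_trans)
  obtain a :: 'k where a: "a \<noteq> 0" "vabs a < 1" using vabs_nontrivial by blast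
  have "(\<lambda>n. vabs a ^ n) \<longlonglongrightarrow> 0"
    using a by (intro LIMSEQ_power_zero) auto
  then have "(\<lambda>n. vabs a ^ n * r) \<longlonglongrightarrow> 0"
    by (auto intro: tendsto_eq_intros)
  then obtain n where n: "vabs a ^ n * r < d"
    using order_tendstoD(2)[of _ 0 sequentially d] d(1) eventually_happens'[OF sequentially_bot] by fastforce
  define c where "c = inverse (a ^ n)"
  have "continuous_on (cball 0 d) (\<lambda>x. z + c * x)"
  proof (rule continuous_onI)
    fix x e :: "'k" and \<epsilon> :: real assume "\<epsilon> > 0"
    have c: "c \<noteq> 0" using a by (simp add: c_def)
    have "dist (z + c * x') (z + c * x) = vabs c * dist x' x" for x'
      by (simp add: dist_vabs vabs_mult flip: right_diff_distrib)
    moreover have "vabs c * dist x' x \<le> \<epsilon>" if "dist x' x < \<epsilon> / vabs c" for x'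
      using that c by (simp add: field_simps)
    ultimately show "\<exists>\<delta>>0. \<forall>x'\<in>cball 0 d. dist x' x < \<delta> \<longrightarrow> dist (z + c * x') (z + c * x) \<le> \<epsilon>"
      using \<open>\<epsilon> > 0\<close> c by (intro exI[of _ "\<epsilon> / vabs c"]) auto
  qed
  then have im: "compact ((\<lambda>x. z + c * x) ` cball 0 d)"
    using c0 compact_continuous_image by blast
  have "cball z r \<subseteq> (\<lambda>x. z + c * x) ` cball 0 d"
  proof
    fix y assume y: "y \<in> cball z r"
    have "vabs (y - z) \<le> r"
      using y by (simp add: dist_vabs) (metis minus_diff_eq vabs_minus)
    then have "vabs (a ^ n * (y - z)) \<le> vabs a ^ n * r"
      by (simp add: vabs_mult vabs_power mult_left_mono)
    then have "a ^ n * (y - z) \<in> cball 0 d"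
      using n by (simp add: dist_vabs)
    moreover have "y = z + c * (a ^ n * (y - z))"
      using a by (simp add: c_def mult.assoc[symmetric])
    ultimately show "y \<in> (\<lambda>x. z + c * x) ` cball 0 d" by blast
  qed
  then show ?thesis
    using compact_Int_closed[OF im closed_cball, of z r] by (metis inf.absorb2)
qed

lemma Cauchy_convergent_local_field:
  fixes f :: "nat \<Rightarrow> 'k::nonarch_local_field"
  assumes "Cauchy f" shows "convergent f"
proof -
  have "bounded (range f)" using assms cauchy_imp_bounded by blast
  then obtain e where "\<forall>n. dist (f 0) (f n) \<le> e"
    unfolding bounded_any_center[of _ "f 0"] by auto
  then have "\<forall>n. f n \<in> cball (f 0) e" by simp
  moreover have "complete (cball (f 0) e)"
    using compact_cball_local_field compact_imp_complete by blast
  ultimately show ?thesis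
    using assms unfolding complete_def convergent_def by blast
qed


section \<open>Ultrametric groups and spaces\<close>

text \<open>
  The axioms of an ultrametric normed space that do not involve scalars. They provide the metric topology,
  and they suffice for the operator spaces, whose scalar multiplication is only ever used pointwise.
\<close>
locale nonarch_group =
  fixes E :: "('k::nonarch_valued_field, 'e::ab_group_add) nspace"
  assumes zero_mem [simp]: "0 \<in> vecs E"
    and diff_mem: "x \<in> vecs E \<Longrightarrow> y \<in> vecs E \<Longrightarrow> x - y \<in> vecs E"
    and nrm_eq_0_iff: "x \<in> vecs E \<Longrightarrow> nrm E x = 0 \<longleftrightarrow> x = 0"
    and nrm_diff_le: "x \<in> vecs E \<Longrightarrow> y \<in> vecs E \<Longrightarrow> nrm E (x - y) \<le> max (nrm E x) (nrm E y)"
begin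

lemma nrm_zero [simp]: "nrm E 0 = 0"
  using nrm_eq_0_iff by simp

lemma nrm_nonneg: "x \<in> vecs E \<Longrightarrow> 0 \<le> nrm E x"
  using nrm_diff_le[of x x] by simp

lemma uminus_mem: "x \<in> vecs E \<Longrightarrow> - x \<in> vecs E"
  using diff_mem[of 0 x] by simp

lemma nrm_uminus: "x \<in> vecs E \<Longrightarrow> nrm E (- x) = nrm E x"
  using nrm_diff_le[of 0 x] nrm_diff_le[of 0 "- x"] uminus_mem nrm_nonneg[of x] nrm_nonneg[of "- x"]
  by simp

lemma add_mem: "x \<in> vecs E \<Longrightarrow> y \<in> vecs E \<Longrightarrow> x + y \<in> vecs E"
  using diff_mem[of x "- y"] uminus_mem by simp

lemma nrm_add_le: "x \<in> vecs E \<Longrightarrow> y \<in> vecs E \<Longrightarrow> nrm E (x + y) \<le> max (nrm E x) (nrm E y)"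
  using nrm_diff_le[of x "- y"] uminus_mem nrm_uminus by simp

lemma nrm_minus_commute: "x \<in> vecs E \<Longrightarrow> y \<in> vecs E \<Longrightarrow> nrm E (x - y) = nrm E (y - x)"
  by (metis diff_mem minus_diff_eq nrm_uminus)

lemma nrm_ultrametric:
  "x \<in> vecs E \<Longrightarrow> y \<in> vecs E \<Longrightarrow> z \<in> vecs E \<Longrightarrow> nrm E (x - z) \<le> max (nrm E (x - y)) (nrm E (y - z))"
  using nrm_add_le[of "x - y" "y - z"] diff_mem by simp

lemma sum_mem: "(\<And>i. i \<in> S \<Longrightarrow> f i \<in> vecs E) \<Longrightarrow> sum f S \<in> vecs E"
  by (induction S rule: infinite_finite_induct) (auto intro: add_mem)

lemma nrm_sum_le:
  "(\<And>i. i \<in> S \<Longrightarrow> f i \<in> vecs E) \<Longrightarrow> (\<And>i. i \<in> S \<Longrightarrow> nrm E (f i) \<le> c) \<Longrightarrow> 0 \<le> c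
    \<Longrightarrow> nrm E (sum f S) \<le> c"
proof (induction S rule: infinite_finite_induct)
  case (insert i S)
  then have "nrm E (f i + sum f S) \<le> max (nrm E (f i)) (nrm E (sum f S))"
    by (intro nrm_add_le sum_mem) auto
  with insert show ?case by (simp add: le_max_iff_disj) (smt (verit) insertCI)
qed auto

sublocale Metric_space "vecs E" "ndist E"
proof
  fix x y z
  show "0 \<le> ndist E x y" by (simp add: ndist_def nrm_nonneg diff_mem)
  show "ndist E x y = ndist E y x" by (simp add: ndist_def nrm_minus_commute)
  assume x: "x \<in> vecs E" and y: "y \<in> vecs E"
  then show "ndist E x y = 0 \<longleftrightarrow> x = y" by (simp add: ndist_def nrm_eq_0_iff diff_mem)
  assume z: "z \<in> vecs E"
  show "ndist E x z \<le> ndist E x y + ndist E y z"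
    using x y z nrm_ultrametric[of x y z] nrm_nonneg[of "x - y"] nrm_nonneg[of "y - z"]
    by (simp add: ndist_def diff_mem)
qed

lemma mtopology_eq: "mtopology = ntop E"
  by (simp add: ntop_def)

lemma topspace_ntop [simp]: "topspace (ntop E) = vecs E"
  by (metis mtopology_eq topspace_mtopology)

text \<open>
  Convergence along the neighbourhood filter turns the continuity proofs below into estimates of norms,
  to be combined with the limit rules for real functions.
\<close>
lemma continuous_map_ntop_iff:
  "continuous_map T (ntop E) f \<longleftrightarrow>
     (\<forall>t\<in>topspace T. f t \<in> vecs E \<and> ((\<lambda>y. nrm E (f y - f t)) \<longlongrightarrow> 0) (nhdsin T t))"
proof -
  have *: "((\<forall>\<epsilon>>0. \<exists>U. openin T U \<and> t \<in> U \<and> (\<forall>y\<in>U. f y \<in> mball (f t) \<epsilon>)) \<longleftrightarrow>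
      f t \<in> vecs E \<and> ((\<lambda>y. nrm E (f y - f t)) \<longlongrightarrow> 0) (nhdsin T t))"
    if t: "t \<in> topspace T" and f: "\<And>y. y \<in> topspace T \<Longrightarrow> f y \<in> vecs E" for t
  proof -
    have "(\<exists>U. openin T U \<and> t \<in> U \<and> (\<forall>y\<in>U. f y \<in> mball (f t) \<epsilon>)) \<longleftrightarrow>
        eventually (\<lambda>y. dist (nrm E (f y - f t)) 0 < \<epsilon>) (nhdsin T t)" for \<epsilon>
    proof -
      have "f y \<in> mball (f t) \<epsilon> \<longleftrightarrow> dist (nrm E (f y - f t)) 0 < \<epsilon>" if "y \<in> topspace T" for y
        using f[OF that] f[OF t] nrm_nonneg[OF diff_mem, of "f y" "f t"]
        by (auto simp: ndist_def nrm_minus_commute[of "f t"] in_mball)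
      then show ?thesis
        using t openin_subset[of T] unfolding eventually_nhdsin by blast
    qed
    then show ?thesis unfolding tendsto_iff using f t by blast
  qed
  show ?thesis
  proof (cases "\<forall>y\<in>topspace T. f y \<in> vecs E")
    case True
    then show ?thesis
      unfolding mtopology_eq[symmetric] continuous_map_to_metric using * by blast
  next
    case False
    then show ?thesis using continuous_map_image_subset_topspace[of T "ntop E" f] by auto
  qed
qed

lemma continuous_map_ntopI:
  assumes "\<And>t. t \<in> topspace T \<Longrightarrow> f t \<in> vecs E"
    and "\<And>t y. t \<in> topspace T \<Longrightarrow> y \<in> topspace T \<Longrightarrow> nrm E (f y - f t) \<le> g t y"
    and "\<And>t. t \<in> topspace T \<Longrightarrow> (g t \<longlongrightarrow> 0) (nhdsin T t)"
  shows "continuous_map T (ntop E) f"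
  unfolding continuous_map_ntop_iff
proof (intro ballI conjI assms(1))
  fix t assume t: "t \<in> topspace T"
  have ev: "eventually (\<lambda>y. y \<in> topspace T) (nhdsin T t)"
    using t by (auto simp: eventually_nhdsin)
  show "((\<lambda>y. nrm E (f y - f t)) \<longlongrightarrow> 0) (nhdsin T t)"
    using tendsto_const assms(3)[OF t]
  proof (rule tendsto_sandwich[rotated 2])
    show "eventually (\<lambda>y. 0 \<le> nrm E (f y - f t)) (nhdsin T t)"
      using ev by eventually_elim (simp add: nrm_nonneg diff_mem assms(1) t)
    show "eventually (\<lambda>y. nrm E (f y - f t) \<le> g t y) (nhdsin T t)"
      using ev by eventually_elim (simp add: assms(2) t)
  qed
qed

lemma continuous_map_ntopD:
  assumes "continuous_map T (ntop E) f" "t \<in> topspace T"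
  shows "f t \<in> vecs E" "((\<lambda>y. nrm E (f y - f t)) \<longlongrightarrow> 0) (nhdsin T t)"
  using assms unfolding continuous_map_ntop_iff by auto

lemma continuous_map_diff:
  assumes f: "continuous_map T (ntop E) f" and g: "continuous_map T (ntop E) g"
  shows "continuous_map T (ntop E) (\<lambda>t. f t - g t)"
proof (rule continuous_map_ntopI[where g = "\<lambda>t y. max (nrm E (f y - f t)) (nrm E (g y - g t))"])
  fix t y assume t: "t \<in> topspace T" and y: "y \<in> topspace T"
  note [simp] = continuous_map_ntopD(1)[OF f t] continuous_map_ntopD(1)[OF g t]
    continuous_map_ntopD(1)[OF f y] continuous_map_ntopD(1)[OF g y]
  show "f t - g t \<in> vecs E" by (simp add: diff_mem)
  have "f y - g y - (f t - g t) = (f y - f t) - (g y - g t)" by simp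
  also have "nrm E \<dots> \<le> max (nrm E (f y - f t)) (nrm E (g y - g t))"
    by (intro nrm_diff_le diff_mem) auto
  finally show "nrm E (f y - g y - (f t - g t)) \<le> max (nrm E (f y - f t)) (nrm E (g y - g t))" .
next
  fix t assume t: "t \<in> topspace T"
  show "((\<lambda>y. max (nrm E (f y - f t)) (nrm E (g y - g t))) \<longlongrightarrow> 0) (nhdsin T t)"
    using tendsto_max[OF continuous_map_ntopD(2)[OF f t] continuous_map_ntopD(2)[OF g t]] by simp
qed

lemma continuous_map_zero: "continuous_map T (ntop E) (\<lambda>_. 0)"
  by simp

lemma continuous_map_add:
  assumes f: "continuous_map T (ntop E) f" and g: "continuous_map T (ntop E) g"
  shows "continuous_map T (ntop E) (\<lambda>t. f t + g t)"
  using continuous_map_diff[OF f continuous_map_diff[OF continuous_map_zero g]] by simp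

lemma continuous_map_sum:
  assumes "\<And>i. i \<in> S \<Longrightarrow> continuous_map T (ntop E) (f i)"
  shows "continuous_map T (ntop E) (\<lambda>t. \<Sum>i\<in>S. f i t)"
  using assms by (induction S rule: infinite_finite_induct) (auto intro: continuous_map_add)

lemma tendsto_nrm:
  assumes f: "continuous_map T (ntop E) f" and t: "t \<in> topspace T"
  shows "((\<lambda>y. nrm E (f y)) \<longlongrightarrow> nrm E (f t)) (nhdsin T t)"
proof -
  have "((\<lambda>y. nrm E (f y) - nrm E (f t)) \<longlongrightarrow> 0) (nhdsin T t)"
  proof (rule Lim_null_comparison[OF _ continuous_map_ntopD(2)[OF f t]])
    have "eventually (\<lambda>y. y \<in> topspace T) (nhdsin T t)"
      using t by (auto simp: eventually_nhdsin)
    then show "eventually (\<lambda>y. norm (nrm E (f y) - nrm E (f t)) \<le> nrm E (f y - f t)) (nhdsin T t)"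
    proof eventually_elim
      case (elim y)
      have m: "f y \<in> vecs E" "f t \<in> vecs E" "f y - f t \<in> vecs E"
        using continuous_map_ntopD(1)[OF f] elim t diff_mem by auto
      show ?case
        using nrm_add_le[of "f y - f t" "f t"] nrm_diff_le[of "f y" "f y - f t"] m
          nrm_nonneg[of "f y"] nrm_nonneg[of "f t"] nrm_nonneg[of "f y - f t"] by auto
    qed
  qed
  then show ?thesis using Lim_null by blast
qed

lemma continuous_map_nrm:
  assumes f: "continuous_map T (ntop E) f"
  shows "continuous_map T euclideanreal (\<lambda>t. nrm E (f t))"
proof -
  have "limitin euclideanreal (\<lambda>t. nrm E (f t)) (nrm E (f t)) (atin T t)" if "t \<in> topspace T" for t
    unfolding limitin_canonical_iff atin_def
    by (rule tendsto_mono[OF inf_le1 tendsto_nrm[OF f that]])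
  then show ?thesis by (simp add: continuous_map_atin)
qed

lemma nsums_iff:
  assumes "\<And>n. f n \<in> vecs E"
  shows "nsums E f s \<longleftrightarrow> s \<in> vecs E \<and> (\<lambda>N. nrm E ((\<Sum>n<N. f n) - s)) \<longlonglongrightarrow> 0"
proof -
  have m: "(\<Sum>n<N. f n) \<in> vecs E" for N using assms by (intro sum_mem)
  then show ?thesis
    unfolding nsums_def mtopology_eq[symmetric] limitin_metric_dist_null by (auto simp: ndist_def)
qed

lemma nsums_mem: "nsums E f s \<Longrightarrow> s \<in> vecs E"
  unfolding nsums_def by (metis limitin_topspace topspace_ntop)

lemma nsuminf_eq: "nsums E f s \<Longrightarrow> nsuminf E f = s"
  unfolding nsuminf_def nsums_def mtopology_eq[symmetric]
  by (intro the_equality) (auto intro: limitin_metric_unique)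

lemma nsums_diff:
  assumes f: "\<And>n. f n \<in> vecs E" "nsums E f s" and g: "\<And>n. g n \<in> vecs E" "nsums E g t"
  shows "nsums E (\<lambda>n. f n - g n) (s - t)"
proof -
  have st: "s \<in> vecs E" "t \<in> vecs E" using f g nsums_mem by auto
  have lim: "(\<lambda>N. nrm E ((\<Sum>n<N. f n) - s)) \<longlonglongrightarrow> 0" "(\<lambda>N. nrm E ((\<Sum>n<N. g n) - t)) \<longlonglongrightarrow> 0"
    using f g nsums_iff by auto
  have m: "(\<Sum>n<N. f n) \<in> vecs E" "(\<Sum>n<N. g n) \<in> vecs E" for N
    using f g by (auto intro: sum_mem)
  have "(\<lambda>N. nrm E ((\<Sum>n<N. f n - g n) - (s - t))) \<longlonglongrightarrow> 0"
  proof (rule Lim_null_comparison)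
    have "nrm E (((\<Sum>n<N. f n) - s) - ((\<Sum>n<N. g n) - t))
       \<le> max (nrm E ((\<Sum>n<N. f n) - s)) (nrm E ((\<Sum>n<N. g n) - t))" for N
      using m st by (intro nrm_diff_le diff_mem)
    moreover have "0 \<le> nrm E (((\<Sum>n<N. f n) - s) - ((\<Sum>n<N. g n) - t))" for N
      using m st by (intro nrm_nonneg diff_mem)
    moreover have "((\<Sum>n<N. f n) - s) - ((\<Sum>n<N. g n) - t) = (\<Sum>n<N. f n - g n) - (s - t)" for N
      by (simp add: sum_subtractf)
    ultimately show "eventually (\<lambda>N. norm (nrm E ((\<Sum>n<N. f n - g n) - (s - t)))
        \<le> max (nrm E ((\<Sum>n<N. f n) - s)) (nrm E ((\<Sum>n<N. g n) - t))) sequentially"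
      by auto
    show "(\<lambda>N. max (nrm E ((\<Sum>n<N. f n) - s)) (nrm E ((\<Sum>n<N. g n) - t))) \<longlonglongrightarrow> 0"
      using tendsto_max[OF lim] by simp
  qed
  then show ?thesis using nsums_iff st f g diff_mem by auto
qed

lemma nsums_zero: "nsums E (\<lambda>n. 0) 0"
  by (simp add: nsums_iff)

lemma nsums_add:
  assumes f: "\<And>n. f n \<in> vecs E" "nsums E f s" and g: "\<And>n. g n \<in> vecs E" "nsums E g t"
  shows "nsums E (\<lambda>n. f n + g n) (s + t)"
  using nsums_diff[OF f _ nsums_diff[OF _ nsums_zero g]] g uminus_mem by simp

text \<open>
  The ultrametric inequality: bounding the terms bounds the sum, whatever their number.
\<close>
lemma nrm_nsums_le:
  assumes f: "\<And>n. f n \<in> vecs E" "nsums E f s" and le: "\<And>n. nrm E (f n) \<le> c"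
  shows "nrm E s \<le> c"
proof (rule ccontr)
  assume "\<not> nrm E s \<le> c"
  have c: "0 \<le> c" using le[of 0] nrm_nonneg[OF f(1)] order_trans by blast
  have s: "s \<in> vecs E" and "(\<lambda>N. nrm E ((\<Sum>n<N. f n) - s)) \<longlonglongrightarrow> 0"
    using f nsums_iff by auto
  then obtain N where N: "nrm E ((\<Sum>n<N. f n) - s) < nrm E s"
    using order_tendstoD(2)[of _ 0 sequentially "nrm E s"] \<open>\<not> nrm E s \<le> c\<close> c
      eventually_happens'[OF sequentially_bot] by fastforce
  have m: "(\<Sum>n<N. f n) \<in> vecs E" using f by (intro sum_mem)
  have "nrm E (\<Sum>n<N. f n) \<le> c" using f le c by (intro nrm_sum_le)
  then show False
    using nrm_diff_le[OF m diff_mem[OF m s]] N \<open>\<not> nrm E s \<le> c\<close> by simp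
qed

lemma nsums_offset:
  assumes f: "\<And>n. f n \<in> vecs E" "nsums E f s"
  shows "nsums E (\<lambda>n. f (n + N)) (s - (\<Sum>n<N. f n))"
proof -
  have m: "(\<Sum>n<N. f n) \<in> vecs E" for N using f by (intro sum_mem)
  have s: "s \<in> vecs E" and lim: "(\<lambda>N. nrm E ((\<Sum>n<N. f n) - s)) \<longlonglongrightarrow> 0"
    using f nsums_iff by auto
  have "(\<Sum>n<M + N. f n) = (\<Sum>n<N. f n) + (\<Sum>n<M. f (n + N))" for M
    by (induction M) (simp_all add: ac_simps)
  then have eq: "(\<Sum>n<M. f (n + N)) - (s - (\<Sum>n<N. f n)) = (\<Sum>n<M + N. f n) - s" for M
    by simp
  have "(\<lambda>M. nrm E ((\<Sum>n<M. f (n + N)) - (s - (\<Sum>n<N. f n)))) \<longlonglongrightarrow> 0"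
    unfolding eq by (rule LIMSEQ_ignore_initial_segment[OF lim])
  then show ?thesis
    using f m s by (simp add: nsums_iff diff_mem)
qed

end

text \<open>
  Completeness in the form in which ultrametric analysis uses it: a series converges as soon as its terms tend
  to \<open>0\<close>.
\<close>
locale nonarch_complete = nonarch_group +
  assumes nsums_ex:
    "(\<And>n. f n \<in> vecs E) \<Longrightarrow> (\<lambda>n. nrm E (f n)) \<longlonglongrightarrow> 0 \<Longrightarrow> \<exists>s. nsums E f s"

text \<open>
  The inequality \<open>nrm_scl_le\<close> implies the equality, by an application to the inverse scalar, and it is easier to verify.
\<close>
locale nonarch_space = nonarch_group E
  for E :: "('k::nonarch_valued_field, 'e::ab_group_add) nspace" +
  assumes scl_mem: "x \<in> vecs E \<Longrightarrow> scl E c x \<in> vecs E"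
    and scl_add_right: "x \<in> vecs E \<Longrightarrow> y \<in> vecs E \<Longrightarrow> scl E c (x + y) = scl E c x + scl E c y"
    and scl_add_left: "x \<in> vecs E \<Longrightarrow> scl E (a + b) x = scl E a x + scl E b x"
    and scl_scl: "x \<in> vecs E \<Longrightarrow> scl E a (scl E b x) = scl E (a * b) x"
    and scl_one: "x \<in> vecs E \<Longrightarrow> scl E 1 x = x"
    and nrm_scl_le: "x \<in> vecs E \<Longrightarrow> nrm E (scl E c x) \<le> vabs c * nrm E x"
begin

lemma scl_zero_right [simp]: "scl E c 0 = 0"
  using scl_add_right[of 0 0 c] by simp

lemma scl_uminus_right: "x \<in> vecs E \<Longrightarrow> scl E c (- x) = - scl E c x"
  using scl_add_right[of x "- x" c] uminus_mem by (simp add: eq_neg_iff_add_eq_0 add.commute)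

lemma scl_diff_right: "x \<in> vecs E \<Longrightarrow> y \<in> vecs E \<Longrightarrow> scl E c (x - y) = scl E c x - scl E c y"
  using scl_add_right[of x "- y" c] uminus_mem scl_uminus_right by simp

lemma scl_diff_left: "x \<in> vecs E \<Longrightarrow> scl E (a - b) x = scl E a x - scl E b x"
  using scl_add_left[of x "a - b" b] by simp

lemma scl_sum_right: "(\<And>i. i \<in> S \<Longrightarrow> f i \<in> vecs E) \<Longrightarrow> scl E c (sum f S) = (\<Sum>i\<in>S. scl E c (f i))"
  by (induction S rule: infinite_finite_induct) (auto simp: scl_add_right sum_mem)

lemma nsums_scl:
  assumes f: "\<And>n. f n \<in> vecs E" "nsums E f s"
  shows "nsums E (\<lambda>n. scl E c (f n)) (scl E c s)"
proof -
  have m: "(\<Sum>n<N. f n) \<in> vecs E" for N using f by (intro sum_mem)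
  have s: "s \<in> vecs E" and lim: "(\<lambda>N. nrm E ((\<Sum>n<N. f n) - s)) \<longlonglongrightarrow> 0"
    using f nsums_iff by auto
  have "(\<lambda>N. nrm E ((\<Sum>n<N. scl E c (f n)) - scl E c s)) \<longlonglongrightarrow> 0"
  proof (rule Lim_null_comparison)
    have "nrm E (scl E c ((\<Sum>n<N. f n) - s)) \<le> vabs c * nrm E ((\<Sum>n<N. f n) - s)"
      "0 \<le> nrm E (scl E c ((\<Sum>n<N. f n) - s))" for N
      using m s by (auto intro!: nrm_scl_le nrm_nonneg scl_mem diff_mem)
    then show "eventually (\<lambda>N. norm (nrm E ((\<Sum>n<N. scl E c (f n)) - scl E c s))
        \<le> vabs c * nrm E ((\<Sum>n<N. f n) - s)) sequentially"
      using f m s by (simp add: scl_diff_right scl_sum_right)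
    show "(\<lambda>N. vabs c * nrm E ((\<Sum>n<N. f n) - s)) \<longlonglongrightarrow> 0"
      using lim by (auto intro: tendsto_eq_intros)
  qed
  then show ?thesis using nsums_iff s f scl_mem by auto
qed

end


section \<open>The spaces of the theorem\<close>

text \<open>
  The norms of \<open>c0_space\<close>, \<open>C0_space\<close>, \<open>lin_space\<close> and \<open>mult_space\<close> are all suprema of a family of
  seminorms, and the axioms pass from the seminorms to their supremum.
\<close>
lemma nonarch_group_SUP:
  fixes E :: "('k::nonarch_valued_field, 'e::ab_group_add) nspace" and q :: "'e \<Rightarrow> 'a \<Rightarrow> real"
  assumes zero: "0 \<in> vecs E"
    and diff: "\<And>x y. x \<in> vecs E \<Longrightarrow> y \<in> vecs E \<Longrightarrow> x - y \<in> vecs E"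
    and D: "D \<noteq> {}"
    and nrm: "\<And>x. nrm E x = (SUP a\<in>D. q x a)"
    and bdd: "\<And>x. x \<in> vecs E \<Longrightarrow> bdd_above (q x ` D)"
    and nonneg: "\<And>x a. x \<in> vecs E \<Longrightarrow> a \<in> D \<Longrightarrow> 0 \<le> q x a"
    and le: "\<And>x y a. x \<in> vecs E \<Longrightarrow> y \<in> vecs E \<Longrightarrow> a \<in> D \<Longrightarrow> q (x - y) a \<le> max (q x a) (q y a)"
    and q0: "\<And>a. a \<in> D \<Longrightarrow> q 0 a = 0"
    and sep: "\<And>x. x \<in> vecs E \<Longrightarrow> \<forall>a\<in>D. q x a = 0 \<Longrightarrow> x = 0"
  shows "nonarch_group E"
proof
  have upper: "q x a \<le> nrm E x" if "x \<in> vecs E" "a \<in> D" for x a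
    unfolding nrm using that bdd by (intro cSUP_upper)
  fix x assume x: "x \<in> vecs E"
  show "nrm E x = 0 \<longleftrightarrow> x = 0"
  proof
    assume "nrm E x = 0"
    then show "x = 0" using upper[OF x] nonneg[OF x] by (intro sep[OF x]) force
  qed (use D q0 nrm in simp)
  fix y assume y: "y \<in> vecs E"
  have "q (x - y) a \<le> max (nrm E x) (nrm E y)" if "a \<in> D" for a
    using le[OF x y that] upper[OF x that] upper[OF y that] by simp
  then show "nrm E (x - y) \<le> max (nrm E x) (nrm E y)"
    unfolding nrm[of "x - y"] using D by (intro cSUP_least)
qed (use zero diff in auto)


subsection \<open>The scalars and the space of null families\<close>

lemma nonarch_space_scalars: "nonarch_space (scalars :: ('k::nonarch_valued_field, 'k) nspace)"
  by (intro nonarch_space.intro nonarch_group.intro nonarch_space_axioms.intro)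
    (simp_all add: scalars_def vabs_diff_le distrib_left distrib_right mult.assoc vabs_mult)

context
  fixes J :: "'j set" and X :: "('k::nonarch_valued_field, 'j \<Rightarrow> 'k) nspace"
  defines "X \<equiv> c0_space J"
begin

lemma vecs_c0: "x \<in> vecs X \<longleftrightarrow> (\<forall>j. j \<notin> J \<longrightarrow> x j = 0) \<and> (\<forall>\<epsilon>>0. finite {j \<in> J. vabs (x j) > \<epsilon>})"
  by (simp add: X_def c0_space_def)

lemma bdd_above_c0:
  assumes "x \<in> vecs X" shows "bdd_above (range (\<lambda>j. vabs (x j)))"
proof -
  have "finite ((\<lambda>j. vabs (x j)) ` {j \<in> J. vabs (x j) > 1})"
    using assms unfolding vecs_c0 by (intro finite_imageI) simp
  then have "bdd_above ((\<lambda>j. vabs (x j)) ` {j \<in> J. vabs (x j) > 1} \<union> {..1})" by simp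
  moreover have "range (\<lambda>j. vabs (x j)) \<subseteq> (\<lambda>j. vabs (x j)) ` {j \<in> J. vabs (x j) > 1} \<union> {..1}"
  proof (intro image_subsetI)
    fix j
    show "vabs (x j) \<in> (\<lambda>j. vabs (x j)) ` {j \<in> J. vabs (x j) > 1} \<union> {..1}"
    proof (cases "vabs (x j) > 1")
      case True
      then have "x j \<noteq> 0" by auto
      then have "j \<in> J" using assms unfolding vecs_c0 by blast
      with True show ?thesis by blast
    qed simp
  qed
  ultimately show ?thesis by (rule bdd_above_mono)
qed

lemma vabs_le_nrm_c0: "x \<in> vecs X \<Longrightarrow> vabs (x j) \<le> nrm X x"
  using cSUP_upper[OF UNIV_I bdd_above_c0] by (simp add: X_def c0_space_def)

lemma nrm_c0_le: "(\<And>j. vabs (x j) \<le> c) \<Longrightarrow> nrm X x \<le> c"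
  by (auto simp: X_def c0_space_def intro: cSUP_least)

lemma nonarch_group_c0: "nonarch_group X"
proof (rule nonarch_group_SUP[where D = UNIV and q = "\<lambda>x j. vabs (x j)"])
  fix x y assume "x \<in> vecs X" "y \<in> vecs X"
  moreover have "{j \<in> J. vabs ((x - y) j) > \<epsilon>} \<subseteq> {j \<in> J. vabs (x j) > \<epsilon>} \<union> {j \<in> J. vabs (y j) > \<epsilon>}" for \<epsilon>
  proof
    fix j assume "j \<in> {j \<in> J. vabs ((x - y) j) > \<epsilon>}"
    then show "j \<in> {j \<in> J. vabs (x j) > \<epsilon>} \<union> {j \<in> J. vabs (y j) > \<epsilon>}"
      using vabs_diff_le[of "x j" "y j"] by auto
  qed
  ultimately show "x - y \<in> vecs X"
    unfolding vecs_c0 by (metis (no_types, lifting) finite_UnI finite_subset minus_apply diff_zero)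
next
  fix x y :: "'j \<Rightarrow> 'k" and j
  show "vabs ((x - y) j) \<le> max (vabs (x j)) (vabs (y j))" by (simp add: vabs_diff_le)
qed (auto simp: vecs_c0 bdd_above_c0 X_def c0_space_def)

lemma nonarch_space_c0: "nonarch_space X"
proof -
  interpret nonarch_group X by (rule nonarch_group_c0)
  show ?thesis
  proof
    fix x c assume x: "x \<in> vecs X"
    show "scl X c x \<in> vecs X"
    proof (cases "c = 0")
      case True
      then have "scl X c x = 0" by (auto simp: X_def c0_space_def)
      then show ?thesis by simp
    next
      case False
      have "{j \<in> J. vabs (scl X c x j) > \<epsilon>} = {j \<in> J. vabs (x j) > \<epsilon> / vabs c}" for \<epsilon>
        using False by (auto simp: X_def c0_space_def vabs_mult field_simps)
      moreover have "\<epsilon> / vabs c > 0" if "\<epsilon> > 0" for \<epsilon> using that False by simp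
      ultimately show ?thesis using x unfolding vecs_c0 by (auto simp: X_def c0_space_def)
    qed
    show "nrm X (scl X c x) \<le> vabs c * nrm X x"
    proof (rule nrm_c0_le)
      show "vabs (scl X c x j) \<le> vabs c * nrm X x" for j
        using vabs_le_nrm_c0[OF x, of j] by (simp add: X_def c0_space_def vabs_mult mult_left_mono)
    qed
  qed (auto simp: X_def c0_space_def algebra_simps)
qed

end

text \<open>
  The coordinates of the partial sums converge, since the field is complete, and they do so uniformly in the
  index. A uniform limit of null families is a null family: where it exceeds \<open>\<epsilon>\<close> in absolute
  value, so does a sufficiently close partial sum.
\<close>
lemma nonarch_complete_c0: "nonarch_complete (c0_space J :: ('k::nonarch_local_field, 'j \<Rightarrow> 'k) nspace)"
proof -
  let ?X = "c0_space J :: ('k, 'j \<Rightarrow> 'k) nspace"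
  interpret X: nonarch_group ?X by (rule nonarch_group_c0)
  interpret K: nonarch_space "scalars :: ('k, 'k) nspace" by (rule nonarch_space_scalars)
  show ?thesis
  proof
    fix f assume f: "\<And>n. f n \<in> vecs ?X" and lim: "(\<lambda>n. nrm ?X (f n)) \<longlonglongrightarrow> 0"
    define S where "S N = (\<Sum>n<N. f n)" for N
    have S: "S N \<in> vecs ?X" for N unfolding S_def using f by (intro X.sum_mem)
    have small: "\<exists>N. \<forall>m\<ge>N. \<forall>n\<ge>N. nrm ?X (S m - S n) \<le> \<epsilon>" if "\<epsilon> > 0" for \<epsilon>
    proof -
      have "eventually (\<lambda>n. nrm ?X (f n) < \<epsilon>) sequentially"
        using order_tendstoD(2)[OF lim that] .
      then obtain N where N: "\<And>n. n \<ge> N \<Longrightarrow> nrm ?X (f n) < \<epsilon>"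
        unfolding eventually_sequentially by auto
      have tail: "nrm ?X (S n - S N) \<le> \<epsilon>" if "n \<ge> N" for n
      proof -
        have "S n - S N = (\<Sum>i\<in>{..<n} - {..<N}. f i)"
          unfolding S_def using that by (subst sum_diff) auto
        then show ?thesis
          using f N \<open>\<epsilon> > 0\<close> by (simp only:) (intro X.nrm_sum_le, auto intro: less_imp_le)
      qed
      show ?thesis
      proof (intro exI[of _ N] allI impI)
        fix m n assume "N \<le> m" "N \<le> n"
        then show "nrm ?X (S m - S n) \<le> \<epsilon>"
          using X.nrm_ultrametric[OF S[of m] S[of N] S[of n]] tail[of m] tail[of n]
            X.nrm_minus_commute[OF S S, of n N] by simp
      qed
    qed
    have "Cauchy (\<lambda>N. S N j)" for j
    proof (rule metric_CauchyI)
      fix e :: real assume "e > 0"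
      then obtain N where N: "\<forall>m\<ge>N. \<forall>n\<ge>N. nrm ?X (S m - S n) \<le> e / 2"
        using small[of "e / 2"] by auto
      show "\<exists>M. \<forall>m\<ge>M. \<forall>n\<ge>M. dist (S m j) (S n j) < e"
      proof (intro exI[of _ N] allI impI)
        fix m n assume "N \<le> m" "N \<le> n"
        then show "dist (S m j) (S n j) < e"
          using N vabs_le_nrm_c0[OF X.diff_mem[OF S S], of m n j] \<open>e > 0\<close>
          by (force simp: dist_vabs)
      qed
    qed
    then have "convergent (\<lambda>N. S N j)" for j by (intro Cauchy_convergent_local_field)
    then have l: "(\<lambda>N. S N j) \<longlonglongrightarrow> lim (\<lambda>N. S N j)" for j by (simp add: convergent_LIMSEQ_iff)
    define l where "l = (\<lambda>j. lim (\<lambda>N. S N j))"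
    have l: "(\<lambda>N. S N j) \<longlonglongrightarrow> l j" for j using l by (simp add: l_def)
    have unif: "\<exists>N. \<forall>n\<ge>N. \<forall>j. vabs (S n j - l j) \<le> \<epsilon>" if e: "\<epsilon> > 0" for \<epsilon>
    proof -
      obtain N where N: "\<forall>m\<ge>N. \<forall>n\<ge>N. nrm ?X (S m - S n) \<le> \<epsilon>" using small[OF e] by auto
      show ?thesis
      proof (intro exI[of _ N] allI impI)
        fix n j assume n: "N \<le> n"
        have "dist (S n j) (S m j) \<le> \<epsilon>" if "m \<ge> N" for m
          using N n that vabs_le_nrm_c0[OF X.diff_mem[OF S S], of n m j] by (force simp: dist_vabs)
        then have "eventually (\<lambda>m. dist (S n j) (S m j) \<le> \<epsilon>) sequentially"
          unfolding eventually_sequentially by blast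
        moreover have "(\<lambda>m. dist (S n j) (S m j)) \<longlonglongrightarrow> dist (S n j) (l j)"
          by (intro tendsto_intros l)
        ultimately have "dist (S n j) (l j) \<le> \<epsilon>"
          by (intro tendsto_upperbound) auto
        then show "vabs (S n j - l j) \<le> \<epsilon>" by (simp add: dist_vabs)
      qed
    qed
    have lX: "l \<in> vecs ?X"
      unfolding vecs_c0
    proof (intro conjI allI impI)
      fix j assume "j \<notin> J"
      then have "(\<lambda>N. S N j) = (\<lambda>N. 0)" using S by (simp add: vecs_c0)
      then show "l j = 0" using l[of j] by (simp add: LIMSEQ_const_iff)
    next
      fix \<epsilon> :: real assume e: "\<epsilon> > 0"
      obtain N where N: "\<And>j. vabs (S N j - l j) \<le> \<epsilon>" using unif[OF e] by auto
      have "{j \<in> J. vabs (l j) > \<epsilon>} \<subseteq> {j \<in> J. vabs (S N j) > \<epsilon>}"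
      proof (intro subsetI, clarsimp)
        fix j assume "\<epsilon> < vabs (l j)"
        then show "\<epsilon> < vabs (S N j)"
          using vabs_diff_le[of "S N j" "S N j - l j"] N[of j] by simp
      qed
      then show "finite {j \<in> J. vabs (l j) > \<epsilon>}"
        using S[of N] e unfolding vecs_c0 by (auto intro: finite_subset)
    qed
    have "(\<lambda>N. nrm ?X (S N - l)) \<longlonglongrightarrow> 0"
    proof (rule LIMSEQ_I)
      fix e :: real assume "e > 0"
      then obtain N where N: "\<forall>n\<ge>N. \<forall>j. vabs (S n j - l j) \<le> e / 2" using unif[of "e / 2"] by auto
      show "\<exists>N. \<forall>n\<ge>N. norm (nrm ?X (S n - l) - 0) < e"
      proof (intro exI[of _ N] allI impI)
        fix n assume "N \<le> n"
        then have "nrm ?X (S n - l) \<le> e / 2" using N by (intro nrm_c0_le) simp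
        then show "norm (nrm ?X (S n - l) - 0) < e"
          using \<open>e > 0\<close> X.nrm_nonneg[OF X.diff_mem[OF S lX], of n] by simp
      qed
    qed
    then show "\<exists>s. nsums ?X f s"
      using X.nsums_iff[of f l] f lX unfolding S_def by blast
  qed
qed


subsection \<open>Finite powers\<close>

lemma vecs_pow: "x \<in> vecs (pow_space I E) \<longleftrightarrow> (\<forall>i\<in>I. x i \<in> vecs E) \<and> (\<forall>i. i \<notin> I \<longrightarrow> x i = 0)"
  by (simp add: pow_space_def)

lemma scl_pow [simp]: "scl (pow_space I E) c x i = scl E c (x i)"
  by (simp add: pow_space_def)

lemma nrm_pow_le_iff:
  "finite I \<Longrightarrow> nrm (pow_space I E) x \<le> c \<longleftrightarrow> 0 \<le> c \<and> (\<forall>i\<in>I. nrm E (x i) \<le> c)"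
  by (simp add: pow_space_def)

lemma nrm_le_nrm_pow: "finite I \<Longrightarrow> i \<in> I \<Longrightarrow> nrm E (x i) \<le> nrm (pow_space I E) x"
  using nrm_pow_le_iff[of I E x "nrm (pow_space I E) x"] by simp

lemma vecs_pow_upd: "x \<in> vecs (pow_space I E) \<Longrightarrow> i \<in> I \<Longrightarrow> a \<in> vecs E \<Longrightarrow> x(i := a) \<in> vecs (pow_space I E)"
  by (auto simp: vecs_pow)

lemma (in nonarch_group) vecs_pow_mem: "x \<in> vecs (pow_space I E) \<Longrightarrow> x i \<in> vecs E"
  by (cases "i \<in> I") (auto simp: vecs_pow)

lemma nonarch_group_pow:
  assumes "nonarch_group E" and I: "finite I" shows "nonarch_group (pow_space I E)"
proof -
  interpret nonarch_group E by fact
  show ?thesis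
  proof
    fix x y assume x: "x \<in> vecs (pow_space I E)" and y: "y \<in> vecs (pow_space I E)"
    then show d: "x - y \<in> vecs (pow_space I E)" by (auto simp: vecs_pow diff_mem)
    show "nrm (pow_space I E) (x - y) \<le> max (nrm (pow_space I E) x) (nrm (pow_space I E) y)"
      unfolding nrm_pow_le_iff[OF I]
    proof
      show "0 \<le> max (nrm (pow_space I E) x) (nrm (pow_space I E) y)"
        using nrm_pow_le_iff[OF I, of E x "nrm (pow_space I E) x"] by (simp add: le_max_iff_disj)
      show "\<forall>i\<in>I. nrm E ((x - y) i) \<le> max (nrm (pow_space I E) x) (nrm (pow_space I E) y)"
      proof
        fix i assume i: "i \<in> I"
        show "nrm E ((x - y) i) \<le> max (nrm (pow_space I E) x) (nrm (pow_space I E) y)"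
          using nrm_diff_le[OF vecs_pow_mem[OF x, of i] vecs_pow_mem[OF y, of i]]
            nrm_le_nrm_pow[OF I i, of E x] nrm_le_nrm_pow[OF I i, of E y] by auto
      qed
    qed
  next
    fix x assume x: "x \<in> vecs (pow_space I E)"
    have "nrm (pow_space I E) x = 0 \<longleftrightarrow> (\<forall>i\<in>I. nrm E (x i) \<le> 0)"
      using nrm_pow_le_iff[OF I, of E x 0] nrm_pow_le_iff[OF I, of E x "nrm (pow_space I E) x"] by auto
    also have "\<dots> \<longleftrightarrow> (\<forall>i\<in>I. x i = 0)"
      using nrm_nonneg[OF vecs_pow_mem[OF x]] nrm_eq_0_iff[OF vecs_pow_mem[OF x]] by (metis order_antisym order_refl)
    also have "\<dots> \<longleftrightarrow> x = 0"
      using x by (auto simp: vecs_pow fun_eq_iff)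
    finally show "nrm (pow_space I E) x = 0 \<longleftrightarrow> x = 0" .
  qed (simp add: vecs_pow)
qed

lemma nonarch_space_pow:
  assumes "nonarch_space E" and I: "finite I" shows "nonarch_space (pow_space I E)"
proof -
  interpret nonarch_space E by fact
  interpret P: nonarch_group "pow_space I E" using nonarch_group_pow nonarch_group_axioms I by blast
  show ?thesis
  proof
    fix x c assume x: "x \<in> vecs (pow_space I E)"
    then show "scl (pow_space I E) c x \<in> vecs (pow_space I E)" by (auto simp: vecs_pow scl_mem)
    show "nrm (pow_space I E) (scl (pow_space I E) c x) \<le> vabs c * nrm (pow_space I E) x"
      unfolding nrm_pow_le_iff[OF I]
      using P.nrm_nonneg[OF x] nrm_scl_le[OF vecs_pow_mem[OF x]] nrm_le_nrm_pow[OF I, of _ E x]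
      by (auto intro!: order_trans[OF nrm_scl_le[OF vecs_pow_mem[OF x]]] mult_left_mono)
  qed (auto simp: vecs_pow fun_eq_iff scl_add_right scl_add_left scl_scl scl_one vecs_pow_mem)
qed

text \<open>
  The maximum norm tends to \<open>0\<close> exactly if every coordinate does. This rule keeps the product norms, which
  occur nested in the arguments of difference quotients, out of the continuity proofs.
\<close>
lemma continuous_map_pow_iff:
  assumes "nonarch_group E" and I: "finite I"
  shows "continuous_map T (ntop (pow_space I E)) f \<longleftrightarrow>
     (\<forall>i\<in>I. continuous_map T (ntop E) (\<lambda>t. f t i)) \<and> (\<forall>t\<in>topspace T. \<forall>i. i \<notin> I \<longrightarrow> f t i = 0)"
    (is "?L \<longleftrightarrow> ?R")
proof -
  interpret nonarch_group E by fact
  interpret P: nonarch_group "pow_space I E" using nonarch_group_pow nonarch_group_axioms I by blast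
  show ?thesis
  proof
    assume L: ?L
    show ?R
    proof (intro conjI ballI allI impI)
      fix i assume i: "i \<in> I"
      show "continuous_map T (ntop E) (\<lambda>t. f t i)"
      proof (rule continuous_map_ntopI[where g = "\<lambda>t y. nrm (pow_space I E) (f y - f t)"])
        show "nrm E (f y i - f t i) \<le> nrm (pow_space I E) (f y - f t)" for t y
          using nrm_le_nrm_pow[OF I i, of E "f y - f t"] by simp
      qed (use P.continuous_map_ntopD[OF L] vecs_pow_mem in blast)+
    qed (use P.continuous_map_ntopD(1)[OF L] in \<open>auto simp: vecs_pow\<close>)
  next
    assume R: ?R
    then have c: "continuous_map T (ntop E) (\<lambda>t. f t i)" if "i \<in> I" for i using that by blast
    show ?L
    proof (rule P.continuous_map_ntopI[where g = "\<lambda>t y. \<Sum>i\<in>I. nrm E (f y i - f t i)"])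
      fix t assume t: "t \<in> topspace T"
      show "f t \<in> vecs (pow_space I E)"
        using R t continuous_map_ntopD(1)[OF c t] by (simp add: vecs_pow)
      show "((\<lambda>y. \<Sum>i\<in>I. nrm E (f y i - f t i)) \<longlongrightarrow> 0) (nhdsin T t)"
        using continuous_map_ntopD(2)[OF c t] by (auto intro: tendsto_null_sum)
      fix y assume y: "y \<in> topspace T"
      have nn: "0 \<le> nrm E (f y i - f t i)" if "i \<in> I" for i
        using continuous_map_ntopD(1)[OF c[OF that] t] continuous_map_ntopD(1)[OF c[OF that] y]
        by (simp add: diff_mem nrm_nonneg)
      then show "nrm (pow_space I E) (f y - f t) \<le> (\<Sum>i\<in>I. nrm E (f y i - f t i))"
        unfolding nrm_pow_le_iff[OF I] using I by (auto intro: sum_nonneg member_le_sum)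
    qed
  qed
qed

lemma (in nonarch_space) continuous_map_scl:
  assumes c: "continuous_map T (ntop scalars) c" and x: "continuous_map T (ntop E) x"
  shows "continuous_map T (ntop E) (\<lambda>t. scl E (c t) (x t))"
proof -
  interpret K: nonarch_space "scalars :: ('k, 'k) nspace" by (rule nonarch_space_scalars)
  have nK: "nrm scalars = (vabs :: 'k \<Rightarrow> real)" by (simp add: scalars_def)
  show ?thesis
  proof (rule continuous_map_ntopI[where
      g = "\<lambda>t y. vabs (c y) * nrm E (x y - x t) + vabs (c y - c t) * nrm E (x t)"])
    fix t assume t: "t \<in> topspace T"
    note xt = continuous_map_ntopD(1)[OF x t]
    show "scl E (c t) (x t) \<in> vecs E" by (simp add: scl_mem xt)
    show "((\<lambda>y. vabs (c y) * nrm E (x y - x t) + vabs (c y - c t) * nrm E (x t)) \<longlongrightarrow> 0) (nhdsin T t)"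
      using continuous_map_ntopD(2)[OF x t] K.continuous_map_ntopD(2)[OF c t] K.tendsto_nrm[OF c t]
      unfolding nK by (auto intro!: tendsto_eq_intros)
    fix y assume y: "y \<in> topspace T"
    note xy = continuous_map_ntopD(1)[OF x y]
    have "scl E (c y) (x y) - scl E (c t) (x t) = scl E (c y) (x y - x t) + scl E (c y - c t) (x t)"
      using xt xy by (simp add: scl_diff_left scl_diff_right)
    also have "nrm E \<dots> \<le> max (nrm E (scl E (c y) (x y - x t))) (nrm E (scl E (c y - c t) (x t)))"
      using xt xy by (intro nrm_add_le scl_mem diff_mem)
    also have "\<dots> \<le> max (vabs (c y) * nrm E (x y - x t)) (vabs (c y - c t) * nrm E (x t))"
      using xt xy by (intro max.mono nrm_scl_le diff_mem)
    also have "\<dots> \<le> vabs (c y) * nrm E (x y - x t) + vabs (c y - c t) * nrm E (x t)"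
      using xt xy by (simp add: nrm_nonneg diff_mem)
    finally show "nrm E (scl E (c y) (x y) - scl E (c t) (x t))
        \<le> vabs (c y) * nrm E (x y - x t) + vabs (c y - c t) * nrm E (x t)" .
  qed
qed


subsection \<open>Continuous functions on a compact set\<close>

lemma vecs_C0:
  "f \<in> vecs (C0_space B E) \<longleftrightarrow> continuous_map (top_of_set B) (ntop E) f \<and> (\<forall>v. v \<notin> B \<longrightarrow> f v = 0)"
  by (simp add: C0_space_def)

lemma scl_C0 [simp]: "scl (C0_space B E) c f v = scl E c (f v)"
  by (simp add: C0_space_def)

lemma (in nonarch_group) bdd_above_C0:
  assumes B: "compact B" and f: "f \<in> vecs (C0_space B E)"
  shows "bdd_above ((\<lambda>v. nrm E (f v)) ` B)"
proof -
  have "continuous_map (top_of_set B) euclideanreal (\<lambda>v. nrm E (f v))"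
    using f by (intro continuous_map_nrm) (simp add: vecs_C0)
  then have "compact ((\<lambda>v. nrm E (f v)) ` B)"
    using B compact_continuous_image by force
  then show ?thesis by (simp add: compact_imp_bounded bounded_imp_bdd_above)
qed

lemma (in nonarch_group) nrm_le_nrm_C0:
  assumes "compact B" "f \<in> vecs (C0_space B E)" "v \<in> B"
  shows "nrm E (f v) \<le> nrm (C0_space B E) f"
  using cSUP_upper[OF assms(3) bdd_above_C0[OF assms(1,2)]] by (simp add: C0_space_def)

lemma nrm_C0_le: "B \<noteq> {} \<Longrightarrow> (\<And>v. v \<in> B \<Longrightarrow> nrm E (f v) \<le> c) \<Longrightarrow> nrm (C0_space B E) f \<le> c"
  by (auto simp: C0_space_def intro: cSUP_least)

lemma (in nonarch_group) vecs_C0_mem: "f \<in> vecs (C0_space B E) \<Longrightarrow> f v \<in> vecs E"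
  using continuous_map_ntopD(1)[of "top_of_set B" f v] by (cases "v \<in> B") (auto simp: vecs_C0)

lemma nonarch_group_C0:
  fixes B :: "'k::nonarch_valued_field set"
  assumes "nonarch_group E" and B: "compact B" "B \<noteq> {}" shows "nonarch_group (C0_space B E)"
proof -
  interpret nonarch_group E by fact
  show ?thesis
  proof (rule nonarch_group_SUP[where D = B and q = "\<lambda>f v. nrm E (f v)"])
    fix x assume x: "x \<in> vecs (C0_space B E)"
    show "bdd_above ((\<lambda>v. nrm E (x v)) ` B)" by (rule bdd_above_C0[OF B(1) x])
    show "x = 0" if "\<forall>a\<in>B. nrm E (x a) = 0"
    proof
      fix v show "x v = 0 v"
        using that nrm_eq_0_iff[OF vecs_C0_mem[OF x]] x by (cases "v \<in> B") (auto simp: vecs_C0)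
    qed
    show "0 \<le> nrm E (x v)" for v using x by (simp add: nrm_nonneg vecs_C0_mem)
    fix y assume y: "y \<in> vecs (C0_space B E)"
    show "x - y \<in> vecs (C0_space B E)"
      using continuous_map_diff[of "top_of_set B" x y] x y by (auto simp: vecs_C0 fun_diff_def)
    show "nrm E ((x - y) v) \<le> max (nrm E (x v)) (nrm E (y v))" for v
      using nrm_diff_le[OF vecs_C0_mem[OF x] vecs_C0_mem[OF y]] by simp
  next
    show "0 \<in> vecs (C0_space B E)" using continuous_map_zero by (auto simp: vecs_C0 zero_fun_def)
  qed (use B in \<open>auto simp: C0_space_def\<close>)
qed

lemma nonarch_space_C0:
  fixes B :: "'k::nonarch_valued_field set"
  assumes "nonarch_space E" and B: "compact B" "B \<noteq> {}" shows "nonarch_space (C0_space B E)"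
proof -
  interpret nonarch_space E by fact
  interpret C: nonarch_group "C0_space B E" using nonarch_group_C0 nonarch_group_axioms B by blast
  interpret K: nonarch_space "scalars :: ('k, 'k) nspace" by (rule nonarch_space_scalars)
  show ?thesis
  proof
    fix x c assume x: "x \<in> vecs (C0_space B E)"
    have "continuous_map (top_of_set B) (ntop E) (\<lambda>v. scl E c (x v))"
      using x by (intro continuous_map_scl) (auto simp: vecs_C0, simp add: scalars_def)
    then show "scl (C0_space B E) c x \<in> vecs (C0_space B E)"
      using x by (simp add: vecs_C0) (simp add: C0_space_def)
    show "nrm (C0_space B E) (scl (C0_space B E) c x) \<le> vabs c * nrm (C0_space B E) x"
      using B nrm_le_nrm_C0[OF B(1) x]
      by (intro nrm_C0_le) (auto intro!: order_trans[OF nrm_scl_le[OF vecs_C0_mem[OF x]]] mult_left_mono)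
  qed (auto simp: fun_eq_iff scl_add_right scl_add_left scl_scl scl_one vecs_C0_mem)
qed

lemma (in nonarch_group) continuous_map_eval_C0:
  fixes B :: "'k::nonarch_valued_field set"
  assumes B: "compact B" "B \<noteq> {}"
    and f: "continuous_map T (ntop (C0_space B E)) f" and s: "continuous_map T (top_of_set B) s"
  shows "continuous_map T (ntop E) (\<lambda>t. f t (s t))"
proof -
  interpret C: nonarch_group "C0_space B E" using nonarch_group_C0 nonarch_group_axioms B by blast
  have sB: "s t \<in> B" if "t \<in> topspace T" for t
    using continuous_map_image_subset_topspace[OF s] that by auto
  show ?thesis
  proof (rule continuous_map_ntopI[where
      g = "\<lambda>t y. max (nrm (C0_space B E) (f y - f t)) (nrm E (f t (s y) - f t (s t)))"])
    fix t assume t: "t \<in> topspace T"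
    note ft = C.continuous_map_ntopD(1)[OF f t]
    show "f t (s t) \<in> vecs E" by (simp add: vecs_C0_mem[OF ft])
    have "continuous_map (top_of_set B) (ntop E) (f t)" using ft by (simp add: vecs_C0)
    from continuous_map_compose[OF s this]
    have "continuous_map T (ntop E) (\<lambda>y. f t (s y))" by (simp add: o_def)
    from tendsto_max[OF C.continuous_map_ntopD(2)[OF f t] continuous_map_ntopD(2)[OF this t]]
    show "((\<lambda>y. max (nrm (C0_space B E) (f y - f t)) (nrm E (f t (s y) - f t (s t)))) \<longlongrightarrow> 0) (nhdsin T t)"
      by simp
    fix y assume y: "y \<in> topspace T"
    note fy = C.continuous_map_ntopD(1)[OF f y]
    have "nrm E (f y (s y) - f t (s t)) \<le> max (nrm E (f y (s y) - f t (s y))) (nrm E (f t (s y) - f t (s t)))"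
      by (intro nrm_ultrametric vecs_C0_mem[OF ft] vecs_C0_mem[OF fy])
    also have "\<dots> \<le> max (nrm (C0_space B E) (f y - f t)) (nrm E (f t (s y) - f t (s t)))"
      using nrm_le_nrm_C0[OF B(1) C.diff_mem[OF fy ft] sB[OF y]] by (intro max.mono) auto
    finally show "nrm E (f y (s y) - f t (s t))
        \<le> max (nrm (C0_space B E) (f y - f t)) (nrm E (f t (s y) - f t (s t)))" .
  qed
qed


subsection \<open>Operator norms\<close>

lemma lin_spaceD:
  assumes "T \<in> vecs (lin_space E)"
  shows "x \<in> vecs E \<Longrightarrow> T x \<in> vecs E" and "x \<notin> vecs E \<Longrightarrow> T x = 0"
    and "x \<in> vecs E \<Longrightarrow> y \<in> vecs E \<Longrightarrow> T (x + y) = T x + T y"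
    and "x \<in> vecs E \<Longrightarrow> T (scl E c x) = scl E c (T x)"
    and "\<exists>C. \<forall>x\<in>vecs E. nrm E (T x) \<le> C * nrm E x"
  using assms unfolding lin_space_def by auto

lemma (in nonarch_space) bdd_above_lin:
  assumes "T \<in> vecs (lin_space E)" shows "bdd_above ((\<lambda>x. nrm E (T x) / nrm E x) ` vecs E)"
proof -
  obtain C where C: "\<And>x. x \<in> vecs E \<Longrightarrow> nrm E (T x) \<le> C * nrm E x"
    using lin_spaceD(5)[OF assms] by blast
  have "nrm E (T y) / nrm E y \<le> max C 0" if "y \<in> vecs E" for y
    using C[OF that] nrm_nonneg[OF that]
    by (cases "nrm E y = 0") (auto simp: divide_le_eq intro: order_trans mult_right_mono)
  then show ?thesis by (auto intro!: bdd_aboveI)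
qed

lemma (in nonarch_space) nrm_apply_lin_le:
  assumes T: "T \<in> vecs (lin_space E)" and x: "x \<in> vecs E"
  shows "nrm E (T x) \<le> nrm (lin_space E) T * nrm E x"
proof (cases "x = 0")
  case True
  moreover have "T 0 = 0"
  proof -
    have "T (0 + 0) = T 0 + T 0" using lin_spaceD(3)[OF T] zero_mem by blast
    then show ?thesis by simp
  qed
  ultimately show ?thesis by simp
next
  case False
  then have pos: "0 < nrm E x" using nrm_eq_0_iff[OF x] nrm_nonneg[OF x] by simp
  have "nrm E (T x) / nrm E x \<le> (SUP x\<in>vecs E. nrm E (T x) / nrm E x)"
    using x bdd_above_lin[OF T] by (intro cSUP_upper)
  then show ?thesis using pos by (simp add: lin_space_def field_simps)
qed

lemma nonarch_group_lin:
  assumes "nonarch_space E" shows "nonarch_group (lin_space E)"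
proof -
  interpret nonarch_space E by fact
  show ?thesis
  proof (rule nonarch_group_SUP[where D = "vecs E" and q = "\<lambda>T x. nrm E (T x) / nrm E x"])
    fix S assume S: "S \<in> vecs (lin_space E)"
    then have SE: "S x \<in> vecs E" if "x \<in> vecs E" for x using that by (simp add: lin_space_def)
    obtain C where C: "\<And>x. x \<in> vecs E \<Longrightarrow> nrm E (S x) \<le> C * nrm E x"
    using lin_spaceD(5)[OF S] by blast
    show "bdd_above ((\<lambda>x. nrm E (S x) / nrm E x) ` vecs E)" by (rule bdd_above_lin[OF S])
    show "0 \<le> nrm E (S x) / nrm E x" if "x \<in> vecs E" for x
      using SE that by (simp add: nrm_nonneg)
    show "S = 0" if "\<forall>x\<in>vecs E. nrm E (S x) / nrm E x = 0"
    proof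
      fix x
      have "nrm E (S x) = 0" if x: "x \<in> vecs E"
        using \<open>\<forall>x\<in>vecs E. nrm E (S x) / nrm E x = 0\<close> C[OF x] nrm_nonneg[OF SE[OF x]] x by auto
      then show "S x = 0 x"
        using S nrm_eq_0_iff[OF SE] by (cases "x \<in> vecs E") (auto simp: lin_space_def)
    qed
    fix T assume T: "T \<in> vecs (lin_space E)"
    then have TE: "T x \<in> vecs E" if "x \<in> vecs E" for x using that by (simp add: lin_space_def)
    obtain D where D: "\<And>x. x \<in> vecs E \<Longrightarrow> nrm E (T x) \<le> D * nrm E x"
      using lin_spaceD(5)[OF T] by blast
    have "nrm E (S x - T x) \<le> max C D * nrm E x" if "x \<in> vecs E" for x
    proof -
      have "nrm E (S x - T x) \<le> max (C * nrm E x) (D * nrm E x)"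
        using nrm_diff_le[OF SE[OF that] TE[OF that]] C[OF that] D[OF that] by linarith
      then show ?thesis using nrm_nonneg[OF that] by (simp add: max_mult_distrib_right)
    qed
    then show "S - T \<in> vecs (lin_space E)"
      using S T by (auto simp: lin_space_def diff_mem scl_diff_right)
    show "nrm E ((S - T) x) / nrm E x \<le> max (nrm E (S x) / nrm E x) (nrm E (T x) / nrm E x)"
      if "x \<in> vecs E" for x
      using divide_right_mono[OF nrm_diff_le[OF SE[OF that] TE[OF that]] nrm_nonneg[OF that]]
        nrm_nonneg[OF that] by (simp add: max_divide_distrib_right)
  next
    show "0 \<in> vecs (lin_space E)" by (auto simp: lin_space_def intro: exI[of _ 0])
    show "vecs E \<noteq> {}" using zero_mem by blast
  qed (auto simp: lin_space_def)
qed

lemma (in nonarch_space) continuous_map_apply_lin: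
  assumes A: "continuous_map T (ntop (lin_space E)) A" and x: "continuous_map T (ntop E) x"
  shows "continuous_map T (ntop E) (\<lambda>t. A t (x t))"
proof -
  interpret L: nonarch_group "lin_space E" using nonarch_group_lin nonarch_space_axioms by blast
  have Amem: "A t a \<in> vecs E" if "t \<in> topspace T" "a \<in> vecs E" for t a
    using L.continuous_map_ntopD(1)[OF A that(1)] that(2) by (simp add: lin_space_def)
  show ?thesis
  proof (rule continuous_map_ntopI[where g = "\<lambda>t y. max (nrm (lin_space E) (A y - A t) * nrm E (x y))
        (nrm (lin_space E) (A t) * nrm E (x y - x t))"])
    fix t assume t: "t \<in> topspace T"
    note At = L.continuous_map_ntopD(1)[OF A t] and xt = continuous_map_ntopD(1)[OF x t]
    show "A t (x t) \<in> vecs E" using Amem t xt by blast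
    have "((\<lambda>y. max (nrm (lin_space E) (A y - A t) * nrm E (x y))
        (nrm (lin_space E) (A t) * nrm E (x y - x t))) \<longlongrightarrow> max (0 * nrm E (x t)) (nrm (lin_space E) (A t) * 0))
        (nhdsin T t)"
      by (intro tendsto_intros tendsto_max L.continuous_map_ntopD[OF A t] continuous_map_ntopD[OF x t] tendsto_nrm[OF x t])
    then show "((\<lambda>y. max (nrm (lin_space E) (A y - A t) * nrm E (x y))
        (nrm (lin_space E) (A t) * nrm E (x y - x t))) \<longlongrightarrow> 0) (nhdsin T t)" by simp
    fix y assume y: "y \<in> topspace T"
    note Ay = L.continuous_map_ntopD(1)[OF A y] and xy = continuous_map_ntopD(1)[OF x y]
    have "A t (x y - x t + x t) = A t (x y - x t) + A t (x t)"
      by (rule lin_spaceD(3)[OF At diff_mem[OF xy xt] xt])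
    then have "nrm E (A y (x y) - A t (x t)) = nrm E ((A y - A t) (x y) + A t (x y - x t))" by simp
    also have "\<dots> \<le> max (nrm E ((A y - A t) (x y))) (nrm E (A t (x y - x t)))"
      using Amem t y xt xy by (intro nrm_add_le) (auto simp: diff_mem)
    also have "\<dots> \<le> max (nrm (lin_space E) (A y - A t) * nrm E (x y)) (nrm (lin_space E) (A t) * nrm E (x y - x t))"
      by (intro max.mono nrm_apply_lin_le L.diff_mem diff_mem At Ay xt xy)
    finally show "nrm E (A y (x y) - A t (x t)) \<le> \<dots>" .
  qed
qed

lemma mult_spaceD:
  assumes "M \<in> vecs (mult_space I E F)"
  shows "continuous_map (ntop (pow_space I E)) (ntop F) M"
    and "x \<notin> vecs (pow_space I E) \<Longrightarrow> M x = 0"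
    and "x \<in> vecs (pow_space I E) \<Longrightarrow> i \<in> I \<Longrightarrow> a \<in> vecs E \<Longrightarrow> b \<in> vecs E \<Longrightarrow>
      M (x(i := a + b)) = M (x(i := a)) + M (x(i := b))"
    and "x \<in> vecs (pow_space I E) \<Longrightarrow> i \<in> I \<Longrightarrow> a \<in> vecs E \<Longrightarrow>
      M (x(i := scl E c a)) = scl F c (M (x(i := a)))"
  using assms by (auto simp: mult_space_def)

lemma mult_space_scl_all:
  assumes "nonarch_space E" "nonarch_space F" and M: "M \<in> vecs (mult_space I E F)"
    and S: "finite S" "S \<subseteq> I" and I: "finite I" and x: "x \<in> vecs (pow_space I E)"
  shows "M (\<lambda>i. if i \<in> S then scl E (c i) (x i) else x i) = scl F (\<Prod>i\<in>S. c i) (M x)"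
proof -
  interpret E: nonarch_space E by fact
  interpret F: nonarch_space F by fact
  interpret P: nonarch_group "pow_space I E"
    using nonarch_group_pow E.nonarch_group_axioms I by blast
  have Mx: "M x \<in> vecs F" using F.continuous_map_ntopD(1)[OF mult_spaceD(1)[OF M]] x by simp
  show ?thesis
    using S
  proof (induction S)
    case empty
    then show ?case using F.scl_one[OF Mx] by simp
  next
    case (insert k S)
    define y where "y = (\<lambda>i. if i \<in> S then scl E (c i) (x i) else x i)"
    have y: "y \<in> vecs (pow_space I E)"
      using x insert by (auto simp: vecs_pow y_def E.scl_mem)
    have "(\<lambda>i. if i \<in> insert k S then scl E (c i) (x i) else x i) = y(k := scl E (c k) (y k))"
      using insert by (auto simp: y_def fun_eq_iff)
    then have "M (\<lambda>i. if i \<in> insert k S then scl E (c i) (x i) else x i) = scl F (c k) (M y)"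
      using mult_spaceD(4)[OF M y, of k "y k" "c k"] insert E.vecs_pow_mem[OF y] by simp
    then show ?case
      using insert Mx by (simp add: y_def F.scl_scl)
  qed
qed

lemma mult_space_eq_0:
  assumes "nonarch_space E" "nonarch_space F" and M: "M \<in> vecs (mult_space I E F)"
    and x: "x \<in> vecs (pow_space I E)" and i: "i \<in> I" "x i = 0" and I: "finite I"
  shows "M x = 0"
proof -
  interpret E: nonarch_space E by fact
  interpret F: nonarch_space F by fact
  have "M (x(i := 0 + 0)) = M (x(i := 0)) + M (x(i := 0))"
    using mult_spaceD(3)[OF M x i(1), of 0 0] by simp
  moreover have "x(i := 0) = x" using i by auto
  ultimately show ?thesis by simp
qed

text \<open>
  By continuity at \<open>0\<close>, the operator is bounded on a ball of some radius \<open>d\<close>. Each nonzero argument \<open>x\<^sub>i\<close>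
  is moved by a scalar \<open>c\<^sub>i\<close> into the shell \<open>d\<bar>a\<bar>/2 \<le> \<bar>c\<^sub>i\<bar> \<bar>x\<^sub>i\<bar> \<le> d/2\<close>, where \<open>0 < \<bar>a\<bar> < 1\<close>; the lower
  bound controls the factor \<open>\<bar>c\<^sub>i\<bar>\<close> that homogeneity divides by. An exact normalization is not
  possible in general, because the norm of \<open>x\<^sub>i\<close> need not be the absolute value of a scalar.
\<close>
lemma mult_space_bounded:
  fixes E :: "('k::nonarch_local_field, 'e::ab_group_add) nspace"
  assumes "nonarch_space E" "nonarch_space F" and M: "M \<in> vecs (mult_space I E F)" and I: "finite I"
  obtains C where "\<And>x. x \<in> vecs (pow_space I E) \<Longrightarrow> nrm F (M x) \<le> C * (\<Prod>i\<in>I. nrm E (x i))" "0 \<le> C"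
proof -
  interpret E: nonarch_space E by fact
  interpret F: nonarch_space F by fact
  interpret P: nonarch_group "pow_space I E"
    using nonarch_group_pow E.nonarch_group_axioms I by blast
  have MF: "M x \<in> vecs F" if "x \<in> vecs (pow_space I E)" for x
    using F.continuous_map_ntopD(1)[OF mult_spaceD(1)[OF M]] that by simp
  have "((\<lambda>y. nrm F (M y - M 0)) \<longlongrightarrow> 0) (nhdsin (ntop (pow_space I E)) 0)"
    using F.continuous_map_ntopD(2)[OF mult_spaceD(1)[OF M]] by simp
  then have "eventually (\<lambda>y. nrm F (M y - M 0) < 1) (nhdsin (ntop (pow_space I E)) 0)"
    by (rule order_tendstoD) simp
  then obtain U where U: "openin (ntop (pow_space I E)) U" "0 \<in> U" "\<forall>y\<in>U. nrm F (M y - M 0) < 1"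
    by (auto simp: eventually_nhdsin)
  then obtain d where d: "d > 0" "P.mball 0 d \<subseteq> U"
    unfolding P.mtopology_eq[symmetric] P.openin_mtopology by auto
  have small: "nrm F (M y) \<le> max 1 (nrm F (M 0))" if y: "y \<in> vecs (pow_space I E)" "nrm (pow_space I E) y < d" for y
  proof -
    have "y \<in> P.mball 0 d" using y by (simp add: P.in_mball ndist_def P.nrm_uminus)
    then have "nrm F (M y - M 0) < 1" using d U by blast
    then show ?thesis
      using F.nrm_add_le[OF F.diff_mem[OF MF MF] MF, of y 0 0] y by simp
  qed
  obtain a :: 'k where a: "a \<noteq> 0" "vabs a < 1" using vabs_nontrivial by blast
  \<comment> \<open>Take the smallest exponent, possibly negative, for which a power of \<open>a\<close> moves \<open>s\<close> to at most \<open>d / 2\<close>.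
    The shift by \<open>m0\<close> makes the exponent a natural number and lets \<open>P 0\<close> fail.\<close>
  have scale: "\<exists>c::'k. c \<noteq> 0 \<and> vabs c * s \<le> d / 2 \<and> inverse (vabs c) \<le> s * (2 / (d * vabs a))" if "s > 0" for s
  proof -
    have ex: "\<exists>n. vabs a ^ n < e" if "e > 0" for e
      using a that by (intro real_arch_pow_inv) auto
    obtain n0 where n0: "vabs a ^ n0 < d / (2 * s)" using ex d \<open>s > 0\<close> by fastforce
    obtain m0 where m0: "vabs a ^ m0 < (2 * s) / d" using ex[of "(2 * s) / d"] d \<open>s > 0\<close> by auto
    define P where "P n \<longleftrightarrow> vabs a ^ n / vabs a ^ m0 * s \<le> d / 2" for n
    have "P (n0 + m0)"
      using n0 \<open>s > 0\<close> a by (simp add: P_def power_add field_simps)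
    then have Pn: "P (LEAST n. P n)" by (rule LeastI)
    have "(LEAST n. P n) \<noteq> 0"
    proof
      assume "(LEAST n. P n) = 0"
      then have "P 0" using Pn by simp
      then show False using m0 \<open>s > 0\<close> a d by (simp add: P_def field_simps)
    qed
    then obtain n where n: "(LEAST n. P n) = Suc n" by (cases "LEAST n. P n") auto
    then have "\<not> P n" using not_less_Least[of n P] by simp
    define c where "c = a ^ Suc n * inverse (a ^ m0)"
    have c0: "c \<noteq> 0" using a by (simp add: c_def)
    have vc: "vabs c = vabs a ^ Suc n / vabs a ^ m0"
      by (simp add: c_def vabs_mult vabs_inverse vabs_power divide_inverse)
    with \<open>\<not> P n\<close> have "d / 2 < vabs c / vabs a * s" using a by (simp add: P_def)
    then have "inverse (vabs c) \<le> s * (2 / (d * vabs a))"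
      using c0 a d by (simp add: field_simps)
    then show ?thesis using Pn n c0 vc by (auto simp: P_def)
  qed
  define K where "K = (2 / (d * vabs a)) ^ card I"
  show thesis
  proof (rule that[of "max 1 (nrm F (M 0)) * K"])
    show "0 \<le> max 1 (nrm F (M 0)) * K" using d a by (simp add: K_def)
    fix x assume x: "x \<in> vecs (pow_space I E)"
    have nn: "0 \<le> nrm E (x i)" for i using E.nrm_nonneg[OF E.vecs_pow_mem[OF x]] by simp
    show "nrm F (M x) \<le> max 1 (nrm F (M 0)) * K * (\<Prod>i\<in>I. nrm E (x i))"
    proof (cases "\<exists>i\<in>I. x i = 0")
      case True
      then have "M x = 0" using mult_space_eq_0[OF assms(1,2) M x] I by blast
      then show ?thesis using nn d a by (auto simp: K_def intro!: mult_nonneg_nonneg prod_nonneg)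
    next
      case False
      have "0 < nrm E (x i)" if "i \<in> I" for i
        using False that nn[of i] E.nrm_eq_0_iff[OF E.vecs_pow_mem[OF x, of i]] by (metis order_le_less)
      then have "\<forall>i\<in>I. \<exists>c::'k. c \<noteq> 0 \<and> vabs c * nrm E (x i) \<le> d / 2
          \<and> inverse (vabs c) \<le> nrm E (x i) * (2 / (d * vabs a))"
        using scale by blast
      then obtain c :: "nat \<Rightarrow> 'k" where c: "\<And>i. i \<in> I \<Longrightarrow> c i \<noteq> 0"
          "\<And>i. i \<in> I \<Longrightarrow> vabs (c i) * nrm E (x i) \<le> d / 2"
          "\<And>i. i \<in> I \<Longrightarrow> inverse (vabs (c i)) \<le> nrm E (x i) * (2 / (d * vabs a))"
        by metis
      define y where "y = (\<lambda>i. if i \<in> I then scl E (c i) (x i) else x i)"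
      have y: "y \<in> vecs (pow_space I E)" using x by (auto simp: vecs_pow y_def E.scl_mem)
      have "nrm E (y i) \<le> d / 2" if "i \<in> I" for i
        using E.nrm_scl_le[OF E.vecs_pow_mem[OF x], of "c i" i] c(2)[OF that] that by (simp add: y_def)
      then have "nrm (pow_space I E) y \<le> d / 2"
        unfolding nrm_pow_le_iff[OF I] using d by simp
      then have My: "nrm F (M y) \<le> max 1 (nrm F (M 0))" using small[OF y] d by simp
      define p where "p = (\<Prod>i\<in>I. c i)"
      have p0: "p \<noteq> 0" using c(1) I by (simp add: p_def)
      have "M y = scl F p (M x)"
        unfolding y_def p_def using mult_space_scl_all[OF assms(1,2) M I subset_refl I x] .
      then have "M x = scl F (inverse p) (M y)"
        using F.scl_scl[OF MF[OF x]] F.scl_one[OF MF[OF x]] p0 by simp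
      then have "nrm F (M x) \<le> vabs (inverse p) * nrm F (M y)"
        using F.nrm_scl_le[OF MF[OF y]] by simp
      also have "\<dots> \<le> vabs (inverse p) * max 1 (nrm F (M 0))"
        using My by (intro mult_left_mono) auto
      finally have Mx: "nrm F (M x) \<le> vabs (inverse p) * max 1 (nrm F (M 0))" .
      have "vabs (inverse p) = (\<Prod>i\<in>I. inverse (vabs (c i)))"
        unfolding p_def using I by (induction I) (auto simp: vabs_mult vabs_inverse)
      also have "\<dots> \<le> (\<Prod>i\<in>I. nrm E (x i) * (2 / (d * vabs a)))"
        using c by (intro prod_mono) auto
      also have "\<dots> = K * (\<Prod>i\<in>I. nrm E (x i))"
        by (simp only: prod.distrib K_def prod_constant mult.commute)
      finally have "vabs (inverse p) * max 1 (nrm F (M 0)) \<le> K * (\<Prod>i\<in>I. nrm E (x i)) * max 1 (nrm F (M 0))"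
        by (rule mult_right_mono) simp
      with Mx show ?thesis by (simp only: mult_ac)
    qed
  qed
qed

lemma bdd_above_mult:
  fixes E :: "('k::nonarch_local_field, 'e::ab_group_add) nspace"
  assumes "nonarch_space E" "nonarch_space F" and M: "M \<in> vecs (mult_space I E F)" and I: "finite I"
  shows "bdd_above ((\<lambda>x. nrm F (M x) / (\<Prod>i\<in>I. nrm E (x i))) ` vecs (pow_space I E))"
proof -
  interpret E: nonarch_space E by fact
  obtain C where C: "\<And>x. x \<in> vecs (pow_space I E) \<Longrightarrow> nrm F (M x) \<le> C * (\<Prod>i\<in>I. nrm E (x i))" "0 \<le> C"
    using mult_space_bounded[OF assms] by blast
  show ?thesis
  proof (rule bdd_aboveI2)
    fix x assume x: "x \<in> vecs (pow_space I E)"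
    have "0 \<le> (\<Prod>i\<in>I. nrm E (x i))"
      using E.nrm_nonneg[OF E.vecs_pow_mem[OF x]] by (auto intro: prod_nonneg)
    then show "nrm F (M x) / (\<Prod>i\<in>I. nrm E (x i)) \<le> C"
      using C(1)[OF x] C(2) by (cases "(\<Prod>i\<in>I. nrm E (x i)) = 0") (auto simp: divide_le_eq)
  qed
qed

lemma nrm_apply_mult_le:
  fixes E :: "('k::nonarch_local_field, 'e::ab_group_add) nspace"
  assumes "nonarch_space E" "nonarch_space F" and M: "M \<in> vecs (mult_space I E F)" and I: "finite I"
    and x: "x \<in> vecs (pow_space I E)"
  shows "nrm F (M x) \<le> nrm (mult_space I E F) M * (\<Prod>i\<in>I. nrm E (x i))"
proof (cases "(\<Prod>i\<in>I. nrm E (x i)) = 0")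
  case True
  interpret E: nonarch_space E by fact
  interpret F: nonarch_space F by fact
  obtain i where "i \<in> I" "x i = 0"
    using True I E.nrm_eq_0_iff[OF E.vecs_pow_mem[OF x]] by auto
  then have "M x = 0" using mult_space_eq_0[OF assms(1,2) M x] I by blast
  then show ?thesis using True by simp
next
  case False
  interpret E: nonarch_space E by fact
  have "0 \<le> (\<Prod>i\<in>I. nrm E (x i))"
    using E.nrm_nonneg[OF E.vecs_pow_mem[OF x]] by (auto intro: prod_nonneg)
  with False have "0 < (\<Prod>i\<in>I. nrm E (x i))" by simp
  moreover have "nrm F (M x) / (\<Prod>i\<in>I. nrm E (x i)) \<le> nrm (mult_space I E F) M"
    using cSUP_upper[OF x bdd_above_mult[OF assms(1-4)]] by (simp add: mult_space_def)
  ultimately show ?thesis by (simp add: divide_le_eq)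
qed

lemma nonarch_group_mult:
  fixes E :: "('k::nonarch_local_field, 'e::ab_group_add) nspace"
  assumes "nonarch_space E" "nonarch_space F" and I: "finite I"
  shows "nonarch_group (mult_space I E F)"
proof -
  interpret E: nonarch_space E by fact
  interpret F: nonarch_space F by fact
  interpret P: nonarch_group "pow_space I E"
    using nonarch_group_pow E.nonarch_group_axioms I by blast
  show ?thesis
  proof (rule nonarch_group_SUP[where D = "vecs (pow_space I E)"
        and q = "\<lambda>M x. nrm F (M x) / (\<Prod>i\<in>I. nrm E (x i))"])
    have pos: "0 \<le> (\<Prod>i\<in>I. nrm E (x i))" if "x \<in> vecs (pow_space I E)" for x
      using E.nrm_nonneg[OF E.vecs_pow_mem[OF that]] by (auto intro: prod_nonneg)
    fix S assume S: "S \<in> vecs (mult_space I E F)"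
    then have SF: "S x \<in> vecs F" if "x \<in> vecs (pow_space I E)" for x
      using F.continuous_map_ntopD(1)[OF mult_spaceD(1)[OF S]] that by simp
    show "bdd_above ((\<lambda>x. nrm F (S x) / (\<Prod>i\<in>I. nrm E (x i))) ` vecs (pow_space I E))"
      by (rule bdd_above_mult) fact+
    show "0 \<le> nrm F (S x) / (\<Prod>i\<in>I. nrm E (x i))" if "x \<in> vecs (pow_space I E)" for x
      using SF[OF that] pos[OF that] by (simp add: F.nrm_nonneg)
    show "S = 0" if 0: "\<forall>x\<in>vecs (pow_space I E). nrm F (S x) / (\<Prod>i\<in>I. nrm E (x i)) = 0"
    proof
      fix x
      have "S x = 0" if x: "x \<in> vecs (pow_space I E)"
      proof (cases "\<exists>i\<in>I. x i = 0")
        case True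
        then show ?thesis using mult_space_eq_0[OF assms(1,2) S x] I by blast
      next
        case False
        then have "(\<Prod>i\<in>I. nrm E (x i)) \<noteq> 0"
          using I E.nrm_eq_0_iff[OF E.vecs_pow_mem[OF x]] by auto
        then show ?thesis using 0 x F.nrm_eq_0_iff[OF SF[OF x]] by auto
      qed
      then show "S x = 0 x" using mult_spaceD(2)[OF S] by (cases "x \<in> vecs (pow_space I E)") auto
    qed
    fix T assume T: "T \<in> vecs (mult_space I E F)"
    then have TF: "T x \<in> vecs F" if "x \<in> vecs (pow_space I E)" for x
      using F.continuous_map_ntopD(1)[OF mult_spaceD(1)[OF T]] that by simp
    show "S - T \<in> vecs (mult_space I E F)"
      using F.continuous_map_diff[OF mult_spaceD(1)[OF S] mult_spaceD(1)[OF T]]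
      by (auto simp: mult_space_def fun_diff_def mult_spaceD(2)[OF S] mult_spaceD(2)[OF T]
          mult_spaceD(3)[OF S] mult_spaceD(3)[OF T] mult_spaceD(4)[OF S] mult_spaceD(4)[OF T]
          F.scl_diff_right SF TF vecs_pow_upd)
    show "nrm F ((S - T) x) / (\<Prod>i\<in>I. nrm E (x i))
        \<le> max (nrm F (S x) / (\<Prod>i\<in>I. nrm E (x i))) (nrm F (T x) / (\<Prod>i\<in>I. nrm E (x i)))"
      if "x \<in> vecs (pow_space I E)" for x
      using divide_right_mono[OF F.nrm_diff_le[OF SF[OF that] TF[OF that]] pos[OF that]]
        pos[OF that] by (simp add: max_divide_distrib_right)
  next
    show "0 \<in> vecs (mult_space I E F)" using F.continuous_map_zero
      by (auto simp: mult_space_def zero_fun_def)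
    show "vecs (pow_space I E) \<noteq> {}" using P.zero_mem by blast
  qed (auto simp: mult_space_def)
qed

text \<open>
  Evaluation is jointly continuous in the operator and its argument: the operator norm controls the change of the
  operator, and the continuity of the operator at the limit controls the change of the argument.
\<close>
lemma continuous_map_apply_mult:
  fixes E :: "('k::nonarch_local_field, 'e::ab_group_add) nspace"
  assumes "nonarch_space E" "nonarch_space F" and I: "finite I"
    and g: "continuous_map T (ntop (mult_space I E F)) g" and x: "continuous_map T (ntop (pow_space I E)) x"
  shows "continuous_map T (ntop F) (\<lambda>t. g t (x t))"
proof -
  interpret E: nonarch_space E by fact
  interpret F: nonarch_space F by fact
  interpret P: nonarch_group "pow_space I E"
    using nonarch_group_pow E.nonarch_group_axioms I by blast
  interpret L: nonarch_group "mult_space I E F" using nonarch_group_mult assms by blast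
  let ?p = "\<lambda>y. \<Prod>i\<in>I. nrm E (x y i)"
  show ?thesis
  proof (rule F.continuous_map_ntopI[where
      g = "\<lambda>t y. max (nrm (mult_space I E F) (g y - g t) * ?p y) (nrm F (g t (x y) - g t (x t)))"])
    fix t assume t: "t \<in> topspace T"
    note gt = L.continuous_map_ntopD(1)[OF g t] and xt = P.continuous_map_ntopD(1)[OF x t]
    have gF: "h a \<in> vecs F" if "h \<in> vecs (mult_space I E F)" "a \<in> vecs (pow_space I E)" for h a
      using F.continuous_map_ntopD(1)[OF mult_spaceD(1)[OF that(1)]] that by simp
    show "g t (x t) \<in> vecs F" using gF gt xt by blast
    have "continuous_map T (ntop F) (\<lambda>y. g t (x y))"
      using continuous_map_compose[OF x mult_spaceD(1)[OF gt]] by (simp add: o_def)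
    from F.continuous_map_ntopD(2)[OF this t]
    have l: "((\<lambda>y. nrm F (g t (x y) - g t (x t))) \<longlongrightarrow> 0) (nhdsin T t)" .
    have xi: "continuous_map T (ntop E) (\<lambda>t. x t i)" if "i \<in> I" for i
      using x that continuous_map_pow_iff[OF E.nonarch_group_axioms I] by blast
    have "((\<lambda>y. max (nrm (mult_space I E F) (g y - g t) * ?p y) (nrm F (g t (x y) - g t (x t))))
        \<longlongrightarrow> max (0 * ?p t) 0) (nhdsin T t)"
      by (intro tendsto_max tendsto_mult tendsto_prod l L.continuous_map_ntopD[OF g t] E.tendsto_nrm xi t)
    then show "((\<lambda>y. max (nrm (mult_space I E F) (g y - g t) * ?p y) (nrm F (g t (x y) - g t (x t))))
        \<longlongrightarrow> 0) (nhdsin T t)" by simp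
    fix y assume y: "y \<in> topspace T"
    note gy = L.continuous_map_ntopD(1)[OF g y] and xy = P.continuous_map_ntopD(1)[OF x y]
    have "nrm F (g y (x y) - g t (x t)) \<le> max (nrm F (g y (x y) - g t (x y))) (nrm F (g t (x y) - g t (x t)))"
      using gF gt gy xt xy by (intro F.nrm_ultrametric) auto
    also have "nrm F (g y (x y) - g t (x y)) \<le> nrm (mult_space I E F) (g y - g t) * ?p y"
      using nrm_apply_mult_le[OF assms(1,2) L.diff_mem[OF gy gt] I xy] by simp
    finally show "nrm F (g y (x y) - g t (x t))
        \<le> max (nrm (mult_space I E F) (g y - g t) * ?p y) (nrm F (g t (x y) - g t (x t)))"
      by (meson max.mono order_refl order_trans)
  qed
qed


section \<open>Series of increments along an approximation of the identity\<close>

lemma openin_less_preimage: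
  assumes "continuous_map Z euclideanreal g" shows "openin Z {z \<in> topspace Z. g z < c}"
  using openin_continuous_map_preimage[OF assms, of "{..<c}"] by simp

text \<open>
  On the compact square \<open>B \<times> B\<close> the norm of \<open>\<tau>\<close> is uniformly continuous, and it is \<open>0\<close> on the diagonal.
\<close>
lemma increments_uniformly_small:
  fixes B :: "'k::nonarch_valued_field set"
  assumes "nonarch_group X" and B: "compact B"
    and \<tau>: "continuous_map (prod_topology (top_of_set B) (top_of_set B)) (ntop X) (\<lambda>(s, t). \<tau> s t)"
    and diag: "\<And>s. s \<in> B \<Longrightarrow> \<tau> s s = 0"
    and \<sigma>: "\<And>n v. v \<in> B \<Longrightarrow> \<sigma> n v \<in> B"
    and conv: "\<And>\<delta>. \<delta> > 0 \<Longrightarrow> \<exists>N. \<forall>n\<ge>N. \<forall>v\<in>B. dist (\<sigma> n v) (\<sigma> (Suc n) v) < \<delta>"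
    and "\<epsilon> > (0::real)"
  shows "\<exists>N. \<forall>n\<ge>N. \<forall>v\<in>B. nrm X (\<tau> (\<sigma> n v) (\<sigma> (Suc n) v)) < \<epsilon>"
proof -
  interpret nonarch_group X by fact
  have "continuous_map (top_of_set (B \<times> B)) euclideanreal (\<lambda>p. nrm X (case p of (s, t) \<Rightarrow> \<tau> s t))"
    using continuous_map_nrm[OF \<tau>] by simp
  then have "uniformly_continuous_on (B \<times> B) (\<lambda>p. nrm X (case p of (s, t) \<Rightarrow> \<tau> s t))"
    using B by (intro compact_uniformly_continuous compact_Times) auto
  then obtain \<delta> where \<delta>: "\<delta> > 0"
    "\<And>p q. p \<in> B \<times> B \<Longrightarrow> q \<in> B \<times> B \<Longrightarrow> dist q p < \<delta>
      \<Longrightarrow> dist (nrm X (case q of (s, t) \<Rightarrow> \<tau> s t)) (nrm X (case p of (s, t) \<Rightarrow> \<tau> s t)) < \<epsilon>"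
    using \<open>\<epsilon> > 0\<close> unfolding uniformly_continuous_on_def by metis
  obtain N where N: "\<forall>n\<ge>N. \<forall>v\<in>B. dist (\<sigma> n v) (\<sigma> (Suc n) v) < \<delta>" using conv[OF \<delta>(1)] by auto
  show ?thesis
  proof (intro exI[of _ N] allI impI ballI)
    fix n v assume n: "N \<le> n" and v: "v \<in> B"
    have "dist (\<sigma> n v, \<sigma> (Suc n) v) (\<sigma> n v, \<sigma> n v) < \<delta>"
      using N n v by (simp add: dist_Pair_Pair dist_commute)
    from \<delta>(2)[OF _ _ this] show "nrm X (\<tau> (\<sigma> n v) (\<sigma> (Suc n) v)) < \<epsilon>"
      using \<sigma> v by (simp add: diag)
  qed
qed

text \<open>
  The analytic core. The terms tend to \<open>0\<close> uniformly in \<open>v\<close>, which gives convergence and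
  continuity of the sum in \<open>v\<close>. For the continuity in the parameter, the tube lemma gives a neighbourhood of \<open>w\<^sub>0\<close>
  on which \<open>\<tau>\<close> differs from its value at \<open>w\<^sub>0\<close> by less than \<open>\<epsilon>/2\<close> on all of \<open>B \<times> B\<close>, and \<open>nrm_nsums_le\<close>
  transfers this bound to the sums.
\<close>
lemma continuous_map_increment_series:
  fixes B :: "'k::nonarch_valued_field set"
    and \<tau> :: "'k \<Rightarrow> 'k \<Rightarrow> 'w \<Rightarrow> 'e::ab_group_add"
  assumes "nonarch_complete X" and B: "compact B" "B \<noteq> {}"
    and \<tau>: "continuous_map (prod_topology (prod_topology (top_of_set B) (top_of_set B)) W) (ntop X)
      (\<lambda>((s, t), w). \<tau> s t w)"
    and diag: "\<And>s w. s \<in> B \<Longrightarrow> w \<in> topspace W \<Longrightarrow> \<tau> s s w = 0"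
    and \<sigma>: "\<And>n. continuous_map (top_of_set B) (top_of_set B) (\<sigma> n)"
    and conv: "\<And>\<delta>. \<delta> > 0 \<Longrightarrow> \<exists>N. \<forall>n\<ge>N. \<forall>v\<in>B. dist (\<sigma> n v) (\<sigma> (Suc n) v) < \<delta>"
  shows "w \<in> topspace W \<Longrightarrow> v \<in> B \<Longrightarrow> \<exists>s. nsums X (\<lambda>n. \<tau> (\<sigma> n v) (\<sigma> (Suc n) v) w) s"
    and "continuous_map W (ntop (C0_space B X))
      (\<lambda>w v. if v \<in> B then nsuminf X (\<lambda>n. \<tau> (\<sigma> n v) (\<sigma> (Suc n) v) w) else 0)"
proof -
  interpret nonarch_complete X by fact
  interpret C: nonarch_group "C0_space B X" using nonarch_group_C0 nonarch_group_axioms B by blast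
  have \<sigma>B: "\<sigma> n v \<in> B" if "v \<in> B" for n v
    using continuous_map_image_subset_topspace[OF \<sigma>[of n]] that by auto
  define f where "f w v n = \<tau> (\<sigma> n v) (\<sigma> (Suc n) v) w" for w v n
  define S where "S w v = (if v \<in> B then nsuminf X (f w v) else 0)" for w v
  have \<tau>_fix: "continuous_map (prod_topology (top_of_set B) (top_of_set B)) (ntop X) (\<lambda>(s, t). \<tau> s t w)"
    if "w \<in> topspace W" for w
  proof -
    have "continuous_map (prod_topology (top_of_set B) (top_of_set B))
      (prod_topology (prod_topology (top_of_set B) (top_of_set B)) W) (\<lambda>p. (p, w))"
      using that by (simp add: continuous_map_pairwise o_def flip: id_def)
    from continuous_map_compose[OF this \<tau>] show ?thesis by (simp add: o_def case_prod_unfold)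
  qed
  have \<tau>_mem: "\<tau> s t w \<in> vecs X" if "s \<in> B" "t \<in> B" "w \<in> topspace W" for s t w
    using continuous_map_ntopD(1)[OF \<tau>, of "((s, t), w)"] that by simp
  have f_mem: "f w v n \<in> vecs X" if "v \<in> B" "w \<in> topspace W" for w v n
    using that by (simp add: f_def \<tau>_mem \<sigma>B)
  have small: "\<exists>N. \<forall>n\<ge>N. \<forall>v\<in>B. nrm X (f w v n) < \<epsilon>" if "w \<in> topspace W" "\<epsilon> > 0" for w \<epsilon>
    unfolding f_def
    using increments_uniformly_small[OF nonarch_group_axioms B(1) \<tau>_fix[OF that(1)] diag[OF _ that(1)] \<sigma>B conv that(2)] .
  have sums: "nsums X (f w v) (nsuminf X (f w v))" if v: "v \<in> B" and w: "w \<in> topspace W" for w v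
  proof -
    have "(\<lambda>n. nrm X (f w v n)) \<longlonglongrightarrow> 0"
    proof (rule LIMSEQ_I)
      fix r :: real assume "r > 0"
      then obtain N where "\<forall>n\<ge>N. nrm X (f w v n) < r" using small[OF w] v by blast
      then show "\<exists>N. \<forall>n\<ge>N. norm (nrm X (f w v n) - 0) < r"
        using nrm_nonneg[OF f_mem[OF v w]] by auto
    qed
    then obtain s where "nsums X (f w v) s" using nsums_ex f_mem[OF v w] by blast
    then show ?thesis using nsuminf_eq by simp
  qed
  show "\<exists>s. nsums X (\<lambda>n. \<tau> (\<sigma> n v) (\<sigma> (Suc n) v) w) s" if "w \<in> topspace W" "v \<in> B" for w v
    using sums[OF that(2,1)] unfolding f_def by blast
  have S_mem: "S w v \<in> vecs X" if "w \<in> topspace W" for w v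
    using nsums_mem[OF sums[OF _ that]] by (simp add: S_def)
  have term_cont: "continuous_map (top_of_set B) (ntop X) (\<lambda>v. f w v n)" if "w \<in> topspace W" for w n
  proof -
    have "continuous_map (top_of_set B) (prod_topology (top_of_set B) (top_of_set B)) (\<lambda>v. (\<sigma> n v, \<sigma> (Suc n) v))"
      using \<sigma> by (simp only: continuous_map_paired)
    from continuous_map_compose[OF this \<tau>_fix[OF that]] show ?thesis by (simp add: o_def f_def)
  qed
  have S_C0: "S w \<in> vecs (C0_space B X)" if w: "w \<in> topspace W" for w
  proof -
    have "continuous_map (top_of_set B) mtopology (S w)"
    proof (rule continuous_map_uniform_limit_alt[where F = sequentially and f = "\<lambda>N v. \<Sum>n<N. f w v n"])
      show "eventually (\<lambda>N. continuous_map (top_of_set B) mtopology (\<lambda>v. \<Sum>n<N. f w v n)) sequentially"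
        unfolding mtopology_eq using term_cont[OF w] by (intro always_eventually allI continuous_map_sum)
      show "S w \<in> topspace (top_of_set B) \<rightarrow> vecs X" using S_mem[OF w] by simp
      fix \<epsilon> :: real assume e: "0 < \<epsilon>"
      then obtain N where N: "\<And>n v. n \<ge> N \<Longrightarrow> v \<in> B \<Longrightarrow> nrm X (f w v n) < \<epsilon> / 2"
        using small[OF w, of "\<epsilon> / 2"] by auto
      have "ndist X (\<Sum>n<M. f w v n) (S w v) < \<epsilon>" if "M \<ge> N" "v \<in> B" for M v
      proof -
        have m: "(\<Sum>n<M. f w v n) \<in> vecs X" using f_mem that w by (intro sum_mem) auto
        have "nrm X (S w v - (\<Sum>n<M. f w v n)) \<le> \<epsilon> / 2"
        proof (rule nrm_nsums_le)
          show "nsums X (\<lambda>n. f w v (n + M)) (S w v - (\<Sum>n<M. f w v n))"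
            using nsums_offset[OF f_mem sums] that w by (simp add: S_def)
        qed (use N that f_mem w in \<open>auto intro: less_imp_le\<close>)
        then show ?thesis using e m S_mem[OF w] nrm_minus_commute[OF m S_mem[OF w, of v]] by (simp add: ndist_def)
      qed
      then show "eventually (\<lambda>M. \<forall>v\<in>topspace (top_of_set B). ndist X (\<Sum>n<M. f w v n) (S w v) < \<epsilon>) sequentially"
        unfolding eventually_sequentially by auto
    qed simp
    then show ?thesis by (simp add: vecs_C0 mtopology_eq) (simp add: S_def)
  qed
  have "continuous_map W (ntop (C0_space B X)) S"
    unfolding C.continuous_map_ntop_iff
  proof (intro ballI conjI S_C0 tendstoI)
    fix w0 and e :: real assume w0: "w0 \<in> topspace W" and e: "0 < e"
    let ?Z = "prod_topology (prod_topology (top_of_set B) (top_of_set B)) W"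
    let ?d = "\<lambda>z. case z of ((s, t), w) \<Rightarrow> \<tau> s t w - \<tau> s t w0"
    have "continuous_map ?Z (ntop X) (\<lambda>z. case fst z of (s, t) \<Rightarrow> \<tau> s t w0)"
      using continuous_map_compose[OF continuous_map_fst \<tau>_fix[OF w0]] by (simp add: o_def)
    from continuous_map_diff[OF \<tau> this]
    have "continuous_map ?Z (ntop X) ?d" by (simp add: case_prod_unfold)
    from openin_less_preimage[OF continuous_map_nrm[OF this], of "e / 2"]
    have op: "openin ?Z {z \<in> topspace ?Z. nrm X (?d z) < e / 2}" .
    have "compactin (prod_topology (top_of_set B) (top_of_set B)) (B \<times> B)"
      using compact_Times[OF B(1) B(1)] by (simp add: compactin_subtopology)
    then have "\<exists>Q U. openin (prod_topology (top_of_set B) (top_of_set B)) Q \<and> openin W U \<and> B \<times> B \<subseteq> Q \<and> w0 \<in> U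
        \<and> Q \<times> U \<subseteq> {z \<in> topspace ?Z. nrm X (?d z) < e / 2}"
    proof (rule tube_lemma_left[OF op _ w0])
      show "(B \<times> B) \<times> {w0} \<subseteq> {z \<in> topspace ?Z. nrm X (?d z) < e / 2}"
        using w0 e by auto
    qed
    then obtain Q U where U: "openin W U" "w0 \<in> U" "B \<times> B \<subseteq> Q"
        and QU: "Q \<times> U \<subseteq> {z \<in> topspace ?Z. nrm X (?d z) < e / 2}"
      by blast
    have "nrm (C0_space B X) (S w - S w0) < e" if w: "w \<in> U" for w
    proof -
      have wW: "w \<in> topspace W" using openin_subset[OF U(1)] w by blast
      have "nrm X ((S w - S w0) v) \<le> e / 2" if v: "v \<in> B" for v
      proof (rule nrm_nsums_le)
        show "nsums X (\<lambda>n. f w v n - f w0 v n) ((S w - S w0) v)"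
          using nsums_diff[OF f_mem[OF v wW] sums[OF v wW] f_mem[OF v w0] sums[OF v w0]] v by (simp add: S_def)
        show "f w v n - f w0 v n \<in> vecs X" for n using v wW w0 by (simp add: f_mem diff_mem)
        have "((\<sigma> n v, \<sigma> (Suc n) v), w) \<in> Q \<times> U" for n using U(3) \<sigma>B[OF v] w by blast
        then have "((\<sigma> n v, \<sigma> (Suc n) v), w) \<in> {z \<in> topspace ?Z. nrm X (?d z) < e / 2}" for n
          using QU by blast
        then show "nrm X (f w v n - f w0 v n) \<le> e / 2" for n
          unfolding f_def by (simp add: less_imp_le)
      qed
      then have "nrm (C0_space B X) (S w - S w0) \<le> e / 2" by (rule nrm_C0_le[OF B(2)])
      then show ?thesis using e by simp
    qed
    then have "dist (nrm (C0_space B X) (S w - S w0)) 0 < e" if "w \<in> U" for w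
      using that openin_subset[OF U(1)] C.nrm_nonneg[OF C.diff_mem[OF S_C0 S_C0[OF w0]]] by force
    then show "eventually (\<lambda>w. dist (nrm (C0_space B X) (S w - S w0)) 0 < e) (nhdsin W w0)"
      using U w0 by (auto simp: eventually_nhdsin)
  qed
  then show "continuous_map W (ntop (C0_space B X))
      (\<lambda>w v. if v \<in> B then nsuminf X (\<lambda>n. \<tau> (\<sigma> n v) (\<sigma> (Suc n) v) w) else 0)"
    unfolding S_def f_def .
qed

text \<open>
  Each \<open>\<sigma> n\<close> is locally constant; for \<open>n = 0\<close> it is constant.
\<close>
lemma approx_identity_continuous:
  assumes "approx_identity B t\<^sub>0 \<sigma>" shows "continuous_map (top_of_set B) (top_of_set B) (\<sigma> n)"
proof -
  obtain \<rho> where \<rho>: "0 < \<rho>"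
      "\<And>n x y. n \<ge> 1 \<Longrightarrow> x \<in> B \<Longrightarrow> y \<in> B \<Longrightarrow> vabs (x - y) < \<rho> ^ n \<Longrightarrow> \<sigma> n x = \<sigma> n y"
    using assms unfolding approx_identity_def by blast
  have "\<exists>d>0. \<forall>x\<in>B. \<forall>y\<in>B. dist y x < d \<longrightarrow> \<sigma> n y = \<sigma> n x"
  proof (cases "n = 0")
    case True
    then show ?thesis using assms by (intro exI[of _ 1]) (auto simp: approx_identity_def)
  next
    case False
    show ?thesis
    proof (intro exI[of _ "\<rho> ^ n"] conjI ballI impI)
      fix x y assume "x \<in> B" "y \<in> B" "dist y x < \<rho> ^ n"
      then show "\<sigma> n y = \<sigma> n x" using False by (intro \<rho>(2)) (auto simp: dist_vabs)
    qed (use \<rho>(1) in simp)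
  qed
  then obtain d where d: "d > 0" "\<And>x y. x \<in> B \<Longrightarrow> y \<in> B \<Longrightarrow> dist y x < d \<Longrightarrow> \<sigma> n y = \<sigma> n x" by blast
  have "continuous_on B (\<sigma> n)"
    unfolding continuous_on_iff
  proof (intro ballI allI impI exI[of _ d] conjI d(1))
    fix x y and e :: real assume "x \<in> B" "y \<in> B" "dist y x < d" "0 < e"
    then have "\<sigma> n y = \<sigma> n x" by (intro d(2))
    then show "dist (\<sigma> n y) (\<sigma> n x) < e" using \<open>0 < e\<close> by simp
  qed
  moreover have "\<sigma> n ` B \<subseteq> B" using assms unfolding approx_identity_def by blast
  ultimately show ?thesis by (auto simp: image_subset_iff)
qed

lemma approx_identity_increments:
  fixes \<sigma> :: "nat \<Rightarrow> 'k::nonarch_valued_field \<Rightarrow> 'k"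
  assumes "approx_identity B t\<^sub>0 \<sigma>" and "\<delta> > (0::real)"
  shows "\<exists>N. \<forall>n\<ge>N. \<forall>v\<in>B. dist (\<sigma> n v) (\<sigma> (Suc n) v) < \<delta>"
proof -
  obtain \<rho> where \<rho>: "0 < \<rho>" "\<rho> < 1" "\<And>n x. n \<ge> 1 \<Longrightarrow> x \<in> B \<Longrightarrow> vabs (\<sigma> n x - x) < \<rho> ^ n"
    using assms(1) unfolding approx_identity_def by blast
  obtain N where N: "\<rho> ^ N < \<delta>" using real_arch_pow_inv[OF assms(2) \<rho>(2)] by blast
  have close: "dist (\<sigma> n v) v < \<delta>" if "n \<ge> Suc N" "v \<in> B" for n v
  proof -
    have "\<rho> ^ n \<le> \<rho> ^ N" using that \<rho>(1,2) by (intro power_decreasing) auto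
    then show ?thesis using \<rho>(3)[of n v] that N by (simp add: dist_vabs)
  qed
  show ?thesis
  proof (intro exI[of _ "Suc N"] allI impI ballI)
    fix n v assume "Suc N \<le> n" "v \<in> B"
    then show "dist (\<sigma> n v) (\<sigma> (Suc n) v) < \<delta>"
      using dist_ultrametric[of "\<sigma> n v" "\<sigma> (Suc n) v" v] close[of n v] close[of "Suc n" v]
      by (simp add: dist_commute)
  qed
qed


section \<open>Difference quotients of multilinear operators\<close>

lemma continuous_map_dq_top:
  "continuous_map (dq_top T E n) T fst"
  "continuous_map (dq_top T E n) (ntop E) (\<lambda>w. fst (snd w))"
  "continuous_map (dq_top T E n) (ntop (pow_space {1..n} E)) (\<lambda>w. fst (snd (snd w)))"
  "continuous_map (dq_top T E n) (ntop (pow_space {1..n} scalars)) (\<lambda>w. snd (snd (snd w)))"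
  unfolding dq_top_def
  by (rule continuous_map_fst continuous_map_fst_of[unfolded o_def, OF continuous_map_snd]
      continuous_map_fst_of[unfolded o_def, OF continuous_map_snd_of[unfolded o_def, OF continuous_map_snd]]
      continuous_map_snd_of[unfolded o_def, OF continuous_map_snd_of[unfolded o_def, OF continuous_map_snd]])+

lemma continuous_map_into_dq_top:
  "continuous_map Z T a \<Longrightarrow> continuous_map Z (ntop E) b \<Longrightarrow> continuous_map Z (ntop (pow_space {1..n} E)) c
    \<Longrightarrow> continuous_map Z (ntop (pow_space {1..n} scalars)) d
    \<Longrightarrow> continuous_map Z (dq_top T E n) (\<lambda>z. (a z, b z, c z, d z))"
  unfolding dq_top_def by (simp add: continuous_map_pairwise o_def)

lemma topspace_dq_top:
  assumes "nonarch_group E"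
  shows "topspace (dq_top T E n)
    = topspace T \<times> vecs E \<times> vecs (pow_space {1..n} E) \<times> vecs (pow_space {1..n} scalars)"
proof -
  interpret E: nonarch_group E by fact
  interpret P: nonarch_group "pow_space {1..n} E" using assms by (intro nonarch_group_pow) auto
  interpret Z: nonarch_group "pow_space {1..n} (scalars :: ('a, 'a) nspace)"
    using nonarch_space_scalars by (intro nonarch_group_pow) (auto simp: nonarch_space_def)
  show ?thesis by (simp add: dq_top_def del: One_nat_def)
qed

lemma vecs_pow_truncate: "h \<in> vecs (pow_space {1..Suc n} E) \<Longrightarrow> h(Suc n := 0) \<in> vecs (pow_space {1..n} E)"
  by (auto simp: vecs_pow)

lemma continuous_map_truncate:
  assumes "nonarch_group E"
  shows "continuous_map (ntop (pow_space {1..Suc n} E)) (ntop (pow_space {1..n} E)) (\<lambda>h. h(Suc n := 0))"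
proof -
  interpret S: nonarch_group "pow_space {1..Suc n} E" using assms by (intro nonarch_group_pow) auto
  have "continuous_map (ntop (pow_space {1..Suc n} E)) (ntop E) (\<lambda>h. h i)" if "i \<in> {1..n}" for i
    using continuous_map_pow_iff[OF assms, of "{1..Suc n}" "ntop (pow_space {1..Suc n} E)" "\<lambda>h. h"] that
    by (auto simp flip: id_def)
  then show ?thesis
    by (auto simp: continuous_map_pow_iff[OF assms] vecs_pow simp del: One_nat_def)
qed

lemma continuous_map_dq_truncate:
  assumes "nonarch_group E"
  shows "continuous_map (dq_top T E (Suc n)) (dq_top T E n) (\<lambda>(v, x, h, \<zeta>). (v, x, h(Suc n := 0), \<zeta>(Suc n := 0)))"
  unfolding case_prod_unfold
  using continuous_map_compose[OF continuous_map_dq_top(3) continuous_map_truncate[OF assms]]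
    continuous_map_compose[OF continuous_map_dq_top(4) continuous_map_truncate]
    nonarch_space_scalars[unfolded nonarch_space_def]
  by (intro continuous_map_into_dq_top continuous_map_dq_top) (auto simp: o_def)

lemma diff_quot_cong:
  assumes "\<And>v x. v \<in> topspace T \<Longrightarrow> x \<in> vecs E \<Longrightarrow> \<phi> v x = \<psi> v x"
  shows "diff_quot T E F \<phi> n \<Phi> \<longleftrightarrow> diff_quot T E F \<psi> n \<Phi>"
  by (induction n arbitrary: \<Phi>) (simp_all add: assms)

lemma smooth_cong:
  assumes "\<And>x. x \<in> vecs E \<Longrightarrow> \<phi> x = \<psi> x"
  shows "smooth m E F \<phi> \<longleftrightarrow> smooth m E F \<psi>"
  unfolding smooth_def smooth_param_def using diff_quot_cong[of _ E "\<lambda>_. \<phi>" "\<lambda>_. \<psi>"] assms by metis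

text \<open>
  The map \<open>a\<close> turns the arguments of the \<open>n\<close>-th difference quotient into a tuple of arguments for a
  multilinear operator. Its entries with index in \<open>S\<close> follow \<open>x\<close> by translation; the others are independent of \<open>x\<close>.
\<close>
definition affine_slots where
  "affine_slots T I E n S a \<longleftrightarrow>
     continuous_map (dq_top T (pow_space I E) n) (ntop (pow_space I E)) a \<and>
     (\<forall>v\<in>topspace T. \<forall>x\<in>vecs (pow_space I E). \<forall>y\<in>vecs (pow_space I E).
        \<forall>h\<in>vecs (pow_space {1..n} (pow_space I E)). \<forall>\<zeta>\<in>vecs (pow_space {1..n} scalars). \<forall>c. \<forall>i\<in>I.
          a (v, x + scl (pow_space I E) c y, h, \<zeta>) i
            = a (v, x, h, \<zeta>) i + (if i \<in> S then scl E c (y i) else 0))"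

text \<open>
  Sums of values of \<open>M\<close> at such tuples. They contain \<open>M\<close> itself, they are continuous, and they are closed
  under difference quotients, so they contain the extended difference quotients of \<open>M\<close> of every order.
\<close>
inductive multilinear_comb for T I E M n where
  zero: "multilinear_comb T I E M n (\<lambda>_. 0)"
| add: "multilinear_comb T I E M n \<Phi> \<Longrightarrow> affine_slots T I E n S a
    \<Longrightarrow> multilinear_comb T I E M n (\<lambda>w. \<Phi> w + M (a w))"

lemma multilinear_comb_add:
  fixes \<Phi> :: "_ \<Rightarrow> 'f::ab_group_add"
  assumes "multilinear_comb T I E M n \<Phi>" and "multilinear_comb T I E M n \<Psi>"
  shows "multilinear_comb T I E M n (\<lambda>w. \<Phi> w + \<Psi> w)"
  using assms(2)
proof induction
  case zero
  then show ?case using assms(1) by simp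
next
  case (add \<Psi> S a)
  then show ?case using multilinear_comb.add[OF add(3,2)] by (simp add: add.assoc)
qed

lemma multilinear_comb_sum:
  assumes "finite N" and "\<And>i. i \<in> N \<Longrightarrow> affine_slots T I E n (S i) (a i)"
  shows "multilinear_comb T I E M n (\<lambda>w. \<Sum>i\<in>N. M (a i w) :: 'f::ab_group_add)"
  using assms
proof (induction N)
  case (insert i N)
  then show ?case
    using multilinear_comb.add[of T I E M n "\<lambda>w. \<Sum>i\<in>N. M (a i w)" "S i" "a i"] by (simp add: add.commute)
qed (auto intro: multilinear_comb.zero)

lemma multilinear_comb_continuous:
  assumes "nonarch_group F" and M: "continuous_map (ntop (pow_space I E)) (ntop F) M"
    and "multilinear_comb T I E M n \<Phi>"
  shows "continuous_map (dq_top T (pow_space I E) n) (ntop F) \<Phi>"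
  using assms(3)
proof induction
  interpret F: nonarch_group F by fact
  {
    case zero
    then show ?case by (rule F.continuous_map_zero)
  next
    case (add \<Phi> S a)
    have "continuous_map (dq_top T (pow_space I E) n) (ntop F) (\<lambda>w. M (a w))"
      using continuous_map_compose[OF _ M] add(2) unfolding affine_slots_def o_def by blast
    then show ?case using add by (intro F.continuous_map_add)
  }
qed

text \<open>
  Replacing the arguments \<open>a\<^sub>i\<close> by \<open>a\<^sub>i + c b\<^sub>i\<close> one after the other, in the order of the indices,
  writes the increment as a telescoping sum; each of its summands is \<open>c\<close> times a value of \<open>M\<close>.
\<close>
lemma multilinear_telescope:
  assumes "nonarch_space E" "nonarch_space F" and I: "finite I" and M: "M \<in> vecs (mult_space I E F)"
    and a: "a \<in> vecs (pow_space I E)" and b: "b \<in> vecs (pow_space I E)"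
  shows "M (a + scl (pow_space I E) c b) - M a
    = scl F c (\<Sum>N\<in>I. M (\<lambda>i. if i < N then a i + scl E c (b i) else if i = N then b i else a i))"
proof -
  interpret E: nonarch_space E by fact
  interpret F: nonarch_space F by fact
  interpret P: nonarch_space "pow_space I E" using nonarch_space_pow assms I by blast
  let ?b = "\<lambda>N i. if i < N then a i + scl E c (b i) else if i = N then b i else a i"
  define x where "x N i = (if i < N then a i + scl E c (b i) else a i)" for N i
  have am: "a i \<in> vecs E" and bm: "b i \<in> vecs E" and xm: "x N i \<in> vecs E" for i N
    using E.vecs_pow_mem[OF a] E.vecs_pow_mem[OF b] by (auto simp: x_def E.add_mem E.scl_mem)
  have a0: "a i = 0" "b i = 0" if "i \<notin> I" for i using a b that by (auto simp: vecs_pow)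
  have x: "x N \<in> vecs (pow_space I E)" for N using xm a0 by (auto simp: vecs_pow x_def)
  have MF: "M y \<in> vecs F" if "y \<in> vecs (pow_space I E)" for y
    using F.continuous_map_ntopD(1)[OF mult_spaceD(1)[OF M]] that by simp
  have bF: "M (?b N) \<in> vecs F" if "N \<in> I" for N
    using am bm a0 that by (intro MF) (auto simp: vecs_pow E.add_mem E.scl_mem)
  have step: "M (x (Suc N)) - M (x N) = (if N \<in> I then scl F c (M (?b N)) else 0)" for N
  proof (cases "N \<in> I")
    case True
    have "x (Suc N) = (x N)(N := a N + scl E c (b N))" "(x N)(N := a N) = x N" "(x N)(N := b N) = ?b N"
      by (auto simp: x_def fun_eq_iff)
    then show ?thesis
      using mult_spaceD(3)[OF M x True am E.scl_mem[OF bm], of N N c N] mult_spaceD(4)[OF M x True bm, of N c N] True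
      by simp
  next
    case False
    then have "x (Suc N) = x N" using a0[OF False] by (auto simp: x_def fun_eq_iff less_Suc_eq)
    then show ?thesis using False by simp
  qed
  obtain K where K: "\<And>i. i \<in> I \<Longrightarrow> i < K" using I finite_nat_set_iff_bounded by auto
  have "x K = a + scl (pow_space I E) c b" using K a0 by (fastforce simp: x_def)
  moreover have "x 0 = a" by (auto simp: x_def)
  ultimately have "M (a + scl (pow_space I E) c b) - M a = (\<Sum>N<K. M (x (Suc N)) - M (x N))"
    using sum_lessThan_telescope[of "\<lambda>N. M (x N)" K] by simp
  also have "\<dots> = (\<Sum>N\<in>I. scl F c (M (?b N)))"
    unfolding step using K by (subst sum.inter_restrict[symmetric]) (auto intro!: sum.cong)
  also have "\<dots> = scl F c (\<Sum>N\<in>I. M (?b N))"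
    using bF by (subst F.scl_sum_right) auto
  finally show ?thesis .
qed

text \<open>
  By \<open>multilinear_telescope\<close> a term \<open>M (a w)\<close> contributes one term for every slot \<open>N\<close>. In it the
  slots before \<open>N\<close> are already translated, slot \<open>N\<close> holds the increment, and the later slots
  are unchanged. So slot \<open>N\<close> no longer depends on \<open>x\<close>, while the others
  depend on \<open>x\<close> as before. Stating the equation with the scalar on the left makes it meaningful at
  \<open>0\<close>, too, and avoids the division.
\<close>
lemma multilinear_comb_step:
  fixes T :: "'v topology" and E :: "('k::nonarch_valued_field, 'e::ab_group_add) nspace"
    and F :: "('k, 'f::ab_group_add) nspace"
  assumes "nonarch_space E" "nonarch_space F" and I: "finite I" and M: "M \<in> vecs (mult_space I E F)"
    and "multilinear_comb T I E M n \<Psi>"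
  shows "\<exists>\<Phi>. multilinear_comb T I E M (Suc n) \<Phi> \<and>
    (\<forall>v\<in>topspace T. \<forall>x\<in>vecs (pow_space I E). \<forall>h\<in>vecs (pow_space {1..Suc n} (pow_space I E)).
      \<forall>\<zeta>\<in>vecs (pow_space {1..Suc n} scalars).
        scl F (\<zeta> (Suc n)) (\<Phi> (v, x, h, \<zeta>)) =
          \<Psi> (v, x + scl (pow_space I E) (\<zeta> (Suc n)) (h (Suc n)), h(Suc n := 0), \<zeta>(Suc n := 0))
          - \<Psi> (v, x, h(Suc n := 0), \<zeta>(Suc n := 0)))"
  using assms(5)
proof induction
  interpret E: nonarch_space E by fact
  interpret F: nonarch_space F by fact
  let ?P = "pow_space I E"
  interpret P: nonarch_space ?P using nonarch_space_pow assms I by blast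
  {
    case zero
    show ?case by (intro exI[of _ "\<lambda>_. 0"]) (auto intro: multilinear_comb.zero)
  next
    case (add \<Psi> S a)
    obtain \<Phi> where \<Phi>: "multilinear_comb T I E M (Suc n) \<Phi>"
      and eq: "\<And>v x h \<zeta>. v \<in> topspace T \<Longrightarrow> x \<in> vecs ?P \<Longrightarrow> h \<in> vecs (pow_space {1..Suc n} ?P)
        \<Longrightarrow> \<zeta> \<in> vecs (pow_space {1..Suc n} scalars) \<Longrightarrow>
        scl F (\<zeta> (Suc n)) (\<Phi> (v, x, h, \<zeta>)) =
          \<Psi> (v, x + scl ?P (\<zeta> (Suc n)) (h (Suc n)), h(Suc n := 0), \<zeta>(Suc n := 0))
          - \<Psi> (v, x, h(Suc n := 0), \<zeta>(Suc n := 0))"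
      using add(3) by blast
    let ?tr = "\<lambda>(v, x, h, \<zeta>). (v, x, h(Suc n := 0), \<zeta>(Suc n := 0))"
    define \<beta> where "\<beta> w i = (if i \<in> S then fst (snd (snd w)) (Suc n) i else 0)"
      for w :: "'v \<times> (nat \<Rightarrow> 'e) \<times> (nat \<Rightarrow> nat \<Rightarrow> 'e) \<times> (nat \<Rightarrow> 'k)" and i
    define b where "b N w i = (if i < N then a (?tr w) i + scl E (snd (snd (snd w)) (Suc n)) (\<beta> w i)
        else if i = N then \<beta> w i else a (?tr w) i)" for N w i
    let ?D = "dq_top T ?P (Suc n)"
    have a_cont: "continuous_map (dq_top T ?P n) (ntop ?P) a"
      and a_aff: "\<And>v x y h \<zeta> c i. v \<in> topspace T \<Longrightarrow> x \<in> vecs ?P \<Longrightarrow> y \<in> vecs ?P \<Longrightarrow> h \<in> vecs (pow_space {1..n} ?P)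
        \<Longrightarrow> \<zeta> \<in> vecs (pow_space {1..n} scalars) \<Longrightarrow> i \<in> I
        \<Longrightarrow> a (v, x + scl ?P c y, h, \<zeta>) i = a (v, x, h, \<zeta>) i + (if i \<in> S then scl E c (y i) else 0)"
      using add(2) unfolding affine_slots_def by blast+
    have top: "topspace ?D = topspace T \<times> vecs ?P \<times> vecs (pow_space {1..Suc n} ?P) \<times> vecs (pow_space {1..Suc n} scalars)"
      using topspace_dq_top P.nonarch_group_axioms by blast
    have tr_cont: "continuous_map ?D (dq_top T ?P n) ?tr"
      using continuous_map_dq_truncate[OF P.nonarch_group_axioms] .
    have atr: "continuous_map ?D (ntop ?P) (\<lambda>w. a (?tr w))"
      using continuous_map_compose[OF tr_cont a_cont] by (simp only: o_def)
    have h_cont: "continuous_map ?D (ntop ?P) (\<lambda>w. fst (snd (snd w)) (Suc n))"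
      using continuous_map_dq_top(3)[of T ?P "Suc n"]
      unfolding continuous_map_pow_iff[OF P.nonarch_group_axioms finite_atLeastAtMost]
      by auto
    have \<zeta>_cont: "continuous_map ?D (ntop scalars) (\<lambda>w. snd (snd (snd w)) (Suc n))"
      using continuous_map_dq_top(4)[of T ?P "Suc n"]
      unfolding continuous_map_pow_iff[OF nonarch_space.axioms(1)[OF nonarch_space_scalars] finite_atLeastAtMost]
      by auto
    have \<beta>_cont: "continuous_map ?D (ntop ?P) \<beta>"
      using h_cont unfolding continuous_map_pow_iff[OF E.nonarch_group_axioms I] \<beta>_def
      by (auto simp: E.continuous_map_zero)
    have b_cont: "continuous_map ?D (ntop ?P) (b N)" for N
      unfolding continuous_map_pow_iff[OF E.nonarch_group_axioms I]
    proof (intro conjI ballI allI impI)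
      fix i assume i: "i \<in> I"
      have c: "continuous_map ?D (ntop E) (\<lambda>w. a (?tr w) i)" "continuous_map ?D (ntop E) (\<lambda>w. \<beta> w i)"
        using atr \<beta>_cont i unfolding continuous_map_pow_iff[OF E.nonarch_group_axioms I] by blast+
      consider "i < N" | "i = N" | "i > N" by linarith
      then show "continuous_map ?D (ntop E) (\<lambda>w. b N w i)"
        unfolding b_def using E.continuous_map_add[OF c(1) E.continuous_map_scl[OF \<zeta>_cont c(2)]] c by cases simp_all
    next
      fix w i assume "w \<in> topspace ?D" "i \<notin> I"
      then have "a (?tr w) i = 0" "\<beta> w i = 0"
        using atr \<beta>_cont unfolding continuous_map_pow_iff[OF E.nonarch_group_axioms I] by blast+
      then show "b N w i = 0" by (auto simp: b_def)
    qed
    have b_aff: "affine_slots T I E (Suc n) (S - {N}) (b N)" for N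
      unfolding affine_slots_def
    proof (intro conjI b_cont ballI allI)
      fix v x y h \<zeta> c i
      assume "v \<in> topspace T" "x \<in> vecs ?P" "y \<in> vecs ?P" "i \<in> I"
        "h \<in> vecs (pow_space {1..Suc n} ?P)" "\<zeta> \<in> vecs (pow_space {1..Suc n} (scalars :: ('k, 'k) nspace))"
      then have "a (?tr (v, x + scl ?P c y, h, \<zeta>)) i = a (?tr (v, x, h, \<zeta>)) i + (if i \<in> S then scl E c (y i) else 0)"
        by (simp only: prod.case) (intro a_aff vecs_pow_truncate)
      then show "b N (v, x + scl ?P c y, h, \<zeta>) i
          = b N (v, x, h, \<zeta>) i + (if i \<in> S - {N} then scl E c (y i) else 0)"
        unfolding b_def \<beta>_def by (auto simp: add_ac)
    qed
    define \<Phi>' where "\<Phi>' w = (\<Sum>N\<in>I. M (b N w))" for w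
    have "multilinear_comb T I E M (Suc n) \<Phi>'"
      unfolding \<Phi>'_def using multilinear_comb_sum[OF I b_aff] .
    with \<Phi> have comb: "multilinear_comb T I E M (Suc n) (\<lambda>w. \<Phi> w + \<Phi>' w)"
      by (rule multilinear_comb_add)
    have eq': "scl F (\<zeta> (Suc n)) (\<Phi>' (v, x, h, \<zeta>)) =
          M (a (v, x + scl ?P (\<zeta> (Suc n)) (h (Suc n)), h(Suc n := 0), \<zeta>(Suc n := 0)))
          - M (a (v, x, h(Suc n := 0), \<zeta>(Suc n := 0)))"
      if w: "v \<in> topspace T" "x \<in> vecs ?P" "h \<in> vecs (pow_space {1..Suc n} ?P)" "\<zeta> \<in> vecs (pow_space {1..Suc n} scalars)"
      for v x h \<zeta>
    proof -
      let ?w = "(v, x, h, \<zeta>)"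
      have wD: "?w \<in> topspace ?D" using w top by simp
      have m: "a (?tr ?w) \<in> vecs ?P" "\<beta> ?w \<in> vecs ?P"
        using P.continuous_map_ntopD(1)[OF atr wD] P.continuous_map_ntopD(1)[OF \<beta>_cont wD] by auto
      have hS: "h (Suc n) \<in> vecs ?P" using P.vecs_pow_mem[OF w(3)] .
      have wD': "(v, x + scl ?P (\<zeta> (Suc n)) (h (Suc n)), h, \<zeta>) \<in> topspace ?D"
        using w top P.add_mem P.scl_mem hS by simp
      have "a (?tr (v, x + scl ?P (\<zeta> (Suc n)) (h (Suc n)), h, \<zeta>)) i
          = (a (?tr ?w) + scl ?P (\<zeta> (Suc n)) (\<beta> ?w)) i" for i
      proof (cases "i \<in> I")
        case True
        then show ?thesis
          using a_aff[OF w(1,2) hS vecs_pow_truncate[OF w(3)] vecs_pow_truncate[OF w(4)]] by (simp add: \<beta>_def)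
      next
        case False
        then show ?thesis
          using P.continuous_map_ntopD(1)[OF atr wD'] m by (simp add: vecs_pow)
      qed
      then have "a (v, x + scl ?P (\<zeta> (Suc n)) (h (Suc n)), h(Suc n := 0), \<zeta>(Suc n := 0))
          = a (?tr ?w) + scl ?P (\<zeta> (Suc n)) (\<beta> ?w)" by auto
      moreover have "b N ?w = (\<lambda>i. if i < N then a (?tr ?w) i + scl E (\<zeta> (Suc n)) (\<beta> ?w i)
          else if i = N then \<beta> ?w i else a (?tr ?w) i)" for N
        by (rule ext) (simp add: b_def)
      ultimately show ?thesis
        using multilinear_telescope[OF assms(1,2) I M m, of "\<zeta> (Suc n)"] by (simp add: \<Phi>'_def)
    qed
    have MF: "M y \<in> vecs F" if "y \<in> vecs ?P" for y
      using F.continuous_map_ntopD(1)[OF mult_spaceD(1)[OF M]] that by simp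
    have \<Phi>F: "\<Phi> w \<in> vecs F" "\<Phi>' w \<in> vecs F" if "w \<in> topspace ?D" for w
      using F.continuous_map_ntopD(1)[OF multilinear_comb_continuous[OF F.nonarch_group_axioms mult_spaceD(1)[OF M]] that]
        \<Phi> \<open>multilinear_comb T I E M (Suc n) \<Phi>'\<close> by auto
    show ?case
    proof (intro exI[of _ "\<lambda>w. \<Phi> w + \<Phi>' w"] conjI comb ballI)
      fix v x h \<zeta>
      assume w: "v \<in> topspace T" "x \<in> vecs ?P" "h \<in> vecs (pow_space {1..Suc n} ?P)"
        "\<zeta> \<in> vecs (pow_space {1..Suc n} (scalars :: ('k, 'k) nspace))"
      then have "(v, x, h, \<zeta>) \<in> topspace ?D" using top by blast
      note \<Phi>F[OF this]
      from F.scl_add_right[OF this] show "scl F (\<zeta> (Suc n)) (\<Phi> (v, x, h, \<zeta>) + \<Phi>' (v, x, h, \<zeta>)) =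
          \<Psi> (v, x + scl ?P (\<zeta> (Suc n)) (h (Suc n)), h(Suc n := 0), \<zeta>(Suc n := 0))
            + M (a (v, x + scl ?P (\<zeta> (Suc n)) (h (Suc n)), h(Suc n := 0), \<zeta>(Suc n := 0)))
          - (\<Psi> (v, x, h(Suc n := 0), \<zeta>(Suc n := 0)) + M (a (v, x, h(Suc n := 0), \<zeta>(Suc n := 0))))"
        by (simp only: eq[OF w] eq'[OF w] add_diff_add)
    qed
  }
qed

theorem smooth_multilinear:
  fixes E :: "('k::nonarch_valued_field, 'e::ab_group_add) nspace"
    and F :: "('k, 'f::ab_group_add) nspace"
  assumes "nonarch_space E" "nonarch_space F" and I: "finite I" and M: "M \<in> vecs (mult_space I E F)"
  shows "smooth m (pow_space I E) F M"
proof -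
  interpret E: nonarch_space E by fact
  interpret F: nonarch_space F by fact
  interpret P: nonarch_space "pow_space I E" using nonarch_space_pow assms I by blast
  define T where "T = discrete_topology {()}"
  have "\<exists>\<Phi>. multilinear_comb T I E M n \<Phi> \<and> diff_quot T (pow_space I E) F (\<lambda>_. M) n \<Phi>" for n
  proof (induction n)
    case 0
    have "affine_slots T I E 0 I (\<lambda>w. fst (snd w))"
      unfolding affine_slots_def using continuous_map_dq_top(2) by auto
    then have "multilinear_comb T I E M 0 (\<lambda>w. 0 + M (fst (snd w)))"
      by (intro multilinear_comb.intros)
    then show ?case
      using multilinear_comb_continuous[OF F.nonarch_group_axioms mult_spaceD(1)[OF M]]
      by (intro exI[of _ "\<lambda>w. 0 + M (fst (snd w))"]) auto
  next
    case (Suc n)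
    then obtain \<Psi> where \<Psi>: "multilinear_comb T I E M n \<Psi>" "diff_quot T (pow_space I E) F (\<lambda>_. M) n \<Psi>" by blast
    obtain \<Phi> where \<Phi>: "multilinear_comb T I E M (Suc n) \<Phi>"
      and eq: "\<forall>v\<in>topspace T. \<forall>x\<in>vecs (pow_space I E). \<forall>h\<in>vecs (pow_space {1..Suc n} (pow_space I E)).
        \<forall>\<zeta>\<in>vecs (pow_space {1..Suc n} scalars).
        scl F (\<zeta> (Suc n)) (\<Phi> (v, x, h, \<zeta>)) =
          \<Psi> (v, x + scl (pow_space I E) (\<zeta> (Suc n)) (h (Suc n)), h(Suc n := 0), \<zeta>(Suc n := 0))
          - \<Psi> (v, x, h(Suc n := 0), \<zeta>(Suc n := 0))"
      using multilinear_comb_step[OF assms \<Psi>(1)] by blast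
    have cont: "continuous_map (dq_top T (pow_space I E) (Suc n)) (ntop F) \<Phi>"
      using multilinear_comb_continuous[OF F.nonarch_group_axioms mult_spaceD(1)[OF M] \<Phi>] .
    have "diff_quot T (pow_space I E) F (\<lambda>_. M) (Suc n) \<Phi>"
      unfolding diff_quot.simps
    proof (intro conjI cont exI[of _ \<Psi>] \<Psi> ballI impI)
      fix v x h \<zeta> assume w: "v \<in> topspace T" "x \<in> vecs (pow_space I E)"
        "h \<in> vecs (pow_space {1..Suc n} (pow_space I E))" "\<zeta> \<in> vecs (pow_space {1..Suc n} scalars)"
        and nz: "\<zeta> (Suc n) \<noteq> (0::'k)"
      have "\<Phi> (v, x, h, \<zeta>) \<in> vecs F"
        using F.continuous_map_ntopD(1)[OF cont] w topspace_dq_top[OF P.nonarch_group_axioms] by blast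
      then have "\<Phi> (v, x, h, \<zeta>) = scl F (inverse (\<zeta> (Suc n))) (scl F (\<zeta> (Suc n)) (\<Phi> (v, x, h, \<zeta>)))"
        using nz by (simp add: F.scl_scl F.scl_one)
      then show "\<Phi> (v, x, h, \<zeta>) = scl F (inverse (\<zeta> (Suc n)))
            (\<Psi> (v, x + scl (pow_space I E) (\<zeta> (Suc n)) (h (Suc n)), h(Suc n := 0), \<zeta>(Suc n := 0))
             - \<Psi> (v, x, h(Suc n := 0), \<zeta>(Suc n := 0)))"
        using eq w by metis
    qed
    with \<Phi> show ?case by blast
  qed
  then show ?thesis unfolding smooth_def smooth_param_def T_def by blast
qed


section \<open>The antiderivation\<close>

text \<open>
  Membership of the terms in the carrier is included because the limit laws for \<open>nsums\<close> require it.
\<close>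
definition antider_summable where
  "antider_summable B X I \<sigma> G A \<xi> \<eta> \<longleftrightarrow>
     (\<forall>v\<in>B. (\<forall>n. antider_term I \<sigma> G A \<xi> \<eta> v n \<in> vecs X) \<and> (\<exists>s. nsums X (antider_term I \<sigma> G A \<xi> \<eta> v) s))"

lemma (in nonarch_group) nsums_antider:
  assumes "antider_summable B E I \<sigma> G A \<xi> \<eta>" and "v \<in> B"
  shows "nsums E (antider_term I \<sigma> G A \<xi> \<eta> v) (antider B E I \<sigma> G A \<xi> \<eta> v)"
    and "antider_term I \<sigma> G A \<xi> \<eta> v n \<in> vecs E"
  using assms nsuminf_eq by (auto simp: antider_summable_def antider_def)

lemma (in nonarch_group) antider_add:
  assumes "antider_summable B E I \<sigma> G A \<xi> \<eta>" and "antider_summable B E I \<sigma> G' A' \<xi>' \<eta>'"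
    and summand: "\<And>v n. v \<in> B \<Longrightarrow> antider_term I \<sigma> G'' A'' \<xi>'' \<eta>'' v n
      = antider_term I \<sigma> G A \<xi> \<eta> v n + antider_term I \<sigma> G' A' \<xi>' \<eta>' v n"
  shows "antider B E I \<sigma> G'' A'' \<xi>'' \<eta>'' = antider B E I \<sigma> G A \<xi> \<eta> + antider B E I \<sigma> G' A' \<xi>' \<eta>'"
proof
  fix v
  show "antider B E I \<sigma> G'' A'' \<xi>'' \<eta>'' v = (antider B E I \<sigma> G A \<xi> \<eta> + antider B E I \<sigma> G' A' \<xi>' \<eta>') v"
  proof (cases "v \<in> B")
    case True
    have "antider_term I \<sigma> G'' A'' \<xi>'' \<eta>'' v
        = (\<lambda>n. antider_term I \<sigma> G A \<xi> \<eta> v n + antider_term I \<sigma> G' A' \<xi>' \<eta>' v n)"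
      using summand[OF True] by auto
    then have "nsuminf E (antider_term I \<sigma> G'' A'' \<xi>'' \<eta>'' v)
        = antider B E I \<sigma> G A \<xi> \<eta> v + antider B E I \<sigma> G' A' \<xi>' \<eta>' v"
      using nsuminf_eq[OF nsums_add] nsums_antider[OF assms(1) True] nsums_antider[OF assms(2) True] by simp
    then show ?thesis using True by (simp add: antider_def[of B E I \<sigma> G''])
  qed (simp add: antider_def)
qed

lemma (in nonarch_group) antider_diff:
  assumes "antider_summable B E I \<sigma> G A \<xi> \<eta>" and "antider_summable B E I \<sigma> G' A' \<xi>' \<eta>'"
    and summand: "\<And>v n. v \<in> B \<Longrightarrow> antider_term I \<sigma> G'' A'' \<xi>'' \<eta>'' v n
      = antider_term I \<sigma> G A \<xi> \<eta> v n - antider_term I \<sigma> G' A' \<xi>' \<eta>' v n"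
  shows "antider B E I \<sigma> G'' A'' \<xi>'' \<eta>'' = antider B E I \<sigma> G A \<xi> \<eta> - antider B E I \<sigma> G' A' \<xi>' \<eta>'"
proof -
  have "antider_summable B E I \<sigma> G'' A'' \<xi>'' \<eta>''"
    unfolding antider_summable_def
  proof (intro ballI conjI allI)
    fix v assume v: "v \<in> B"
    show "antider_term I \<sigma> G'' A'' \<xi>'' \<eta>'' v n \<in> vecs E" for n
      using nsums_antider(2)[OF assms(1) v] nsums_antider(2)[OF assms(2) v] by (simp add: summand[OF v] diff_mem)
    have "antider_term I \<sigma> G'' A'' \<xi>'' \<eta>'' v
        = (\<lambda>n. antider_term I \<sigma> G A \<xi> \<eta> v n - antider_term I \<sigma> G' A' \<xi>' \<eta>' v n)"
      using summand[OF v] by auto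
    then show "\<exists>s. nsums E (antider_term I \<sigma> G'' A'' \<xi>'' \<eta>'' v) s"
      using nsums_diff[OF nsums_antider(2,1)[OF assms(1) v] nsums_antider(2,1)[OF assms(2) v]] by auto
  qed
  from antider_add[OF this assms(2), of G A \<xi> \<eta>] summand show ?thesis by simp
qed

lemma (in nonarch_space) antider_scl:
  assumes "antider_summable B E I \<sigma> G A \<xi> \<eta>"
    and summand: "\<And>v n. v \<in> B \<Longrightarrow> antider_term I \<sigma> G' A' \<xi>' \<eta>' v n = scl E c (antider_term I \<sigma> G A \<xi> \<eta> v n)"
  shows "antider B E I \<sigma> G' A' \<xi>' \<eta>' = scl (C0_space B E) c (antider B E I \<sigma> G A \<xi> \<eta>)"
proof -
  have eq: "antider_term I \<sigma> G' A' \<xi>' \<eta>' v = (\<lambda>n. scl E c (antider_term I \<sigma> G A \<xi> \<eta> v n))" if "v \<in> B" for v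
    using summand[OF that] by auto
  have s: "nsums E (antider_term I \<sigma> G' A' \<xi>' \<eta>' v) (scl E c (antider B E I \<sigma> G A \<xi> \<eta> v))" if "v \<in> B" for v
    unfolding eq[OF that] using nsums_scl nsums_antider[OF assms(1) that] by blast
  show "antider B E I \<sigma> G' A' \<xi>' \<eta>' = scl (C0_space B E) c (antider B E I \<sigma> G A \<xi> \<eta>)"
  proof
    fix v show "antider B E I \<sigma> G' A' \<xi>' \<eta>' v = scl (C0_space B E) c (antider B E I \<sigma> G A \<xi> \<eta>) v"
      using nsuminf_eq[OF s] by (cases "v \<in> B") (simp_all add: antider_def)
  qed
qed

locale antiderivation = nonarch_space X + nonarch_complete X
  for X :: "('k::nonarch_local_field, 'e::ab_group_add) nspace" +
  fixes B :: "'k set" and t\<^sub>0 :: 'k and \<sigma> :: "nat \<Rightarrow> 'k \<Rightarrow> 'k"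
    and I :: "nat set" and A :: "nat \<Rightarrow> 'k \<Rightarrow> 'e \<Rightarrow> 'e"
  assumes B: "compact B" "B \<noteq> {}"
    and approx: "approx_identity B t\<^sub>0 \<sigma>"
    and I: "finite I" "I \<noteq> {}"
    and A: "i \<in> I \<Longrightarrow> continuous_map (top_of_set B) (ntop (lin_space X)) (A i)"
begin

abbreviation "CX \<equiv> C0_space B X"

sublocale CX: nonarch_space CX
  using nonarch_space_C0 nonarch_space_axioms B by blast

lemma \<sigma>_mem: "v \<in> B \<Longrightarrow> \<sigma> n v \<in> B"
  using approx by (simp add: approx_identity_def)

lemma A_mem: "i \<in> I \<Longrightarrow> s \<in> B \<Longrightarrow> A i s \<in> vecs (lin_space X)"
  using continuous_map_image_subset_topspace[OF A]
    nonarch_group.topspace_ntop[OF nonarch_group_lin[OF nonarch_space_axioms]] by auto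

lemma antider_cong:
  assumes "\<And>s. s \<in> B \<Longrightarrow> G s (\<lambda>i. \<xi> i s) = G' s (\<lambda>i. \<xi>' i s)"
  shows "antider B X I \<sigma> G A \<xi> \<eta> = antider B X I \<sigma> G' A \<xi>' \<eta>"
proof -
  have "antider_term I \<sigma> G A \<xi> \<eta> v = antider_term I \<sigma> G' A \<xi>' \<eta> v" if "v \<in> B" for v
    using assms that by (simp add: antider_term_def fun_eq_iff \<sigma>_mem)
  then show ?thesis by (intro ext) (simp add: antider_def)
qed

lemma continuous_map_eval_pow:
  assumes L: "finite L" and f: "continuous_map Z (ntop (pow_space L CX)) f"
    and s: "continuous_map Z (top_of_set B) s"
  shows "continuous_map Z (ntop (pow_space L X)) (\<lambda>z i. f z i (s z))"
  using f continuous_map_eval_C0[OF B _ s]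
  unfolding continuous_map_pow_iff[OF nonarch_group_axioms L] continuous_map_pow_iff[OF CX.nonarch_group_axioms L]
  by auto

lemma continuous_map_increments:
  assumes \<eta>: "continuous_map Z (ntop (pow_space I CX)) \<eta>"
    and s: "continuous_map Z (top_of_set B) s" and t: "continuous_map Z (top_of_set B) t"
  shows "continuous_map Z (ntop (pow_space I X))
    (\<lambda>z i. if i \<in> I then A i (s z) (\<eta> z i (t z) - \<eta> z i (s z)) else 0)"
  unfolding continuous_map_pow_iff[OF nonarch_group_axioms I(1)]
proof (intro conjI ballI allI impI)
  fix i assume i: "i \<in> I"
  have "continuous_map Z (ntop CX) (\<lambda>z. \<eta> z i)"
    using \<eta> i unfolding continuous_map_pow_iff[OF CX.nonarch_group_axioms I(1)] by blast
  then have "continuous_map Z (ntop X) (\<lambda>z. \<eta> z i (t z) - \<eta> z i (s z))"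
    by (intro continuous_map_diff continuous_map_eval_C0[OF B] s t)
  from continuous_map_apply_lin[OF _ this] continuous_map_compose[OF s A[OF i]]
  show "continuous_map Z (ntop X) (\<lambda>z. if i \<in> I then A i (s z) (\<eta> z i (t z) - \<eta> z i (s z)) else 0)"
    using i by (simp add: o_def)
qed auto

text \<open>
  Here \<open>G\<close>, \<open>\<xi>\<close> and \<open>\<eta>\<close> may all depend on the parameter, but only the composite
  \<open>s \<mapsto> G w s (\<xi> w s)\<close> has to be continuous. Therefore the lemma applies to the difference quotients of \<open>G\<close> as well
  as to \<open>G\<close>. The terms vanish on the diagonal because the index set \<open>I\<close>
  of the increments is not empty.
\<close>
lemma continuous_map_antider:
  fixes W :: "'w topology"
  assumes G: "continuous_map (prod_topology (top_of_set B) W) (ntop (mult_space I X X))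
      (\<lambda>(s, w). G w s (\<lambda>i. \<xi> w i s))"
    and \<eta>: "continuous_map W (ntop (pow_space I CX)) \<eta>"
  shows "w \<in> topspace W \<Longrightarrow> antider_summable B X I \<sigma> (G w) A (\<xi> w) (\<eta> w)"
    and "continuous_map W (ntop CX) (\<lambda>w. antider B X I \<sigma> (G w) A (\<xi> w) (\<eta> w))"
proof -
  define \<tau> where "\<tau> s t w = G w s (\<lambda>i. \<xi> w i s) (\<lambda>i. if i \<in> I then A i s (\<eta> w i t - \<eta> w i s) else 0)" for s t w
  have summand: "antider_term I \<sigma> (G w) A (\<xi> w) (\<eta> w) v = (\<lambda>n. \<tau> (\<sigma> n v) (\<sigma> (Suc n) v) w)" for w v
    by (simp add: antider_term_def \<tau>_def fun_eq_iff)
  let ?Z = "prod_topology (prod_topology (top_of_set B) (top_of_set B)) W"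
  have s: "continuous_map ?Z (top_of_set B) (\<lambda>z. fst (fst z))"
    and t: "continuous_map ?Z (top_of_set B) (\<lambda>z. snd (fst z))"
    by (rule continuous_map_fst_of[unfolded o_def, OF continuous_map_fst]
        continuous_map_snd_of[unfolded o_def, OF continuous_map_fst])+
  have "continuous_map ?Z (prod_topology (top_of_set B) W) (\<lambda>z. (fst (fst z), snd z))"
    by (intro continuous_map_pairedI s continuous_map_snd)
  from continuous_map_compose[OF this G]
  have g: "continuous_map ?Z (ntop (mult_space I X X)) (\<lambda>z. G (snd z) (fst (fst z)) (\<lambda>i. \<xi> (snd z) i (fst (fst z))))"
    by (simp add: o_def)
  have "continuous_map ?Z (ntop (pow_space I CX)) (\<lambda>z. \<eta> (snd z))"
    using continuous_map_compose[OF continuous_map_snd \<eta>] by (simp add: o_def)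
  from continuous_map_apply_mult[OF nonarch_space_axioms nonarch_space_axioms I(1) g continuous_map_increments[OF this s t]]
  have \<tau>: "continuous_map ?Z (ntop X) (\<lambda>((s, t), w). \<tau> s t w)"
    by (simp add: \<tau>_def case_prod_unfold)
  have diag: "\<tau> s s w = 0" if "s \<in> B" "w \<in> topspace W" for s w
  proof -
    obtain i where i: "i \<in> I" using I by blast
    have A0: "A i s 0 = 0" if "i \<in> I" for i
      using lin_spaceD(3)[OF A_mem[OF that \<open>s \<in> B\<close>], of 0 0] by simp
    have "G w s (\<lambda>i. \<xi> w i s) \<in> vecs (mult_space I X X)"
      using continuous_map_image_subset_topspace[OF G] that
        nonarch_group.topspace_ntop[OF nonarch_group_mult[OF nonarch_space_axioms nonarch_space_axioms I(1)]] by auto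
    from mult_space_eq_0[OF nonarch_space_axioms nonarch_space_axioms this _ i _ I(1)]
    show ?thesis by (simp add: \<tau>_def vecs_pow A0)
  qed
  have sums: "\<exists>s. nsums X (\<lambda>n. \<tau> (\<sigma> n v) (\<sigma> (Suc n) v) w) s" if "w \<in> topspace W" "v \<in> B" for w v
    by (rule continuous_map_increment_series(1)[OF nonarch_complete_axioms B \<tau>])
      (use diag approx_identity_continuous[OF approx] approx_identity_increments[OF approx] that in auto)
  show "antider_summable B X I \<sigma> (G w) A (\<xi> w) (\<eta> w)" if "w \<in> topspace W" for w
    unfolding antider_summable_def summand
    using sums[OF that] continuous_map_ntopD(1)[OF \<tau>, of "((s, t), w)" for s t] that by (auto simp: \<sigma>_mem)
  have "continuous_map W (ntop CX)
      (\<lambda>w v. if v \<in> B then nsuminf X (\<lambda>n. \<tau> (\<sigma> n v) (\<sigma> (Suc n) v) w) else 0)"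
    by (rule continuous_map_increment_series(2)[OF nonarch_complete_axioms B \<tau>])
      (use diag approx_identity_continuous[OF approx] approx_identity_increments[OF approx] in auto)
  then show "continuous_map W (ntop CX) (\<lambda>w. antider B X I \<sigma> (G w) A (\<xi> w) (\<eta> w))"
    unfolding antider_def[abs_def] summand .
qed

context
  fixes L :: "nat set" and G :: "'k \<Rightarrow> (nat \<Rightarrow> 'e) \<Rightarrow> (nat \<Rightarrow> 'e) \<Rightarrow> 'e"
  assumes L: "finite L"
    and G: "continuous_map (prod_topology (top_of_set B) (ntop (pow_space L X))) (ntop (mult_space I X X))
      (\<lambda>(v, x). G v x)"
begin

interpretation P: nonarch_space "pow_space L X" using nonarch_space_pow nonarch_space_axioms L by blast
interpretation PC: nonarch_space "pow_space L CX" using nonarch_space_pow CX.nonarch_space_axioms L by blast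
interpretation IC: nonarch_space "pow_space I CX" using nonarch_space_pow CX.nonarch_space_axioms I by blast

lemma continuous_map_G_along:
  assumes "continuous_map W (ntop (pow_space L CX)) \<xi>"
  shows "continuous_map (prod_topology (top_of_set B) W) (ntop (mult_space I X X)) (\<lambda>(s, w). G s (\<lambda>i. \<xi> w i s))"
proof -
  let ?Z = "prod_topology (top_of_set B) W"
  have "continuous_map ?Z (ntop (pow_space L CX)) (\<lambda>z. \<xi> (snd z))"
    using continuous_map_compose[OF continuous_map_snd assms] by (simp add: o_def)
  from continuous_map_eval_pow[OF L this continuous_map_fst]
  have "continuous_map ?Z (prod_topology (top_of_set B) (ntop (pow_space L X))) (\<lambda>z. (fst z, \<lambda>i. \<xi> (snd z) i (fst z)))"
    by (intro continuous_map_pairedI continuous_map_fst)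
  from continuous_map_compose[OF this G] show ?thesis by (simp add: o_def case_prod_unfold)
qed

lemma continuous_map_antider_\<xi>:
  assumes "\<eta> \<in> vecs (pow_space I CX)"
  shows "\<xi> \<in> vecs (pow_space L CX) \<Longrightarrow> antider_summable B X I \<sigma> G A \<xi> \<eta>"
    and "continuous_map (ntop (pow_space L CX)) (ntop CX) (\<lambda>\<xi>. antider B X I \<sigma> G A \<xi> \<eta>)"
proof -
  have "continuous_map (ntop (pow_space L CX)) (ntop (pow_space L CX)) (\<lambda>\<xi>. \<xi>)"
    by (simp flip: id_def)
  note * = continuous_map_antider[where G = "\<lambda>_. G" and \<xi> = "\<lambda>\<xi>. \<xi>" and \<eta> = "\<lambda>_. \<eta>", OF continuous_map_G_along[OF this]]
  show "antider_summable B X I \<sigma> G A \<xi> \<eta>" if "\<xi> \<in> vecs (pow_space L CX)" for \<xi>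
    using *(1)[of \<xi>] that assms by simp
  show "continuous_map (ntop (pow_space L CX)) (ntop CX) (\<lambda>\<xi>. antider B X I \<sigma> G A \<xi> \<eta>)"
    using *(2) assms by simp
qed

lemma continuous_map_antider_joint:
  assumes "\<eta> \<in> vecs (pow_space I CX)"
  shows "continuous_map (prod_topology (top_of_set B) (ntop (pow_space L CX))) (ntop X)
    (\<lambda>(v, \<xi>). antider B X I \<sigma> G A \<xi> \<eta> v)"
proof -
  let ?Z = "prod_topology (top_of_set B) (ntop (pow_space L CX))"
  have "continuous_map ?Z (ntop CX) (\<lambda>z. antider B X I \<sigma> G A (snd z) \<eta>)"
    using continuous_map_compose[OF continuous_map_snd continuous_map_antider_\<xi>(2)[OF assms]] by (simp add: o_def)
  from continuous_map_eval_C0[OF B this continuous_map_fst] show ?thesis by (simp add: case_prod_unfold)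
qed

text \<open>
  The antiderivation is multilinear in \<open>\<eta>\<close> because each term is, and its continuity in \<open>\<eta>\<close> is
  \<open>continuous_map_antider\<close> with \<open>\<eta>\<close> itself as the parameter.
\<close>
lemma smooth_antider_\<eta>:
  assumes \<xi>: "\<xi> \<in> vecs (pow_space L CX)"
  shows "smooth m (pow_space I CX) CX (\<lambda>\<eta>. antider B X I \<sigma> G A \<xi> \<eta>)"
proof -
  let ?P = "\<lambda>\<eta>. antider B X I \<sigma> G A \<xi> \<eta>"
  let ?y = "\<lambda>\<eta> s t i. if i \<in> I then A i s (\<eta> i t - \<eta> i s) else 0"
  \<comment> \<open>\<open>mult_space\<close> requires the value \<open>0\<close> off the carrier, where the antiderivation is not controlled.\<close>
  define M where "M \<eta> = (if \<eta> \<in> vecs (pow_space I CX) then ?P \<eta> else 0)" for \<eta>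
  have "continuous_map (ntop (pow_space I CX)) (ntop (pow_space L CX)) (\<lambda>_. \<xi>)"
    using \<xi> by simp
  note G\<xi> = continuous_map_G_along[OF this]
  have "continuous_map (ntop (pow_space I CX)) (ntop (pow_space I CX)) (\<lambda>\<eta>. \<eta>)"
    by (simp flip: id_def)
  note * = continuous_map_antider[where G = "\<lambda>_. G" and \<xi> = "\<lambda>_. \<xi>", OF G\<xi> this]
  have summable: "antider_summable B X I \<sigma> G A \<xi> \<eta>" if "\<eta> \<in> vecs (pow_space I CX)" for \<eta>
    using *(1) that by simp
  have Gs: "G s (\<lambda>i. \<xi> i s) \<in> vecs (mult_space I X X)" if "s \<in> B" for s
    using nonarch_group.continuous_map_ntopD(1)[OF nonarch_group_mult[OF nonarch_space_axioms nonarch_space_axioms I(1)] G\<xi>,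
        of "(s, 0)"] that by simp
  have y: "?y \<eta> s t \<in> vecs (pow_space I X)" if "\<eta> \<in> vecs (pow_space I CX)" "s \<in> B" "t \<in> B" for \<eta> s t
    using lin_spaceD(1)[OF A_mem diff_mem] vecs_C0_mem[OF CX.vecs_pow_mem[OF that(1)]] that by (simp add: vecs_pow)
  have y_upd: "?y (\<eta>(i := a)) s t = (?y \<eta> s t)(i := A i s (a t - a s))" if "i \<in> I" for \<eta> i a s t
    using that by (auto simp: fun_eq_iff)
  have "M \<in> vecs (mult_space I CX CX)"
    unfolding mult_space_def
  proof (simp only: nspace.simps mem_Collect_eq, intro conjI ballI allI impI)
    show "continuous_map (ntop (pow_space I CX)) (ntop CX) M"
      by (rule continuous_map_eq[OF *(2)]) (simp add: M_def)
    show "M \<eta> = 0" if "\<eta> \<notin> vecs (pow_space I CX)" for \<eta> using that by (simp add: M_def)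
    fix \<eta> i assume \<eta>: "\<eta> \<in> vecs (pow_space I CX)" and i: "i \<in> I"
    have upd: "\<eta>(i := a) \<in> vecs (pow_space I CX)" if "a \<in> vecs CX" for a
      using vecs_pow_upd[OF \<eta> i that] .
    fix a assume a: "a \<in> vecs CX"
    {
      fix b assume b: "b \<in> vecs CX"
      have "?P (\<eta>(i := a + b)) = ?P (\<eta>(i := a)) + ?P (\<eta>(i := b))"
      proof (rule antider_add[OF summable[OF upd[OF a]] summable[OF upd[OF b]]])
        fix v n assume v: "v \<in> B"
        let ?s = "\<sigma> n v" and ?t = "\<sigma> (Suc n) v"
        have "A i ?s ((a + b) ?t - (a + b) ?s) = A i ?s ((a ?t - a ?s) + (b ?t - b ?s))"
          by (simp add: algebra_simps)
        also have "\<dots> = A i ?s (a ?t - a ?s) + A i ?s (b ?t - b ?s)"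
          by (intro lin_spaceD(3)[OF A_mem[OF i]] \<sigma>_mem v diff_mem vecs_C0_mem[OF a] vecs_C0_mem[OF b])
        finally show "antider_term I \<sigma> G A \<xi> (\<eta>(i := a + b)) v n
            = antider_term I \<sigma> G A \<xi> (\<eta>(i := a)) v n + antider_term I \<sigma> G A \<xi> (\<eta>(i := b)) v n"
          unfolding antider_term_def y_upd[OF i]
          using mult_spaceD(3)[OF Gs[OF \<sigma>_mem[OF v]] y[OF \<eta> \<sigma>_mem[OF v] \<sigma>_mem[OF v]] i
              lin_spaceD(1)[OF A_mem[OF i \<sigma>_mem[OF v]] diff_mem[OF vecs_C0_mem[OF a] vecs_C0_mem[OF a]]]
              lin_spaceD(1)[OF A_mem[OF i \<sigma>_mem[OF v]] diff_mem[OF vecs_C0_mem[OF b] vecs_C0_mem[OF b]]]]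
          by simp
      qed
      then show "M (\<eta>(i := a + b)) = M (\<eta>(i := a)) + M (\<eta>(i := b))"
        using upd a b CX.add_mem by (simp add: M_def)
    }
    fix c
    have "?P (\<eta>(i := scl CX c a)) = scl CX c (?P (\<eta>(i := a)))"
    proof (rule antider_scl[OF summable[OF upd[OF a]]])
      fix v n assume v: "v \<in> B"
      let ?s = "\<sigma> n v" and ?t = "\<sigma> (Suc n) v"
      have "A i ?s (scl CX c a ?t - scl CX c a ?s) = A i ?s (scl X c (a ?t - a ?s))"
        by (simp add: scl_diff_right vecs_C0_mem[OF a])
      also have "\<dots> = scl X c (A i ?s (a ?t - a ?s))"
        by (intro lin_spaceD(4)[OF A_mem[OF i]] \<sigma>_mem v diff_mem vecs_C0_mem[OF a])
      finally show "antider_term I \<sigma> G A \<xi> (\<eta>(i := scl CX c a)) v n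
          = scl X c (antider_term I \<sigma> G A \<xi> (\<eta>(i := a)) v n)"
        unfolding antider_term_def y_upd[OF i]
        using mult_spaceD(4)[OF Gs[OF \<sigma>_mem[OF v]] y[OF \<eta> \<sigma>_mem[OF v] \<sigma>_mem[OF v]] i
            lin_spaceD(1)[OF A_mem[OF i \<sigma>_mem[OF v]] diff_mem[OF vecs_C0_mem[OF a] vecs_C0_mem[OF a]]]]
        by simp
    qed
    then show "M (\<eta>(i := scl CX c a)) = scl CX c (M (\<eta>(i := a)))"
      using upd a CX.scl_mem by (simp add: M_def)
  qed
  from smooth_multilinear[OF CX.nonarch_space_axioms CX.nonarch_space_axioms I(1) this, of m]
  show ?thesis
    using smooth_cong[of "pow_space I CX" M ?P] by (simp add: M_def)
qed

text \<open>
  The antiderivation is taken of \<open>\<Phi>\<close> with all its arguments evaluated at the point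
  \<open>s\<close>. The defining equation of the difference quotient holds term by term, hence for the sums. The space \<open>T\<close>
  is a dummy parameter space, to be specialized to one point.
\<close>
lemma diff_quot_antider:
  fixes T :: "'u topology"
  assumes \<eta>: "\<eta> \<in> vecs (pow_space I CX)"
    and "diff_quot (top_of_set B) (pow_space L X) (mult_space I X X) G n \<Phi>"
  shows "diff_quot T (pow_space L CX) CX (\<lambda>_ \<xi>. antider B X I \<sigma> G A \<xi> \<eta>) n
    (\<lambda>(u, \<xi>, h, \<zeta>). antider B X I \<sigma> (\<lambda>s x. \<Phi> (s, x, \<lambda>a i. h a i s, \<zeta>)) A \<xi> \<eta>)"
proof -
  let ?D = "\<lambda>T n. dq_top T (pow_space L CX) n"
  let ?Q = "\<lambda>\<Phi> \<xi> h \<zeta>. antider B X I \<sigma> (\<lambda>s x. \<Phi> (s, x, \<lambda>a i. h a i s, \<zeta>)) A \<xi> \<eta>"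
  have cont: "w \<in> topspace (?D T n) \<Longrightarrow> antider_summable B X I \<sigma>
        (\<lambda>s x. \<Phi> (s, x, \<lambda>a i. fst (snd (snd w)) a i s, snd (snd (snd w)))) A (fst (snd w)) \<eta>"
      "continuous_map (?D T n) (ntop CX) (\<lambda>w. ?Q \<Phi> (fst (snd w)) (fst (snd (snd w))) (snd (snd (snd w))))"
    if \<Phi>: "continuous_map (dq_top (top_of_set B) (pow_space L X) n) (ntop (mult_space I X X)) \<Phi>"
    for n \<Phi> w and T :: "'t topology"
  proof -
    let ?Z = "prod_topology (top_of_set B) (?D T n)"
    have s: "continuous_map ?Z (top_of_set B) fst" by (rule continuous_map_fst)
    have \<xi>: "continuous_map ?Z (ntop (pow_space L CX)) (\<lambda>z. fst (snd (snd z)))"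
      and h: "continuous_map ?Z (ntop (pow_space {1..n} (pow_space L CX))) (\<lambda>z. fst (snd (snd (snd z))))"
      and \<zeta>: "continuous_map ?Z (ntop (pow_space {1..n} scalars)) (\<lambda>z. snd (snd (snd (snd z))))"
      using continuous_map_compose[OF continuous_map_snd continuous_map_dq_top(2)]
        continuous_map_compose[OF continuous_map_snd continuous_map_dq_top(3)]
        continuous_map_compose[OF continuous_map_snd continuous_map_dq_top(4)]
      unfolding o_def by blast+
    have "continuous_map ?Z (ntop (pow_space {1..n} (pow_space L X))) (\<lambda>z a i. fst (snd (snd (snd z))) a i (fst z))"
      unfolding continuous_map_pow_iff[OF P.nonarch_group_axioms finite_atLeastAtMost]
    proof (intro conjI ballI allI impI)
      fix a assume "a \<in> {1..n}"
      then have "continuous_map ?Z (ntop (pow_space L CX)) (\<lambda>z. fst (snd (snd (snd z))) a)"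
        using h unfolding continuous_map_pow_iff[OF PC.nonarch_group_axioms finite_atLeastAtMost] by blast
      from continuous_map_eval_pow[OF L this s]
      show "continuous_map ?Z (ntop (pow_space L X)) (\<lambda>z i. fst (snd (snd (snd z))) a i (fst z))" .
    next
      fix z a assume "z \<in> topspace ?Z" "a \<notin> {1..n}"
      then have "fst (snd (snd (snd z))) a = 0"
        using h unfolding continuous_map_pow_iff[OF PC.nonarch_group_axioms finite_atLeastAtMost] by blast
      then show "(\<lambda>i. fst (snd (snd (snd z))) a i (fst z)) = 0" by (simp add: fun_eq_iff)
    qed
    from continuous_map_compose[OF continuous_map_into_dq_top[OF s continuous_map_eval_pow[OF L \<xi> s] this \<zeta>] \<Phi>]
    have g: "continuous_map ?Z (ntop (mult_space I X X)) (\<lambda>(s, w). \<Phi> (s, \<lambda>i. fst (snd w) i s,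
        \<lambda>a i. fst (snd (snd w)) a i s, snd (snd (snd w))))"
      by (simp add: o_def case_prod_unfold)
    have "continuous_map (?D T n) (ntop (pow_space I CX)) (\<lambda>_. \<eta>)" using \<eta> by simp
    note * = continuous_map_antider[where \<xi> = "\<lambda>w. fst (snd w)"
        and G = "\<lambda>w s x. \<Phi> (s, x, \<lambda>a i. fst (snd (snd w)) a i s, snd (snd (snd w)))", OF g this]
    show "antider_summable B X I \<sigma>
        (\<lambda>s x. \<Phi> (s, x, \<lambda>a i. fst (snd (snd w)) a i s, snd (snd (snd w)))) A (fst (snd w)) \<eta>"
      if "w \<in> topspace (?D T n)" using *(1)[OF that] .
    show "continuous_map (?D T n) (ntop CX) (\<lambda>w. ?Q \<Phi> (fst (snd w)) (fst (snd (snd w))) (snd (snd (snd w))))"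
      using *(2) .
  qed
  have summable: "antider_summable B X I \<sigma> (\<lambda>s x. \<Phi> (s, x, \<lambda>a i. h a i s, \<zeta>)) A \<xi> \<eta>"
    if "diff_quot (top_of_set B) (pow_space L X) (mult_space I X X) G n \<Phi>"
      and "\<xi> \<in> vecs (pow_space L CX)" "h \<in> vecs (pow_space {1..n} (pow_space L CX))"
      "\<zeta> \<in> vecs (pow_space {1..n} scalars)" for n \<Phi> \<xi> h \<zeta>
  proof -
    have "continuous_map (dq_top (top_of_set B) (pow_space L X) n) (ntop (mult_space I X X)) \<Phi>"
      using that(1) by (cases n) auto
    \<comment> \<open>Convergence does not involve the dummy parameter, so a one-point space serves.\<close>
    moreover have "((), \<xi>, h, \<zeta>) \<in> topspace (?D (discrete_topology {()}) n)"
      using that by (simp add: topspace_dq_top[OF PC.nonarch_group_axioms])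
    ultimately show ?thesis using cont(1) by fastforce
  qed
  show "diff_quot T (pow_space L CX) CX (\<lambda>_ \<xi>. antider B X I \<sigma> G A \<xi> \<eta>) n (\<lambda>(u, \<xi>, h, \<zeta>). ?Q \<Phi> \<xi> h \<zeta>)"
    using assms(2)
  proof (induction n arbitrary: \<Phi>)
    case 0
    then have \<Phi>: "continuous_map (dq_top (top_of_set B) (pow_space L X) 0) (ntop (mult_space I X X)) \<Phi>"
      and eq: "\<And>v x. v \<in> B \<Longrightarrow> x \<in> vecs (pow_space L X) \<Longrightarrow> \<Phi> (v, x, 0, 0) = G v x" by auto
    have "?Q \<Phi> \<xi> 0 0 = antider B X I \<sigma> G A \<xi> \<eta>" if \<xi>: "\<xi> \<in> vecs (pow_space L CX)" for \<xi>
    proof (rule antider_cong)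
      fix s assume "s \<in> B"
      moreover have "(\<lambda>i. \<xi> i s) \<in> vecs (pow_space L X)"
        using \<xi> vecs_C0_mem by (auto simp: vecs_pow)
      moreover have "(\<lambda>a i. (0 :: nat \<Rightarrow> nat \<Rightarrow> 'k \<Rightarrow> 'e) a i s) = 0" by (simp add: fun_eq_iff)
      ultimately show "\<Phi> (s, \<lambda>i. \<xi> i s, \<lambda>a i. (0 :: nat \<Rightarrow> nat \<Rightarrow> 'k \<Rightarrow> 'e) a i s, 0) = G s (\<lambda>i. \<xi> i s)"
        using eq by simp
    qed
    then show ?case using cont(2)[OF \<Phi>, of T] by (simp add: case_prod_unfold)
  next
    case (Suc n)
    then obtain \<Psi> where \<Phi>: "continuous_map (dq_top (top_of_set B) (pow_space L X) (Suc n)) (ntop (mult_space I X X)) \<Phi>"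
      and \<Psi>: "diff_quot (top_of_set B) (pow_space L X) (mult_space I X X) G n \<Psi>"
      and eq: "\<And>v x h \<zeta>. v \<in> B \<Longrightarrow> x \<in> vecs (pow_space L X) \<Longrightarrow> h \<in> vecs (pow_space {1..Suc n} (pow_space L X))
        \<Longrightarrow> \<zeta> \<in> vecs (pow_space {1..Suc n} scalars) \<Longrightarrow> \<zeta> (Suc n) \<noteq> 0 \<Longrightarrow>
          \<Phi> (v, x, h, \<zeta>) = scl (mult_space I X X) (inverse (\<zeta> (Suc n)))
            (\<Psi> (v, x + scl (pow_space L X) (\<zeta> (Suc n)) (h (Suc n)), h(Suc n := 0), \<zeta>(Suc n := 0))
             - \<Psi> (v, x, h(Suc n := 0), \<zeta>(Suc n := 0)))"
      by auto
    have "?Q \<Phi> \<xi> h \<zeta> = scl CX (inverse (\<zeta> (Suc n)))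
        (?Q \<Psi> (\<xi> + scl (pow_space L CX) (\<zeta> (Suc n)) (h (Suc n))) (h(Suc n := 0)) (\<zeta>(Suc n := 0))
         - ?Q \<Psi> \<xi> (h(Suc n := 0)) (\<zeta>(Suc n := 0)))"
      if \<xi>: "\<xi> \<in> vecs (pow_space L CX)" and h: "h \<in> vecs (pow_space {1..Suc n} (pow_space L CX))"
        and \<zeta>: "\<zeta> \<in> vecs (pow_space {1..Suc n} scalars)" "\<zeta> (Suc n) \<noteq> 0" for \<xi> h \<zeta>
    proof -
      let ?\<xi>' = "\<xi> + scl (pow_space L CX) (\<zeta> (Suc n)) (h (Suc n))"
        and ?h' = "h(Suc n := 0)" and ?\<zeta>' = "\<zeta>(Suc n := 0)" and ?c = "\<zeta> (Suc n)"
      have \<xi>': "?\<xi>' \<in> vecs (pow_space L CX)"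
        using PC.add_mem[OF \<xi> PC.scl_mem[OF PC.vecs_pow_mem[OF h]]] .
      note S1 = summable[OF \<Psi> \<xi>' vecs_pow_truncate[OF h] vecs_pow_truncate[OF \<zeta>(1)]]
        and S2 = summable[OF \<Psi> \<xi> vecs_pow_truncate[OF h] vecs_pow_truncate[OF \<zeta>(1)]]
        and S = summable[OF Suc.prems \<xi> h \<zeta>(1)]
      have scaled: "scl CX ?c (?Q \<Phi> \<xi> h \<zeta>) = ?Q \<Psi> ?\<xi>' ?h' ?\<zeta>' - ?Q \<Psi> \<xi> ?h' ?\<zeta>'"
      proof -
        let ?y = "\<lambda>v n i. if i \<in> I then A i (\<sigma> n v) (\<eta> i (\<sigma> (Suc n) v) - \<eta> i (\<sigma> n v)) else 0"
        have summand: "scl X ?c (antider_term I \<sigma> (\<lambda>s x. \<Phi> (s, x, \<lambda>a i. h a i s, \<zeta>)) A \<xi> \<eta> v m)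
          = antider_term I \<sigma> (\<lambda>s x. \<Psi> (s, x, \<lambda>a i. ?h' a i s, ?\<zeta>')) A ?\<xi>' \<eta> v m
           - antider_term I \<sigma> (\<lambda>s x. \<Psi> (s, x, \<lambda>a i. ?h' a i s, ?\<zeta>')) A \<xi> \<eta> v m" if v: "v \<in> B" for v m
        proof -
          let ?s = "\<sigma> m v"
          let ?e = "\<lambda>h a i. h a i ?s"
          have x: "(\<lambda>i. \<xi> i ?s) \<in> vecs (pow_space L X)" and hs: "?e h \<in> vecs (pow_space {1..Suc n} (pow_space L X))"
            using \<xi> h vecs_C0_mem[OF CX.vecs_pow_mem[OF \<xi>]] vecs_C0_mem[OF CX.vecs_pow_mem[OF PC.vecs_pow_mem[OF h]]]
            by (auto simp: vecs_pow fun_eq_iff)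
          have "(\<lambda>i. ?\<xi>' i ?s) = (\<lambda>i. \<xi> i ?s) + scl (pow_space L X) ?c (?e h (Suc n))" "?e ?h' = (?e h)(Suc n := 0)"
            by (auto simp: fun_eq_iff)
          with eq[OF \<sigma>_mem[OF v] x hs \<zeta>]
          have "\<Phi> (?s, \<lambda>i. \<xi> i ?s, ?e h, \<zeta>) (?y v m) = scl X (inverse ?c)
              (\<Psi> (?s, \<lambda>i. ?\<xi>' i ?s, ?e ?h', ?\<zeta>') (?y v m) - \<Psi> (?s, \<lambda>i. \<xi> i ?s, ?e ?h', ?\<zeta>') (?y v m))"
            by (simp add: mult_space_def)
          moreover have "\<Psi> (?s, \<lambda>i. ?\<xi>' i ?s, ?e ?h', ?\<zeta>') (?y v m) - \<Psi> (?s, \<lambda>i. \<xi> i ?s, ?e ?h', ?\<zeta>') (?y v m) \<in> vecs X"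
            using diff_mem[OF nsums_antider(2)[OF S1 v, of m] nsums_antider(2)[OF S2 v, of m]] by (simp add: antider_term_def)
          ultimately show ?thesis using \<zeta>(2) by (simp add: antider_term_def scl_scl scl_one)
        qed
        have "scl CX ?c (?Q \<Phi> \<xi> h \<zeta>) = antider B X I \<sigma> (\<lambda>s x y. scl X ?c (\<Phi> (s, x, \<lambda>a i. h a i s, \<zeta>) y)) A \<xi> \<eta>"
          by (rule antider_scl[OF S, symmetric]) (simp add: antider_term_def)
        also have "\<dots> = ?Q \<Psi> ?\<xi>' ?h' ?\<zeta>' - ?Q \<Psi> \<xi> ?h' ?\<zeta>'"
        proof (rule antider_diff[OF S1 S2])
          fix v m assume "v \<in> B"
          have "antider_term I \<sigma> (\<lambda>s x y. scl X ?c (\<Phi> (s, x, \<lambda>a i. h a i s, \<zeta>) y)) A \<xi> \<eta> v m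
              = scl X ?c (antider_term I \<sigma> (\<lambda>s x. \<Phi> (s, x, \<lambda>a i. h a i s, \<zeta>)) A \<xi> \<eta> v m)"
            by (simp only: antider_term_def)
          then show "antider_term I \<sigma> (\<lambda>s x y. scl X ?c (\<Phi> (s, x, \<lambda>a i. h a i s, \<zeta>) y)) A \<xi> \<eta> v m
            = antider_term I \<sigma> (\<lambda>s x. \<Psi> (s, x, \<lambda>a i. ?h' a i s, ?\<zeta>')) A ?\<xi>' \<eta> v m
             - antider_term I \<sigma> (\<lambda>s x. \<Psi> (s, x, \<lambda>a i. ?h' a i s, ?\<zeta>')) A \<xi> \<eta> v m"
            using summand[OF \<open>v \<in> B\<close>, of m] by (rule trans)
        qed
        finally show ?thesis .
      qed
      have mem: "?Q \<Phi> \<xi> h \<zeta> \<in> vecs CX"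
        using CX.continuous_map_ntopD(1)[OF cont(2)[OF \<Phi>, of "discrete_topology {()}"], of "((), \<xi>, h, \<zeta>)"] \<xi> h \<zeta>
        by (simp add: topspace_dq_top[OF PC.nonarch_group_axioms])
      have "?Q \<Phi> \<xi> h \<zeta> = scl CX (inverse ?c) (scl CX ?c (?Q \<Phi> \<xi> h \<zeta>))"
        by (simp only: CX.scl_scl[OF mem] CX.scl_one[OF mem] left_inverse[OF \<zeta>(2)])
      then show ?thesis unfolding scaled .
    qed
    then show ?case
      unfolding diff_quot.simps
    proof (intro conjI exI[of _ "\<lambda>(u, \<xi>, h, \<zeta>). ?Q \<Psi> \<xi> h \<zeta>"] ballI impI Suc.IH \<Psi>, goal_cases)
      case 1
      then show ?case using cont(2)[OF \<Phi>, of T] by (simp add: case_prod_unfold)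
    next
      case 2
      then show ?case by (simp only: prod.case)
    qed
  qed
qed

lemma smooth_antider_\<xi>:
  assumes "\<eta> \<in> vecs (pow_space I CX)"
    and "smooth_param m (top_of_set B) (pow_space L X) (mult_space I X X) G"
  shows "smooth m (pow_space L CX) CX (\<lambda>\<xi>. antider B X I \<sigma> G A \<xi> \<eta>)"
  using diff_quot_antider[OF assms(1)] assms(2) unfolding smooth_def smooth_param_def by blast

end

end

theorem lemma2p2:
  fixes p k l :: nat
    and z t\<^sub>0 :: "'k::{nonarch_local_field, field_char_0}"
    and r :: real
    and \<alpha> :: "'j rel"
    and B :: "'k set"
    and X :: "('k, 'j \<Rightarrow> 'k) nspace"
    and CX :: "('k, 'k \<Rightarrow> 'j \<Rightarrow> 'k) nspace"
    and \<sigma> :: "nat \<Rightarrow> 'k \<Rightarrow> 'k"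
    and G :: "'k \<Rightarrow> (nat \<Rightarrow> 'j \<Rightarrow> 'k) \<Rightarrow> (nat \<Rightarrow> 'j \<Rightarrow> 'k) \<Rightarrow> 'j \<Rightarrow> 'k"
    and A :: "nat \<Rightarrow> 'k \<Rightarrow> ('j \<Rightarrow> 'k) \<Rightarrow> 'j \<Rightarrow> 'k"
  assumes "prime p" and "contains_Qp p TYPE('k)"
    and "Well_order \<alpha>" and X: "X = c0_space (Field \<alpha>)"
    and "r > 0" and B: "B = cball z r" and "t\<^sub>0 \<in> B"
    and CX: "CX = C0_space B X"
    and "approx_identity B t\<^sub>0 \<sigma>"
    and "l < k"
    and "continuous_map (prod_topology (top_of_set B) (ntop (pow_space {1..l} X)))
           (ntop (mult_space {l+1..k} X X)) (\<lambda>(v, x). G v x)"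
    and "\<forall>i\<in>{l+1..k}. continuous_map (top_of_set B) (ntop (lin_space X)) (A i)"
  shows
    "(\<forall>\<eta>\<in>vecs (pow_space {l+1..k} CX).
        (\<forall>\<xi>\<in>vecs (pow_space {1..l} CX). \<forall>v\<in>B.
           \<exists>s. nsums X (antider_term {l+1..k} \<sigma> G A \<xi> \<eta> v) s) \<and>
        continuous_map (prod_topology (top_of_set B) (ntop (pow_space {1..l} CX))) (ntop X)
          (\<lambda>(v, \<xi>). antider B X {l+1..k} \<sigma> G A \<xi> \<eta> v) \<and>
        continuous_map (ntop (pow_space {1..l} CX)) (ntop CX)
          (\<lambda>\<xi>. antider B X {l+1..k} \<sigma> G A \<xi> \<eta>)) \<and>
     (\<forall>\<xi>\<in>vecs (pow_space {1..l} CX).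
        smooth \<infinity> (pow_space {l+1..k} CX) CX
          (\<lambda>\<eta>. antider B X {l+1..k} \<sigma> G A \<xi> \<eta>)) \<and>
     (\<forall>m. smooth_param m (top_of_set B) (pow_space {1..l} X) (mult_space {l+1..k} X X) G \<longrightarrow>
        (\<forall>\<eta>\<in>vecs (pow_space {l+1..k} CX).
           smooth m (pow_space {1..l} CX) CX
             (\<lambda>\<xi>. antider B X {l+1..k} \<sigma> G A \<xi> \<eta>)))"
proof -
  interpret antiderivation X B t\<^sub>0 \<sigma> "{l+1..k}" A
  proof (intro antiderivation.intro antiderivation_axioms.intro)
    show "nonarch_space X" "nonarch_complete X"
      unfolding X by (rule nonarch_space_c0 nonarch_complete_c0)+
    show "compact B" unfolding B by (rule compact_cball_local_field)
    show "B \<noteq> {}" using \<open>t\<^sub>0 \<in> B\<close> by blast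
  qed (use assms in auto)
  note G = \<open>continuous_map _ (ntop (mult_space {l+1..k} X X)) _\<close>
  have L: "finite {1..l}" by simp
  show ?thesis
    unfolding CX
  proof (intro conjI ballI allI impI)
    fix \<eta> \<xi> v assume "\<eta> \<in> vecs (pow_space {l+1..k} (C0_space B X))" "\<xi> \<in> vecs (pow_space {1..l} (C0_space B X))" "v \<in> B"
    then show "\<exists>s. nsums X (antider_term {l+1..k} \<sigma> G A \<xi> \<eta> v) s"
      using continuous_map_antider_\<xi>(1)[OF L G] unfolding antider_summable_def by blast
  qed (auto intro: continuous_map_antider_joint[OF L G] continuous_map_antider_\<xi>(2)[OF L G]
      smooth_antider_\<eta>[OF L G] smooth_antider_\<xi>[OF L G] simp del: One_nat_def)
qed

end
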